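(* Let $\lambda,\mu$ be distinct partitions with $\mu_i\le\lambda_i$ for all $i$. Then the shifted skew diagram $D_{\lambda/\mu}$ is strange (that is, $Q_{\lambda/\mu}=Q_\nu$ for some distinct partition $\nu$) if and only if there exist distinct partitions $\overline{\lambda},\overline{\mu}$ such that $D_{\lambda/\mu}$ coincides, up to a translation of the plane, with $D_{\overline{\lambda}/\overline{\mu}}$, where at least one of the following holds: (1) $\overline{\lambda}$ is arbitrary and $\overline{\mu}=\{\}$ (the empty partition); (2) $\overline{\lambda}=\{m>m-1>\cdots>1\}$ and $\overline{\mu}=\{\mu_1>\cdots>\mu_l\}\subseteq \overline\lambda$ is any distinct partition (with $D_{\overline\mu}\subseteq D_{\overline\lambda}$) with exactly $l$ parts, where $0<l<m-1$; (3) $\overline{\lambda}=\{p+q+r>p+q+r-1>p+q+r-2>\cdots>p\}$ and $\overline{\mu}=\{q>q-1>\cdots>1\}$, where $p,q,r$ are integers with $p,q\ge 1$, $r\ge 0$; (4) $\overline{\lambda}=\{p+q>p+q-1>\cdots>p+q-r\}$ and $\overline{\mu}=\{q>q-1>\cdots>q-r\}$, where $p,q,r$ are integers with $p>0$ and $q>r\ge 0$. (In (2)-(4) all displayed partitions consist of consecutive integers, except $\overline\mu$ in (2).)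
   Context: A distinct partition is a finite (possibly empty) strictly decreasing sequence $\lambda=\{\lambda_1>\dots>\lambda_k\}$ of positive integers; missing parts are taken to be $0$. Its shifted diagram $D_\lambda$ has rows listed from top to bottom, the $i$-th row consisting of $\lambda_i$ boxes placed after $i-1$ empty positions (so row $i$ occupies columns $i,\dots,i+\lambda_i-1$). If $\mu_i\le\lambda_i$ for all $i$, then $D_\mu\subseteq D_\lambda$ and $D_{\lambda/\mu}$ is the set-theoretic difference $D_\lambda\setminus D_\mu$. Consider the ordered alphabet $\mathcal A=\{\overline 1<1<\overline 2<2<\overline 3<3<\cdots\}$; letters $\overline 1,\overline 2,\dots$ are marked, letters $1,2,\dots$ are unmarked. A generalized shifted Young tableau (GSYT) of shape $D_{\lambda/\mu}$ is a filling of its boxes by letters of $\mathcal A$ such that rows (left to right) and columns (top to bottom) are weakly increasing, each row contains each marked letter at most once, and each column contains each unmarked letter at most once. For a GSYT $T$ put $x^T=x_1^{a_1}x_2^{a_2}\cdots$ where $a_s$ is the total number of occurrences of $s$ or $\overline s$ in $T$. In infinitely many variables $x_1,x_2,\dots$, Schur's skew Q-function is $Q_{\lambda/\mu}=\sum_T x^T$, the sum over all GSYT $T$ of shape $D_{\lambda/\mu}$, and $Q_\lambda=Q_{\lambda/\{\}}$ (sum over GSYT of shape $D_\lambda$). *)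

theory Defs
  imports "HOL-Library.FuncSet"
begin

section \<open>Distinct partitions and shifted skew diagrams\<close>

definition distinct_partition :: "nat list \<Rightarrow> bool" where
  "distinct_partition lam \<longleftrightarrow> sorted_wrt (>) lam \<and> (\<forall>x\<in>set lam. 0 < x)"

text \<open>Parts are numbered from 1; missing parts are 0.\<close>

definition part :: "nat list \<Rightarrow> nat \<Rightarrow> nat" where
  "part lam i = (if 1 \<le> i \<and> i \<le> length lam then lam ! (i - 1) else 0)"

definition part_le :: "nat list \<Rightarrow> nat list \<Rightarrow> bool" where
  "part_le mu lam \<longleftrightarrow> (\<forall>i. part mu i \<le> part lam i)"

text \<open>The box in row \<open>i\<close> (counted downwards) and column \<open>j\<close> is the pair \<open>(i, j)\<close>. Boxes have integer
  coordinates so that diagrams can be translated in all directions.\<close>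

type_synonym box = "int \<times> int"

definition shifted_diagram :: "nat list \<Rightarrow> box set" where
  "shifted_diagram lam = {(int i, int j) | i j. 1 \<le> i \<and> i \<le> j \<and> j < i + part lam i}"

definition skew_diagram :: "nat list \<Rightarrow> nat list \<Rightarrow> box set" where
  "skew_diagram lam mu = shifted_diagram lam - shifted_diagram mu"

definition translate :: "int \<Rightarrow> int \<Rightarrow> box set \<Rightarrow> box set" where
  "translate a b D = (\<lambda>(i, j). (i + a, j + b)) ` D"

text \<open>The partition into consecutive parts \<open>a > a - 1 > \<dots> > b\<close>.\<close>

definition consecutive :: "nat \<Rightarrow> nat \<Rightarrow> nat list" where
  "consecutive a b = rev [b..<Suc a]"


section \<open>Generalized shifted Young tableaux\<close>

datatype letter = Marked (index: nat) | Unmarked (index: nat)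

fun is_marked :: "letter \<Rightarrow> bool" where
  "is_marked (Marked _) = True"
| "is_marked (Unmarked _) = False"

instantiation letter :: linorder
begin

definition less_eq_letter :: "letter \<Rightarrow> letter \<Rightarrow> bool" where
  "x \<le> y \<longleftrightarrow> index x < index y \<or> index x = index y \<and> (is_marked x \<or> \<not> is_marked y)"

definition less_letter :: "letter \<Rightarrow> letter \<Rightarrow> bool" where
  "x < y \<longleftrightarrow> x \<le> y \<and> \<not> y \<le> (x :: letter)"

instance
proof
  fix x y z :: letter
  show "x < y \<longleftrightarrow> x \<le> y \<and> \<not> y \<le> x" by (rule less_letter_def)
  show "x \<le> x" by (simp add: less_eq_letter_def)
  show "x \<le> y \<Longrightarrow> y \<le> z \<Longrightarrow> x \<le> z" by (auto simp: less_eq_letter_def)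
  show "x \<le> y \<Longrightarrow> y \<le> x \<Longrightarrow> x = y"
    by (cases x; cases y) (auto simp: less_eq_letter_def)
  show "x \<le> y \<or> y \<le> x" by (auto simp: less_eq_letter_def)
qed

end

lemma letter_order_check:
  "Marked s < Unmarked s" "Unmarked s < Marked (Suc s)"
  by (simp_all add: less_letter_def less_eq_letter_def)

definition alphabet :: "letter set" where
  "alphabet = {x. 1 \<le> index x}"

text \<open>A tableau is a function on boxes that is \<open>undefined\<close> outside its diagram, so that distinct
  tableaux are distinct functions.\<close>

definition gsyt :: "box set \<Rightarrow> (box \<Rightarrow> letter) set" where
  "gsyt D = {T \<in> D \<rightarrow>\<^sub>E alphabet.
     (\<forall>i j j'. (i, j) \<in> D \<and> (i, j') \<in> D \<and> j \<le> j' \<longrightarrow> T (i, j) \<le> T (i, j')) \<and>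
     (\<forall>i i' j. (i, j) \<in> D \<and> (i', j) \<in> D \<and> i \<le> i' \<longrightarrow> T (i, j) \<le> T (i', j)) \<and>
     (\<forall>i j j'. (i, j) \<in> D \<and> (i, j') \<in> D \<and> is_marked (T (i, j)) \<and> T (i, j) = T (i, j')
        \<longrightarrow> j = j') \<and>
     (\<forall>i i' j. (i, j) \<in> D \<and> (i', j) \<in> D \<and> \<not> is_marked (T (i, j)) \<and> T (i, j) = T (i', j)
        \<longrightarrow> i = i')}"

text \<open>The exponent vector of the monomial \<open>x\<^sup>T\<close>.\<close>

definition content :: "box set \<Rightarrow> (box \<Rightarrow> letter) \<Rightarrow> nat \<Rightarrow> nat" where
  "content D T s = card {b \<in> D. index (T b) = s}"


section \<open>Schur Q-functions\<close>

text \<open>A power series in the variables \<open>x\<^sub>1, x\<^sub>2, \<dots>\<close> is represented by its coefficients: it maps an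
  exponent vector to the coefficient of the corresponding monomial. The value at vectors that are
  not finitely supported, or nonzero at 0, is 0 for all series below.\<close>

type_synonym power_series = "(nat \<Rightarrow> nat) \<Rightarrow> int"

definition Q_diagram :: "box set \<Rightarrow> power_series" where
  "Q_diagram D = (\<lambda>a. int (card {T \<in> gsyt D. content D T = a}))"

definition skew_Q :: "nat list \<Rightarrow> nat list \<Rightarrow> power_series" where
  "skew_Q lam mu = Q_diagram (skew_diagram lam mu)"

definition schur_Q :: "nat list \<Rightarrow> power_series" where
  "schur_Q nu = skew_Q nu []"

definition strange :: "nat list \<Rightarrow> nat list \<Rightarrow> bool" where
  "strange lam mu \<longleftrightarrow> (\<exists>nu. distinct_partition nu \<and> skew_Q lam mu = schur_Q nu)"


text \<open>Diagrams are finite and only finitely many tableaux have a given content, so the uses of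
  \<open>card\<close> above are meaningful.\<close>

lemma finite_shifted_diagram: "finite (shifted_diagram lam)"
proof -
  let ?n = "length lam" and ?M = "length lam + sum_list lam"
  have "shifted_diagram lam \<subseteq> {0..int ?n} \<times> {0..int ?M}"
  proof
    fix b assume "b \<in> shifted_diagram lam"
    then obtain i j where b: "b = (int i, int j)" and ij: "1 \<le> i" "i \<le> j" "j < i + part lam i"
      by (auto simp: shifted_diagram_def)
    then have i: "i \<le> ?n" by (auto simp: part_def split: if_splits)
    with ij have "part lam i \<le> sum_list lam"
      by (auto simp: part_def intro!: member_le_sum_list nth_mem)
    with i ij b show "b \<in> {0..int ?n} \<times> {0..int ?M}" by auto
  qed
  then show ?thesis by (rule finite_subset) simp
qed

lemma finite_skew_diagram: "finite (skew_diagram lam mu)"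
  by (simp add: skew_diagram_def finite_shifted_diagram)

lemma finite_gsyt_content:
  assumes "finite D"
  shows "finite {T \<in> gsyt D. content D T = a}"
proof (cases "\<exists>T\<in>gsyt D. content D T = a")
  case False
  then have "{T \<in> gsyt D. content D T = a} = {}" by auto
  then show ?thesis by (simp only: finite.emptyI)
next
  case True
  then obtain T0 where T0: "content D T0 = a" by blast
  define S where "S = (\<lambda>b. index (T0 b)) ` D"
  have "{T \<in> gsyt D. content D T = a} \<subseteq> D \<rightarrow>\<^sub>E (Marked ` S \<union> Unmarked ` S)"
  proof
    fix T assume T: "T \<in> {T \<in> gsyt D. content D T = a}"
    have "T b \<in> Marked ` S \<union> Unmarked ` S" if "b \<in> D" for b
    proof -
      have "content D T (index (T b)) \<noteq> 0"
        using that assms unfolding content_def by (subst card_0_eq) (simp, blast)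
      with T T0 have "content D T0 (index (T b)) \<noteq> 0" by simp
      then have "{c \<in> D. index (T0 c) = index (T b)} \<noteq> {}"
        unfolding content_def by (metis card.empty)
      then obtain c where "c \<in> D" "index (T0 c) = index (T b)" by blast
      then have "index (T b) \<in> S" unfolding S_def by (metis imageI)
      then show ?thesis by (cases "T b") auto
    qed
    with T show "T \<in> D \<rightarrow>\<^sub>E (Marked ` S \<union> Unmarked ` S)"
      by (auto simp: gsyt_def PiE_iff)
  qed
  moreover have "finite (D \<rightarrow>\<^sub>E (Marked ` S \<union> Unmarked ` S))"
    using assms by (intro finite_PiE) (auto simp: S_def)
  ultimately show ?thesis by (rule finite_subset)
qed

end

theory Submission
  imports "HOL-Library.Multiset" "HOL-Computational_Algebra.Polynomial" Defs
begin

text \<open>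
A strict partition is treated as a finite set of positive integers. The number of boxes of its shifted diagram
on the diagonal \<open>e\<close>, the boxes \<open>(i, i + e - 1)\<close>, is the number of parts that are at least \<open>e\<close>. The letters of one index occupy a strip having
at most one box on each diagonal, so Q-functions are matrix entries of products of strip operators: the
entry from \<open>A\<close> to \<open>B\<close> is \<open>2\<close> to the number of elements of \<open>A - B\<close> if \<open>A\<close> and \<open>B\<close> interlace. These operators
commute by a Yang--Baxter argument, which makes Q-functions symmetric; complementation in \<open>{1..N}\<close>
transposes them, which is reflection of a diagram in an antidiagonal.

If \<open>D\<close> is strange, then so is \<open>D\<close> without its outermost layer, since this is the coefficient of the top power of
\<open>x\<^sub>1\<close>, and the layer is connected. Comparing the coefficients of the second highest power of \<open>x\<^sub>1\<close> shows that the
inner partition is empty unless the two largest parts of the outer one are consecutive; with reflection and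
induction this leaves only the diagrams listed.

Conversely, triangles without a diagram are reflections of diagrams. For the trapezoid
\<open>{p..n}\<close> over \<open>{1..q}\<close>, expand the skew Q-function in Q-functions. The contribution of those with first
part \<open>n\<close> is determined by the trapezoid without its outermost layer. By reflection the remaining coefficients are
structure constants of the product of the P-functions of \<open>{1..q}\<close> and \<open>{1..p - 1}\<close>, whose degree in \<open>x\<^sub>1\<close> is
only \<open>q + p - 1 < n\<close>.
\<close>


section \<open>Strict partitions as sets\<close>

text \<open>The necessity part rests on factors 2. A layer contributes one factor 2 for each of its
  components, whereas over the empty partition a layer is a row and contributes exactly 2; comparing
  the two products layer by layer leaves no room for a disconnected layer. The second highest power
  is not computed but estimated: from below by keeping two strips only, each of them the full layer
  with one box left out, and from above because a further box at the end of the first row multiplies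
  the series by at most \<open>q_1\<close>, twice the sum of the variables. As all coefficients are
  nonnegative, these estimates contradict each other unless the diagram has the right form. The
  sufficiency part needs products of P-functions, yet no ring of symmetric functions is built.
  Formal combinations of exponent words act as commuting matrices, the dual basis is defined through
  their entries towards the empty partition, and multiplication is read off from a skew diagram
  whose first row lies so far to the right that it is disconnected from the rest.\<close>

definition parts :: "nat set \<Rightarrow> bool" where
  "parts A \<longleftrightarrow> finite A \<and> 0 \<notin> A"

definition cnt :: "nat set \<Rightarrow> nat \<Rightarrow> nat" where
  "cnt A e = card {x \<in> A. e \<le> x}"

lemma parts_finite [simp]: "parts A \<Longrightarrow> finite A"
  by (simp add: parts_def)

lemma parts_subset: "A \<subseteq> {1..N} \<Longrightarrow> parts A"
  by (auto simp: parts_def intro: finite_subset)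

lemma parts_bounded: "parts A \<Longrightarrow> \<exists>N. A \<subseteq> {1..N}"
proof -
  assume "parts A"
  then have "A \<subseteq> {1..Max A}"
    by (auto simp: parts_def Suc_le_eq intro: gr0I)
  then show ?thesis ..
qed

lemma cnt_Suc: "finite A \<Longrightarrow> cnt A e = cnt A (Suc e) + of_bool (e \<in> A)"
proof -
  assume A: "finite A"
  have "{x \<in> A. e \<le> x} = {x \<in> A. Suc e \<le> x} \<union> (if e \<in> A then {e} else {})"
    by (auto simp: Suc_le_eq order_le_less)
  then show ?thesis
    using A by (auto simp: cnt_def)
qed

lemma cnt_mem: "finite A \<Longrightarrow> e \<in> A \<longleftrightarrow> cnt A e = Suc (cnt A (Suc e))"
  using cnt_Suc[of A e] by auto

lemma cnt_antimono: "finite A \<Longrightarrow> e \<le> f \<Longrightarrow> cnt A f \<le> cnt A e"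
  unfolding cnt_def by (rule card_mono) auto

lemma cnt_eq_0_iff: "finite A \<Longrightarrow> cnt A e = 0 \<longleftrightarrow> (\<forall>x\<in>A. x < e)"
  by (auto simp: cnt_def not_le)

lemma cnt_0: "0 \<notin> A \<Longrightarrow> cnt A 0 = cnt A 1"
  unfolding cnt_def by (rule arg_cong[where f=card]) (auto simp: Suc_le_eq intro: Suc_leI gr0I)

lemma cnt_0': "0 \<notin> A \<Longrightarrow> cnt A 0 = card A"
  by (simp add: cnt_def)

lemma cnt_empty [simp]: "cnt {} e = 0"
  by (simp add: cnt_def)

lemma cnt_insert: "finite A \<Longrightarrow> t \<notin> A \<Longrightarrow> cnt (insert t A) e = cnt A e + of_bool (e \<le> t)"
proof -
  assume A: "finite A" "t \<notin> A"
  have "{x \<in> insert t A. e \<le> x} = (if e \<le> t then insert t {x \<in> A. e \<le> x} else {x \<in> A. e \<le> x})"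
    by auto
  then show ?thesis
    using A by (auto simp: cnt_def)
qed

lemma sum_cnt: "A \<subseteq> {1..N} \<Longrightarrow> \<Sum>A = (\<Sum>e=1..N. cnt A e)"
proof (induction N arbitrary: A)
  case 0
  then show ?case by auto
next
  case (Suc N)
  have fin: "finite A" using Suc.prems finite_subset by blast
  show ?case
  proof (cases "Suc N \<in> A")
    case False
    then have A: "A \<subseteq> {1..N}" using Suc.prems by (auto simp: le_Suc_eq)
    then have "cnt A (Suc N) = 0" using fin by (auto simp: cnt_eq_0_iff)
    then show ?thesis using Suc.IH[OF A] by simp
  next
    case True
    define A' where "A' = A - {Suc N}"
    have A': "A' \<subseteq> {1..N}" "A = insert (Suc N) A'" "Suc N \<notin> A'"
      using Suc.prems True by (auto simp: A'_def le_Suc_eq)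
    have fin': "finite A'" using fin by (simp add: A'_def)
    have "cnt A' (Suc N) = 0" using fin' A' by (auto simp: cnt_eq_0_iff)
    moreover have "(\<Sum>e=1..N. cnt A e) = (\<Sum>e=1..N. cnt A' e + 1)"
      using A' fin' by (intro sum.cong) (auto simp: cnt_insert)
    ultimately show ?thesis
      using Suc.IH[OF A'(1)] A' fin' by (simp add: cnt_insert sum_Suc)
  qed
qed

text \<open>The parts are the places where \<open>c\<close> drops. Layers and order ideals of boxes
  are known by their diagonal lengths and become partitions through this criterion.\<close>

lemma cnt_exists:
  assumes step: "\<And>e. 1 \<le> e \<Longrightarrow> c (Suc e) \<le> c e \<and> c e \<le> Suc (c (Suc e))"
    and fin: "\<And>e. N < e \<Longrightarrow> c e = (0::nat)"
  shows "\<exists>A \<subseteq> {1..N}. \<forall>e\<ge>1. cnt A e = c e"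
proof (intro exI conjI allI impI)
  let ?A = "{e \<in> {1..N}. c e = Suc (c (Suc e))}"
  show "?A \<subseteq> {1..N}" by auto
  fix e :: nat
  assume "1 \<le> e"
  then show "cnt ?A e = c e"
  proof (induction "Suc N - e" arbitrary: e)
    case 0
    then show ?case using fin[of e] by (subst cnt_eq_0_iff[THEN iffD2]) auto
  next
    case (Suc n)
    then have "cnt ?A (Suc e) = c (Suc e)" by auto
    moreover have "e \<in> ?A \<longleftrightarrow> c e = Suc (c (Suc e))" using Suc by auto
    moreover have "c e = Suc (c (Suc e)) \<or> c e = c (Suc e)"
      using step[of e] Suc.prems by auto
    ultimately show ?case using cnt_Suc[of ?A e] by auto
  qed
qed

section \<open>Interlacing and weights of strips\<close>

definition interlaced :: "nat set \<Rightarrow> nat set \<Rightarrow> bool" where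
  "interlaced A B \<longleftrightarrow> (\<forall>e\<ge>1. cnt B e \<le> cnt A e \<and> cnt A e \<le> Suc (cnt B e))"

text \<open>The exponent is the number of components of the strip: the highest diagonal of each
  component is a part of \<open>A\<close> but not of \<open>B\<close>. In each component exactly one
  box is free to be marked or unmarked.\<close>

definition weight :: "nat set \<Rightarrow> nat set \<Rightarrow> real" where
  "weight A B = (if interlaced A B then 2 ^ card (A - B) else 0)"

text \<open>Unlike \<open>Pow {1..N}\<close>, this index set depends on \<open>A\<close> alone, so
  that \<open>strips\<close> needs no bound \<open>N\<close>; \<open>sum_below\<close> passes
  between the two.\<close>

definition below :: "nat set \<Rightarrow> nat set set" where
  "below A = {S. parts S \<and> interlaced A S}"

lemma cnt_le_subset:
  assumes "A \<subseteq> {1..N}" "parts B" "\<And>e. 1 \<le> e \<Longrightarrow> cnt B e \<le> cnt A e"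
  shows "B \<subseteq> {1..N}"
proof
  fix x assume "x \<in> B"
  then have "1 \<le> x" using assms(2) by (cases x) (auto simp: parts_def)
  moreover have "cnt B x > 0" using \<open>x \<in> B\<close> assms(2) cnt_eq_0_iff[of B x] by auto
  ultimately have "cnt A x > 0" using assms(3)[of x] by simp
  moreover have "finite A" using assms(1) finite_subset by blast
  ultimately obtain y where "y \<in> A" "x \<le> y"
    using cnt_eq_0_iff[of A x] by (auto simp: not_less)
  then show "x \<in> {1..N}" using \<open>1 \<le> x\<close> assms(1) by force
qed

lemma below_subset: "A \<subseteq> {1..N} \<Longrightarrow> below A \<subseteq> Pow {1..N}"
  unfolding below_def interlaced_def by (blast dest: cnt_le_subset)

lemma finite_below: "parts A \<Longrightarrow> finite (below A)"
  using parts_bounded below_subset by (meson finite_Pow_iff finite_atLeastAtMost finite_subset)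

lemma sum_below:
  assumes "A \<subseteq> {1..N}"
  shows "(\<Sum>S\<in>below A. weight A S * f S) = (\<Sum>S\<in>Pow {1..N}. weight A S * f S)"
proof (rule sum.mono_neutral_left)
  show "below A \<subseteq> Pow {1..N}" using below_subset[OF assms] .
  show "\<forall>i\<in>Pow {1..N} - below A. weight A i * f i = 0"
    using parts_subset by (auto simp: below_def weight_def)
qed simp

text \<open>The matrix \<open>weight A B * x ^ (\<Sum>A - \<Sum>B)\<close> is the row partition function of a vertex model: scan
  the columns from \<open>n\<close> down to 1, the horizontal edge recording \<open>cnt A - cnt B\<close>.\<close>

definition vertex_weight :: "real \<Rightarrow> bool \<Rightarrow> bool \<Rightarrow> bool \<Rightarrow> real" where
  "vertex_weight x h a b = (if h then (if a then (if b then x else 0) else (if b then 1 else x))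
                  else (if a then (if b then 1 else 2 * x) else (if b then 0 else 1)))"

definition vertex_out :: "bool \<Rightarrow> bool \<Rightarrow> bool \<Rightarrow> bool" where
  "vertex_out h a b = (if h then a \<or> \<not> b else a \<and> \<not> b)"

primrec row_weight :: "real \<Rightarrow> nat \<Rightarrow> nat set \<Rightarrow> nat set \<Rightarrow> bool \<Rightarrow> real" where
  "row_weight x 0 A B h = 1"
| "row_weight x (Suc n) A B h = vertex_weight x h (Suc n \<in> A) (Suc n \<in> B)
      * row_weight x n A B (vertex_out h (Suc n \<in> A) (Suc n \<in> B))"

lemma row_weight_cong:
  "(\<And>e. e \<in> {1..n} \<Longrightarrow> e \<in> A \<longleftrightarrow> e \<in> A') \<Longrightarrow> (\<And>e. e \<in> {1..n} \<Longrightarrow> e \<in> B \<longleftrightarrow> e \<in> B')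
    \<Longrightarrow> row_weight x n A B h = row_weight x n A' B' h"
  by (induction n arbitrary: h) auto

text \<open>The state that the horizontal edge would have after column \<open>e\<close>, if the scan
  enters column \<open>n\<close> in state \<open>h\<close>. The row is allowed iff all these
  integers are 0 or 1.\<close>

definition edge_excess :: "nat set \<Rightarrow> nat set \<Rightarrow> nat \<Rightarrow> bool \<Rightarrow> nat \<Rightarrow> int" where
  "edge_excess A B n h e = of_bool h + int (card (A \<inter> {e..n})) - int (card (B \<inter> {e..n}))"

lemma edge_excess_Suc_aux: "e \<le> Suc n \<Longrightarrow> card (A \<inter> {e..Suc n}) = card (A \<inter> {e..n}) + of_bool (Suc n \<in> A)"
proof -
  assume "e \<le> Suc n"
  then have "A \<inter> {e..Suc n} = (A \<inter> {e..n}) \<union> (if Suc n \<in> A then {Suc n} else {})"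
    by (auto simp: le_Suc_eq)
  then show ?thesis by auto
qed

text \<open>Each occupied outgoing edge costs \<open>x\<close>, each part of \<open>A\<close>
  missing from \<open>B\<close> costs 2, and a forbidden vertex is met as soon as an edge would
  leave the states 0 and 1.\<close>

lemma row_weight_eq:
  "row_weight x n A B h = (if \<forall>e\<in>{1..n}. edge_excess A B n h e \<in> {0, 1}
     then 2 ^ card ((A - B) \<inter> {1..n}) * x ^ nat (\<Sum>e=1..n. edge_excess A B n h e) else 0)"
proof (induction n arbitrary: h)
  case 0
  then show ?case by simp
next
  case (Suc n)
  let ?a = "Suc n \<in> A" and ?b = "Suc n \<in> B"
  let ?h' = "vertex_out h ?a ?b"
  show ?case
  \<comment> \<open>The two forbidden vertices, whose outgoing edge would have state 2 or -1; the
    value of \<open>vertex_out\<close> has no meaning there.\<close>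
  proof (cases "(h \<and> ?a \<and> \<not> ?b) \<or> (\<not> h \<and> \<not> ?a \<and> ?b)")
    case True
    then have "edge_excess A B (Suc n) h (Suc n) \<notin> {0, 1}"
      by (auto simp: edge_excess_def)
    moreover have "vertex_weight x h ?a ?b = 0" using True by (auto simp: vertex_weight_def)
    moreover have "Suc n \<in> {1..Suc n}" by simp
    ultimately have "\<not> (\<forall>e\<in>{1..Suc n}. edge_excess A B (Suc n) h e \<in> {0, 1})" by blast
    with \<open>vertex_weight x h ?a ?b = 0\<close> show ?thesis by (simp only: row_weight.simps if_False mult_zero_left)
  next
    case False
    have top: "edge_excess A B (Suc n) h (Suc n) = of_bool ?h'"
      using False by (cases h; cases ?a; cases ?b) (auto simp: edge_excess_def vertex_out_def)
    have low: "edge_excess A B (Suc n) h e = edge_excess A B n ?h' e" if "e \<in> {1..n}" for e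
      using False that edge_excess_Suc_aux[of e n A] edge_excess_Suc_aux[of e n B]
      by (cases h; cases ?a; cases ?b) (auto simp: edge_excess_def vertex_out_def)
    have cond: "(\<forall>e\<in>{1..Suc n}. edge_excess A B (Suc n) h e \<in> {0, 1})
        \<longleftrightarrow> (\<forall>e\<in>{1..n}. edge_excess A B n ?h' e \<in> {0, 1})"
    proof -
      have "{1..Suc n} = insert (Suc n) {1..n}" by auto
      then show ?thesis using top low by auto
    qed
    have "(\<Sum>e=1..n. edge_excess A B (Suc n) h e) = (\<Sum>e=1..n. edge_excess A B n ?h' e)"
      using low by (intro sum.cong) auto
    then have sums: "(\<Sum>e=1..Suc n. edge_excess A B (Suc n) h e) = (\<Sum>e=1..n. edge_excess A B n ?h' e) + of_bool ?h'"
      using top by simp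
    have nn: "(\<Sum>e=1..n. edge_excess A B n ?h' e) \<ge> 0" if "\<forall>e\<in>{1..n}. edge_excess A B n ?h' e \<in> {0, 1}"
      using that by (intro sum_nonneg) force
    have card: "card ((A - B) \<inter> {1..Suc n}) = card ((A - B) \<inter> {1..n}) + of_bool (?a \<and> \<not> ?b)"
      using edge_excess_Suc_aux[of 1 n "A - B"] by simp
    show ?thesis
      unfolding row_weight.simps Suc.IH cond sums card
      using nn False
      by (cases h; cases ?a; cases ?b) (auto simp: vertex_weight_def vertex_out_def nat_add_distrib)
  qed
qed

lemma cnt_Int: "A \<subseteq> {1..N} \<Longrightarrow> card (A \<inter> {e..N}) = cnt A e"
  unfolding cnt_def by (rule arg_cong[where f=card]) auto

lemma row_weight_weight:
  assumes A: "A \<subseteq> {1..N}" and B: "B \<subseteq> {1..N}"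
  shows "row_weight x N A B False = weight A B * x ^ (\<Sum>A - \<Sum>B)"
proof -
  have d: "edge_excess A B N False e = int (cnt A e) - int (cnt B e)" for e
    using A B by (simp add: edge_excess_def cnt_Int)
  have z: "cnt A e = 0" "cnt B e = 0" if "e > N" for e
    using that A B finite_subset[OF A] finite_subset[OF B] by (auto simp: cnt_eq_0_iff subset_iff)
  have i: "(\<forall>e\<in>{1..N}. edge_excess A B N False e \<in> {0, 1}) \<longleftrightarrow> interlaced A B"
  proof
    assume *: "\<forall>e\<in>{1..N}. edge_excess A B N False e \<in> {0, 1}"
    show "interlaced A B" unfolding interlaced_def
    proof (intro allI impI)
      fix e :: nat assume "1 \<le> e"
      then show "cnt B e \<le> cnt A e \<and> cnt A e \<le> Suc (cnt B e)"
        using * z[of e] by (cases "e \<le> N") (auto simp: d dest!: bspec[where x=e])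
    qed
  next
    assume *: "interlaced A B"
    show "\<forall>e\<in>{1..N}. edge_excess A B N False e \<in> {0, 1}"
    proof
      fix e assume "e \<in> {1..N}"
      then have "cnt B e \<le> cnt A e \<and> cnt A e \<le> Suc (cnt B e)" using * by (auto simp: interlaced_def)
      then show "edge_excess A B N False e \<in> {0, 1}" unfolding d by auto
    qed
  qed
  have "(\<Sum>e=1..N. edge_excess A B N False e) = int (\<Sum>A) - int (\<Sum>B)"
    unfolding d sum_cnt[OF A] sum_cnt[OF B] by (simp add: sum_subtractf)
  moreover have "(A - B) \<inter> {1..N} = A - B" using A by auto
  ultimately show ?thesis
    unfolding row_weight_eq i weight_def by (simp add: nat_diff_distrib' del: of_nat_sum)
qed

lemma sum_Pow_Suc:
  "(\<Sum>S\<in>Pow {1..Suc n}. f S) = (\<Sum>S\<in>Pow {1..n}. f S + f (insert (Suc n) S))"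
proof -
  have eq: "{1..Suc n} = insert (Suc n) {1..n}" by auto
  have "(\<Sum>S\<in>Pow {1..Suc n}. f S) = (\<Sum>S\<in>Pow {1..n}. f S) + sum f (insert (Suc n) ` Pow {1..n})"
    unfolding eq Pow_insert by (rule sum.union_disjoint) auto
  also have "sum f (insert (Suc n) ` Pow {1..n}) = (\<Sum>S\<in>Pow {1..n}. f (insert (Suc n) S))"
  proof (rule sum.reindex_cong[OF _ refl refl])
    show "inj_on (insert (Suc n)) (Pow {1..n})"
    proof (rule inj_onI)
      fix S T assume "S \<in> Pow {1..n}" "T \<in> Pow {1..n}" "insert (Suc n) S = insert (Suc n) T"
      moreover from this have "Suc n \<notin> S" "Suc n \<notin> T" by auto
      ultimately show "S = T" using insert_ident by metis
    qed
  qed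
  finally show ?thesis by (simp add: sum.distrib)
qed

definition row_pair_weight :: "real \<Rightarrow> real \<Rightarrow> nat \<Rightarrow> nat set \<Rightarrow> nat set \<Rightarrow> bool \<Rightarrow> bool \<Rightarrow> real" where
  "row_pair_weight x y n A C h k = (\<Sum>S\<in>Pow {1..n}. row_weight x n A S h * row_weight y n S C k)"

lemma row_pair_weight_Suc:
  "row_pair_weight x y (Suc n) A C h k =
     vertex_weight x h (Suc n \<in> A) False * vertex_weight y k False (Suc n \<in> C)
       * row_pair_weight x y n A C (vertex_out h (Suc n \<in> A) False) (vertex_out k False (Suc n \<in> C))
   + vertex_weight x h (Suc n \<in> A) True * vertex_weight y k True (Suc n \<in> C)
       * row_pair_weight x y n A C (vertex_out h (Suc n \<in> A) True) (vertex_out k True (Suc n \<in> C))"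
proof -
  have "row_weight x n A (insert (Suc n) S) h' = row_weight x n A S h'"
      "row_weight y n (insert (Suc n) S) C h' = row_weight y n S C h'" for S h'
    by (intro row_weight_cong; auto)+
  moreover have "Suc n \<notin> S" if "S \<in> Pow {1..n}" for S
    using that by auto
  ultimately show ?thesis
    unfolding row_pair_weight_def sum_Pow_Suc sum.distrib sum_distrib_left
    by (intro arg_cong2[where f="(+)"] sum.cong refl) (auto simp: mult_ac)
qed

text \<open>The Yang--Baxter relation: an intertwiner on the pair of horizontal edges, found from the
  vertex with two empty vertical edges.\<close>

lemma row_pair_weight_swap:
  assumes "x > 0" "y > 0"
  shows "row_pair_weight x y n A C False False = row_pair_weight y x n A C False False \<and>
    row_pair_weight x y n A C True True = row_pair_weight y x n A C True True \<and>
    (x + y) * row_pair_weight x y n A C False True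
      = (y - x) * row_pair_weight y x n A C True False + 2 * x * row_pair_weight y x n A C False True \<and>
    (x + y) * row_pair_weight x y n A C True False
      = 2 * y * row_pair_weight y x n A C True False + (x - y) * row_pair_weight y x n A C False True"
proof (induction n)
  case 0
  then show ?case by (simp add: row_pair_weight_def)
next
  case (Suc n)
  have xy: "x + y \<noteq> 0" using assms by simp
  define u1 u2 u3 u4 where u: "u1 = row_pair_weight x y n A C False False" "u2 = row_pair_weight x y n A C True True"
     "u3 = row_pair_weight x y n A C False True" "u4 = row_pair_weight x y n A C True False"
  define v1 v2 v3 v4 where v: "v1 = row_pair_weight y x n A C False False" "v2 = row_pair_weight y x n A C True True"
     "v3 = row_pair_weight y x n A C False True" "v4 = row_pair_weight y x n A C True False"
  have e: "u1 = v1" "u2 = v2" "(x + y) * u3 = (y - x) * v4 + 2 * x * v3"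
     "(x + y) * u4 = 2 * y * v4 + (x - y) * v3"
    using Suc.IH by (simp_all add: u v)
  \<comment> \<open>Only the mixed states carry the denominator \<open>x + y\<close>, which
    positivity keeps away from 0. The identity used later concerns the state without horizontal
    edges, but the scan passes through the mixed ones.\<close>
  have u3: "u3 = ((y - x) * v4 + 2 * x * v3) / (x + y)" and u4: "u4 = (2 * y * v4 + (x - y) * v3) / (x + y)"
    using e xy by (simp_all add: field_simps)
  show ?case
    unfolding row_pair_weight_Suc
    apply (cases "Suc n \<in> A"; cases "Suc n \<in> C")
    apply (simp_all add: vertex_weight_def vertex_out_def flip: u v)
    apply (simp_all add: e(1,2) u3 u4)
    using xy
    apply (simp_all add: divide_simps)
    apply (simp_all add: algebra_simps)
    done
qed

section \<open>Commuting strip operators\<close>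

lemma weight_nonneg: "0 \<le> weight A B"
  by (simp add: weight_def)

lemma interlaced_sum:
  assumes "parts A" "parts B" "\<And>e. 1 \<le> e \<Longrightarrow> cnt B e \<le> cnt A e"
  shows "\<Sum>B \<le> \<Sum>A"
proof -
  obtain N where N: "A \<subseteq> {1..N}" using parts_bounded assms by blast
  then have N': "B \<subseteq> {1..N}" using assms cnt_le_subset by blast
  show ?thesis
    unfolding sum_cnt[OF N] sum_cnt[OF N'] by (intro sum_mono) (use assms(3) in auto)
qed

lemma weight_commute:
  assumes A: "A \<subseteq> {1..N}" and C: "C \<subseteq> {1..N}" and xy: "0 < x" "0 < y"
  shows "(\<Sum>S\<in>Pow {1..N}. weight A S * weight S C * x ^ (\<Sum>A - \<Sum>S) * y ^ (\<Sum>S - \<Sum>C))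
       = (\<Sum>S\<in>Pow {1..N}. weight A S * weight S C * y ^ (\<Sum>A - \<Sum>S) * x ^ (\<Sum>S - \<Sum>C))"
proof -
  have "(\<Sum>S\<in>Pow {1..N}. weight A S * weight S C * x ^ (\<Sum>A - \<Sum>S) * y ^ (\<Sum>S - \<Sum>C))
      = row_pair_weight x y N A C False False" for x y
    unfolding row_pair_weight_def using assms by (intro sum.cong) (auto simp: row_weight_weight)
  then show ?thesis using row_pair_weight_swap[OF xy, of N A C] by simp
qed

lemma poly_eq_on_pos:
  fixes p q :: "real poly"
  assumes "\<And>x. 0 < x \<Longrightarrow> poly p x = poly q x"
  shows "p = q"
proof (rule ccontr)
  assume "p \<noteq> q"
  then have "finite {x. poly (p - q) x = 0}" by (intro poly_roots_finite) simp
  moreover have "{0<..} \<subseteq> {x. poly (p - q) x = 0}" using assms by auto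
  ultimately show False using infinite_Ioi finite_subset by blast
qed

text \<open>The free function \<open>\<phi>\<close> of the size of the strip serves two purposes:
  \<open>delta k\<close> extracts the coefficient of the power \<open>k\<close> of a variable,
  \<open>geom x\<close> substitutes a real number for it.\<close>

definition strip :: "(nat \<Rightarrow> real) \<Rightarrow> nat set \<Rightarrow> nat set \<Rightarrow> real" where
  "strip \<phi> A B = weight A B * \<phi> (\<Sum>A - \<Sum>B)"

text \<open>The sizes of the two strips from \<open>A\<close> over \<open>S\<close> to
  \<open>C\<close> add up to a constant, so the weighted distribution of one size decides
  everything. Commutation for powers says that both sizes have the same distribution.\<close>

lemma strip_commute:
  assumes A: "A \<subseteq> {1..N}" and C: "C \<subseteq> {1..N}"
  shows "(\<Sum>S\<in>Pow {1..N}. strip \<phi> A S * strip \<psi> S C) = (\<Sum>S\<in>Pow {1..N}. strip \<psi> A S * strip \<phi> S C)"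
proof -
  define P where "P = Pow {1..N}"
  define c where "c S = weight A S * weight S C" for S
  define n where "n = \<Sum>A - \<Sum>C"
  have cs: "\<Sum>S - \<Sum>C = n - (\<Sum>A - \<Sum>S) \<and> \<Sum>A - \<Sum>S = n - (\<Sum>S - \<Sum>C)
      \<and> \<Sum>A - \<Sum>S \<le> n \<and> \<Sum>S - \<Sum>C \<le> n" if "S \<in> P" "c S \<noteq> 0" for S
  proof -
    have "interlaced A S" "interlaced S C" using that by (auto simp: c_def weight_def split: if_splits)
    moreover have "parts A" "parts S" "parts C" using A C that parts_subset by (auto simp: P_def)
    ultimately have "\<Sum>S \<le> \<Sum>A" "\<Sum>C \<le> \<Sum>S" by (auto simp: interlaced_def intro: interlaced_sum)
    then show ?thesis by (auto simp: n_def)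
  qed
  define p where "p = (\<Sum>S\<in>P. monom (c S) (\<Sum>A - \<Sum>S))"
  define q where "q = (\<Sum>S\<in>P. monom (c S) (\<Sum>S - \<Sum>C))"
  \<comment> \<open>Since the two exponents add up to \<open>n\<close>, nothing is lost by setting
    the second variable to 1.\<close>
  have "poly p x = poly q x" if "x > 0" for x
    using weight_commute[OF A C that zero_less_one]
    by (simp add: p_def q_def poly_sum poly_monom c_def P_def)
  then have pq: "p = q" by (rule poly_eq_on_pos)
  have pick: "(\<Sum>i\<le>n. (if i = k then b else 0) * \<phi> i * \<psi> (n - i))
      = (if k \<le> n then b * \<phi> k * \<psi> (n - k) else 0)" for k b
  proof -
    have "(\<Sum>i\<le>n. (if i = k then b else 0) * \<phi> i * \<psi> (n - i))
        = (\<Sum>i\<le>n. if i = k then b * \<phi> i * \<psi> (n - i) else 0)"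
      by (rule sum.cong) auto
    then show ?thesis by simp
  qed
  have swap: "(\<Sum>S\<in>P. \<Sum>i\<le>n. (if i = g S then c S else 0) * \<phi> i * \<psi> (n - i))
      = (\<Sum>i\<le>n. coeff (\<Sum>S\<in>P. monom (c S) (g S)) i * \<phi> i * \<psi> (n - i))" for g
  proof -
    have "coeff (\<Sum>S\<in>P. monom (c S) (g S)) i = (\<Sum>S\<in>P. if i = g S then c S else 0)" for i
      unfolding coeff_sum coeff_monom by (rule sum.cong) auto
    then show ?thesis by (simp only: sum_distrib_right) (rule sum.swap)
  qed
  have "(\<Sum>S\<in>P. strip \<phi> A S * strip \<psi> S C) = (\<Sum>S\<in>P. \<Sum>i\<le>n. (if i = \<Sum>A - \<Sum>S then c S else 0) * \<phi> i * \<psi> (n - i))"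
  proof (rule sum.cong[OF refl])
    fix S assume S: "S \<in> P"
    show "strip \<phi> A S * strip \<psi> S C = (\<Sum>i\<le>n. (if i = \<Sum>A - \<Sum>S then c S else 0) * \<phi> i * \<psi> (n - i))"
    proof (cases "c S = 0")
      case True
      then show ?thesis unfolding pick by (auto simp: strip_def c_def)
    next
      case False
      then have "\<Sum>S - \<Sum>C = n - (\<Sum>A - \<Sum>S)" "\<Sum>A - \<Sum>S \<le> n" using cs[OF S] by blast+
      then show ?thesis unfolding pick strip_def c_def by simp
    qed
  qed
  also have "\<dots> = (\<Sum>i\<le>n. coeff p i * \<phi> i * \<psi> (n - i))"
    unfolding p_def by (rule swap)
  also have "\<dots> = (\<Sum>i\<le>n. coeff q i * \<phi> i * \<psi> (n - i))" by (simp add: pq)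
  also have "\<dots> = (\<Sum>S\<in>P. \<Sum>i\<le>n. (if i = \<Sum>S - \<Sum>C then c S else 0) * \<phi> i * \<psi> (n - i))"
    unfolding q_def by (rule swap[symmetric])
  also have "\<dots> = (\<Sum>S\<in>P. strip \<psi> A S * strip \<phi> S C)"
  proof (rule sum.cong[OF refl])
    fix S assume S: "S \<in> P"
    show "(\<Sum>i\<le>n. (if i = \<Sum>S - \<Sum>C then c S else 0) * \<phi> i * \<psi> (n - i)) = strip \<psi> A S * strip \<phi> S C"
    proof (cases "c S = 0")
      case True
      then show ?thesis unfolding pick by (auto simp: strip_def c_def)
    next
      case False
      then have "\<Sum>A - \<Sum>S = n - (\<Sum>S - \<Sum>C)" "\<Sum>S - \<Sum>C \<le> n" using cs[OF S] by blast+
      then show ?thesis unfolding pick strip_def c_def by simp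
    qed
  qed
  finally show ?thesis by (simp add: P_def)
qed

text \<open>An entry of a product of strip operators; the head of the list acts at the outer
  boundary.\<close>

primrec strips :: "(nat \<Rightarrow> real) list \<Rightarrow> nat set \<Rightarrow> nat set \<Rightarrow> real" where
  "strips [] A B = of_bool (A = B)"
| "strips (\<phi> # \<phi>s) A B = (\<Sum>S\<in>below A. strip \<phi> A S * strips \<phi>s S B)"

lemma strips_Cons:
  assumes "A \<subseteq> {1..N}"
  shows "strips (\<phi> # \<phi>s) A B = (\<Sum>S\<in>Pow {1..N}. strip \<phi> A S * strips \<phi>s S B)"
  using sum_below[OF assms, of "\<lambda>S. \<phi> (\<Sum>A - \<Sum>S) * strips \<phi>s S B"] by (simp add: strip_def mult.assoc)

declare strips.simps(2) [simp del]

lemma strips_append: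
  assumes "A \<subseteq> {1..N}"
  shows "strips (u @ v) A B = (\<Sum>S\<in>Pow {1..N}. strips u A S * strips v S B)"
  using assms
proof (induction u arbitrary: A)
  case Nil
  have "(\<Sum>S\<in>Pow {1..N}. strips [] A S * strips v S B) = (\<Sum>S\<in>Pow {1..N}. if S = A then strips v S B else 0)"
    by (intro sum.cong) auto
  then show ?case using Nil by simp
next
  case (Cons \<phi> u)
  have "strips ((\<phi> # u) @ v) A B
      = (\<Sum>T\<in>Pow {1..N}. \<Sum>S\<in>Pow {1..N}. strip \<phi> A T * (strips u T S * strips v S B))"
    using Cons by (simp add: strips_Cons sum_distrib_left)
  also have "\<dots> = (\<Sum>S\<in>Pow {1..N}. \<Sum>T\<in>Pow {1..N}. strip \<phi> A T * (strips u T S * strips v S B))"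
    by (rule sum.swap)
  also have "\<dots> = (\<Sum>S\<in>Pow {1..N}. strips (\<phi> # u) A S * strips v S B)"
    using Cons.prems by (simp add: strips_Cons sum_distrib_right mult.assoc)
  finally show ?case .
qed

lemma strips_single: "parts A \<Longrightarrow> parts B \<Longrightarrow> strips [\<phi>] A B = strip \<phi> A B"
proof -
  assume "parts A" "parts B"
  then obtain N where "A \<union> B \<subseteq> {1..N}" using parts_bounded[of "A \<union> B"] by (auto simp: parts_def)
  moreover have "(\<Sum>S\<in>Pow {1..N}. strip \<phi> A S * of_bool (S = B)) = (\<Sum>S\<in>Pow {1..N}. if S = B then strip \<phi> A B else 0)"
    by (intro sum.cong) auto
  ultimately show ?thesis by (simp add: strips_Cons[of A N])
qed

lemma strips_swap:
  assumes "parts A"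
  shows "strips (\<phi> # \<psi> # v) A B = strips (\<psi> # \<phi> # v) A B"
proof -
  obtain N where N: "A \<subseteq> {1..N}" using parts_bounded[OF assms] by blast
  have *: "strips (\<phi> # \<psi> # v) A B = (\<Sum>T\<in>Pow {1..N}. (\<Sum>S\<in>Pow {1..N}. strip \<phi> A S * strip \<psi> S T) * strips v T B)" for \<phi> \<psi>
  proof -
    have "strips (\<phi> # \<psi> # v) A B = (\<Sum>S\<in>Pow {1..N}. \<Sum>T\<in>Pow {1..N}. strip \<phi> A S * (strip \<psi> S T * strips v T B))"
      using N by (simp add: strips_Cons sum_distrib_left)
    also have "\<dots> = (\<Sum>T\<in>Pow {1..N}. \<Sum>S\<in>Pow {1..N}. strip \<phi> A S * (strip \<psi> S T * strips v T B))"
      by (rule sum.swap)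
    finally show ?thesis by (simp add: sum_distrib_right mult.assoc)
  qed
  show ?thesis unfolding * using N by (intro sum.cong arg_cong2[where f="(*)"] strip_commute) auto
qed

lemma below_parts: "S \<in> below A \<Longrightarrow> parts S"
  by (simp add: below_def)

lemma strips_middle: "parts A \<Longrightarrow> strips (u @ \<phi> # v) A B = strips (\<phi> # u @ v) A B"
proof (induction u arbitrary: A)
  case (Cons \<psi> u)
  have "strips ((\<psi> # u) @ \<phi> # v) A B = (\<Sum>S\<in>below A. strip \<psi> A S * strips (u @ \<phi> # v) S B)"
    by (simp add: strips.simps)
  also have "\<dots> = (\<Sum>S\<in>below A. strip \<psi> A S * strips (\<phi> # u @ v) S B)"
    by (intro sum.cong) (auto simp: Cons.IH below_parts)
  also have "\<dots> = strips (\<psi> # \<phi> # u @ v) A B" by (simp add: strips.simps)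
  finally show ?case using strips_swap[OF Cons.prems, of \<psi> \<phi>] by simp
qed simp

text \<open>Moving single entries to the front generates all reorderings. For entries
  \<open>delta k\<close> this is the symmetry of skew Q-functions in their variables.\<close>

lemma strips_perm: "parts A \<Longrightarrow> mset u = mset v \<Longrightarrow> strips u A B = strips v A B"
proof (induction u arbitrary: v A)
  case (Cons \<phi> u)
  then have "\<phi> \<in> set v" by (metis list.set_intros(1) mset_eq_setD)
  then obtain v1 v2 where v: "v = v1 @ \<phi> # v2" by (meson split_list)
  then have "mset u = mset (v1 @ v2)" using Cons.prems by simp
  then have "strips (\<phi> # u) A B = strips (\<phi> # v1 @ v2) A B"
    unfolding strips.simps by (intro sum.cong) (auto simp: below_parts intro!: Cons.IH)
  then show ?case using v strips_middle[OF Cons.prems(1)] by simp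
qed simp

lemma strips_nonzero:
  "parts A \<Longrightarrow> strips u A B \<noteq> 0 \<Longrightarrow> 1 \<le> e \<Longrightarrow> cnt B e \<le> cnt A e"
proof (induction u arbitrary: A)
  case (Cons \<phi> u)
  then obtain S where "S \<in> below A" "strip \<phi> A S * strips u S B \<noteq> 0"
    unfolding strips.simps by (meson sum.not_neutral_contains_not_neutral)
  then have "parts S" "interlaced A S" "strips u S B \<noteq> 0" by (auto simp: below_def)
  then show ?case using Cons.IH[of S] Cons.prems by (auto simp: interlaced_def intro: le_trans)
qed (auto split: if_splits)

lemma strips_nonneg: "(\<And>\<phi> k. \<phi> \<in> set u \<Longrightarrow> 0 \<le> \<phi> k) \<Longrightarrow> 0 \<le> strips u A B"
proof (induction u arbitrary: A)
  case (Cons \<phi> u)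
  then show ?case
    unfolding strips.simps by (intro sum_nonneg mult_nonneg_nonneg) (auto simp: strip_def weight_nonneg)
qed simp

section \<open>Coefficients of skew Q-functions\<close>

definition delta :: "nat \<Rightarrow> nat \<Rightarrow> real" where
  "delta k n = of_bool (n = k)"

text \<open>\<open>Qc w A B\<close> is the coefficient of \<open>x\<^sup>w\<close> in the skew Q-function of the pair \<open>A\<close>, \<open>B\<close>.\<close>

abbreviation Qc :: "nat list \<Rightarrow> nat set \<Rightarrow> nat set \<Rightarrow> real" where
  "Qc w A B \<equiv> strips (map delta w) A B"

lemma Qc_nonneg [simp]: "0 \<le> Qc w A B"
  by (rule strips_nonneg) (auto simp: delta_def)

lemma strip_delta: "strip (delta k) A B = (if \<Sum>A - \<Sum>B = k then weight A B else 0)"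
  by (simp add: strip_def delta_def)

lemma Qc_sum:
  assumes "parts A" "Qc w A B \<noteq> 0"
  shows "\<Sum>A = \<Sum>B + sum_list w"
  using assms
proof (induction w arbitrary: A)
  case (Cons k w)
  then obtain S where S: "S \<in> below A" "strip (delta k) A S * Qc w S B \<noteq> 0"
    unfolding list.map strips.simps by (meson sum.not_neutral_contains_not_neutral)
  then have "\<Sum>S \<le> \<Sum>A"
    using Cons.prems by (auto simp: below_def interlaced_def intro!: interlaced_sum)
  moreover have "\<Sum>A - \<Sum>S = k" using S by (auto simp: strip_delta split: if_splits)
  ultimately show ?case using Cons.IH[of S] S by (auto simp: below_def)
qed (auto split: if_splits)

section \<open>Complementation in an interval\<close>

lemma cnt_compl:
  assumes "A \<subseteq> {1..N}" "1 \<le> e"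
  shows "cnt ({1..N} - A) e + cnt A e = Suc N - e"
proof -
  have "{x \<in> {1..N} - A. e \<le> x} \<union> {x \<in> A. e \<le> x} = {e..N}" using assms by auto
  moreover have "{x \<in> {1..N} - A. e \<le> x} \<inter> {x \<in> A. e \<le> x} = {}" by auto
  moreover have "finite A" using assms finite_subset by blast
  ultimately show ?thesis
    unfolding cnt_def by (metis (no_types, lifting) card_Un_disjoint card_atLeastAtMost finite_Un finite_atLeastAtMost)
qed

lemma interlaced_compl:
  assumes "A \<subseteq> {1..N}" "B \<subseteq> {1..N}"
  shows "interlaced ({1..N} - B) ({1..N} - A) \<longleftrightarrow> interlaced A B"
proof -
  have "cnt ({1..N} - A) e \<le> cnt ({1..N} - B) e \<and> cnt ({1..N} - B) e \<le> Suc (cnt ({1..N} - A) e)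
      \<longleftrightarrow> cnt B e \<le> cnt A e \<and> cnt A e \<le> Suc (cnt B e)" if "1 \<le> e" for e
    using cnt_compl[OF assms(1) that] cnt_compl[OF assms(2) that] by linarith
  then show ?thesis by (auto simp: interlaced_def)
qed

lemma sum_compl:
  fixes A :: "nat set"
  assumes "A \<subseteq> {1..N}"
  shows "\<Sum>({1..N} - A) + \<Sum>A = \<Sum>{1..N}"
  using sum.subset_diff[OF assms, of "\<lambda>x. x"] by simp

lemma strip_compl:
  assumes "A \<subseteq> {1..N}" "B \<subseteq> {1..N}"
  shows "strip \<phi> ({1..N} - B) ({1..N} - A) = strip \<phi> A B"
proof -
  have "({1..N} - B) - ({1..N} - A) = A - B" using assms by auto
  moreover have "\<Sum>({1..N} - B) - \<Sum>({1..N} - A) = \<Sum>A - \<Sum>B"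
    using sum_compl[OF assms(1)] sum_compl[OF assms(2)] by linarith
  ultimately show ?thesis using interlaced_compl[OF assms] by (simp add: strip_def weight_def)
qed

text \<open>Complementation reverses inclusion and hence the order of the strips; commutation
  restores the order of the list.\<close>

lemma strips_compl:
  assumes "A \<subseteq> {1..N}" "B \<subseteq> {1..N}"
  shows "strips u ({1..N} - B) ({1..N} - A) = strips u A B"
  using assms
proof (induction u arbitrary: A)
  case Nil
  then have "{1..N} - B = {1..N} - A \<longleftrightarrow> A = B" by blast
  then show ?case by simp
next
  case (Cons \<phi> u)
  have ps: "parts ({1..N} - B)" using parts_subset[of "{1..N} - B"] by auto
  have "strips (\<phi> # u) ({1..N} - B) ({1..N} - A) = strips (u @ [\<phi>]) ({1..N} - B) ({1..N} - A)"
    using strips_middle[OF ps, of u \<phi> "[]"] by simp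
  also have "\<dots> = (\<Sum>S\<in>Pow {1..N}. strips u ({1..N} - B) S * strips [\<phi>] S ({1..N} - A))"
    by (rule strips_append) auto
  also have "\<dots> = (\<Sum>S\<in>Pow {1..N}. strips u ({1..N} - B) ({1..N} - S) * strips [\<phi>] ({1..N} - S) ({1..N} - A))"
    by (rule sum.reindex_bij_witness[of _ "\<lambda>S. {1..N} - S" "\<lambda>S. {1..N} - S"])
       (auto simp: double_diff)
  also have "\<dots> = (\<Sum>S\<in>Pow {1..N}. strips u S B * strip \<phi> A S)"
  proof (rule sum.cong[OF refl])
    fix S assume S: "S \<in> Pow {1..N}"
    then have "strips u ({1..N} - B) ({1..N} - S) = strips u S B" using Cons.IH[of S] Cons.prems by simp
    moreover have "strips [\<phi>] ({1..N} - S) ({1..N} - A) = strip \<phi> ({1..N} - S) ({1..N} - A)"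
      using parts_subset[of "{1..N} - S" N] parts_subset[of "{1..N} - A" N] by (auto intro!: strips_single)
    moreover have "strip \<phi> ({1..N} - S) ({1..N} - A) = strip \<phi> A S"
      using S Cons.prems by (intro strip_compl) auto
    ultimately show "strips u ({1..N} - B) ({1..N} - S) * strips [\<phi>] ({1..N} - S) ({1..N} - A) = strips u S B * strip \<phi> A S"
      by simp
  qed
  also have "\<dots> = strips (\<phi> # u) A B"
    using Cons.prems by (simp add: strips_Cons mult.commute)
  finally show ?case .
qed

section \<open>Leading exponents\<close>

definition inside :: "nat set \<Rightarrow> nat set \<Rightarrow> bool" where
  "inside B A \<longleftrightarrow> (\<forall>e\<ge>1. cnt B e \<le> cnt A e)"

lemma inside_refl [simp]: "inside A A"
  by (simp add: inside_def)

lemma inside_empty [simp]: "inside {} A"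
  by (simp add: inside_def)

lemma interlaced_inside: "interlaced A B \<Longrightarrow> inside B A"
  by (simp add: interlaced_def inside_def)

lemma strips_nonzero_inside: "parts A \<Longrightarrow> strips u A B \<noteq> 0 \<Longrightarrow> inside B A"
  unfolding inside_def using strips_nonzero by blast

lemma parts_insert_Suc: "A \<subseteq> {1..n} \<Longrightarrow> parts (insert (Suc n) A)"
  by (rule parts_subset[of _ "Suc n"]) auto

lemma not_mem_Suc: "A \<subseteq> {1..n} \<Longrightarrow> Suc n \<notin> (A::nat set)"
  by auto

lemma cnt_insert_Suc: "A \<subseteq> {1..n} \<Longrightarrow> cnt (insert (Suc n) A) e = cnt A e + of_bool (e \<le> Suc n)"
  using cnt_insert[OF _ not_mem_Suc] finite_subset by blast

lemma cnt_high: "A \<subseteq> {1..n} \<Longrightarrow> n < e \<Longrightarrow> cnt A e = 0"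
  using finite_subset[of A "{1..n}"] by (auto simp: cnt_eq_0_iff)

lemma sum_insert_Suc: "A \<subseteq> {1..n} \<Longrightarrow> \<Sum>(insert (Suc n) A) = Suc n + \<Sum>A"
  using not_mem_Suc[of A n] finite_subset[of A "{1..n}"] by (subst sum.insert) auto

lemma interlaced_insert_Suc:
  assumes "A \<subseteq> {1..n}" "B \<subseteq> {1..n}"
  shows "interlaced (insert (Suc n) A) (insert (Suc n) B) \<longleftrightarrow> interlaced A B"
  using assms by (simp add: interlaced_def cnt_insert_Suc)

lemma strip_insert_Suc:
  assumes "A \<subseteq> {1..n}" "B \<subseteq> {1..n}"
  shows "strip \<phi> (insert (Suc n) A) (insert (Suc n) B) = strip \<phi> A B"
proof -
  have "insert (Suc n) A - insert (Suc n) B = A - B" using assms by auto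
  then show ?thesis
    using assms by (simp add: strip_def weight_def interlaced_insert_Suc sum_insert_Suc del: sum.insert)
qed

lemma strips_eq_0: "parts A \<Longrightarrow> 1 \<le> e \<Longrightarrow> cnt A e < cnt B e \<Longrightarrow> strips u A B = 0"
  using strips_nonzero[of A u B e] by force

text \<open>No chain between the two sets can lose \<open>Suc n\<close> on its way, because diagonal
  \<open>Suc n\<close> would then be too short to contain the inner set.\<close>

lemma strips_insert_Suc:
  assumes "A \<subseteq> {1..n}" "B \<subseteq> {1..n}"
  shows "strips u (insert (Suc n) A) (insert (Suc n) B) = strips u A B"
  using assms
proof (induction u arbitrary: A)
  case Nil
  have "insert (Suc n) A = insert (Suc n) B \<longleftrightarrow> A = B"
    using insert_ident not_mem_Suc Nil by metis
  then show ?case by simp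
next
  case (Cons \<phi> u)
  have z: "strips u S (insert (Suc n) B) = 0" if "S \<subseteq> {1..n}" for S
    by (rule strips_eq_0[of _ "Suc n"]) (use that Cons.prems parts_subset in \<open>auto simp: cnt_insert_Suc cnt_high\<close>)
  have "strips (\<phi> # u) (insert (Suc n) A) (insert (Suc n) B)
      = (\<Sum>S\<in>Pow {1..Suc n}. strip \<phi> (insert (Suc n) A) S * strips u S (insert (Suc n) B))"
    by (rule strips_Cons) (use Cons.prems in auto)
  also have "\<dots> = (\<Sum>S\<in>Pow {1..n}. strip \<phi> A S * strips u S B)"
    unfolding sum_Pow_Suc using Cons by (intro sum.cong) (auto simp: z strip_insert_Suc)
  finally show ?case using Cons.prems by (simp add: strips_Cons)
qed

lemma Qc_Nil_pos: "Qc [] A A = 1"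
  by simp

text \<open>\<open>U\<close> adds to \<open>B\<close> the first box of the skew diagram on every
  nonempty diagonal. It is the largest strip along the inner boundary.\<close>

definition layer :: "nat set \<Rightarrow> nat set \<Rightarrow> nat set \<Rightarrow> bool" where
  "layer A B U \<longleftrightarrow> parts U \<and> (\<forall>e\<ge>1. cnt U e = min (cnt A e) (Suc (cnt B e)))"

definition diags :: "nat set \<Rightarrow> nat set \<Rightarrow> nat set" where
  "diags A B = {e. 1 \<le> e \<and> cnt B e < cnt A e}"

lemma layer_exists: "parts A \<Longrightarrow> parts B \<Longrightarrow> \<exists>U. layer A B U"
proof -
  assume A: "parts A" and B: "parts B"
  then obtain N where N: "A \<subseteq> {1..N}" using parts_bounded by blast
  have "\<exists>U\<subseteq>{1..N}. \<forall>e\<ge>1. cnt U e = min (cnt A e) (Suc (cnt B e))"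
  proof (rule cnt_exists)
    fix e :: nat
    show "min (cnt A (Suc e)) (Suc (cnt B (Suc e))) \<le> min (cnt A e) (Suc (cnt B e)) \<and>
        min (cnt A e) (Suc (cnt B e)) \<le> Suc (min (cnt A (Suc e)) (Suc (cnt B (Suc e))))"
      using cnt_Suc[of A e] cnt_Suc[of B e] A B by (auto simp: min_def)
  qed (simp add: cnt_high[OF N])
  then show ?thesis using parts_subset by (auto simp: layer_def)
qed

lemma diags_subset: "A \<subseteq> {1..N} \<Longrightarrow> diags A B \<subseteq> {1..N}"
proof
  fix e assume "A \<subseteq> {1..N}" "e \<in> diags A B"
  then show "e \<in> {1..N}" using cnt_high[of A N e] by (cases "e \<le> N") (auto simp: diags_def)
qed

lemma finite_diags: "parts A \<Longrightarrow> finite (diags A B)"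
  using parts_bounded diags_subset finite_subset by (metis finite_atLeastAtMost)

lemma layer_cnt:
  assumes "layer A B U" "inside B A" "1 \<le> e"
  shows "cnt U e = cnt B e + of_bool (e \<in> diags A B)"
  using assms by (auto simp: layer_def inside_def diags_def min_def not_less_eq_eq Suc_le_eq le_less)

lemma layer_props:
  assumes "parts A" "parts B" "inside B A" "layer A B U"
  shows "parts U" "interlaced U B" "inside U A" "\<Sum>U = \<Sum>B + card (diags A B)"
    "weight U B = 2 ^ card (U - B)"
proof -
  obtain N where N: "A \<subseteq> {1..N}" using assms parts_bounded by blast
  have NB: "B \<subseteq> {1..N}" using N assms cnt_le_subset by (auto simp: inside_def)
  show U: "parts U" "inside U A" using assms by (auto simp: layer_def inside_def)
  then have NU: "U \<subseteq> {1..N}" using N cnt_le_subset by (auto simp: inside_def)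
  show i: "interlaced U B" using layer_cnt[OF assms(4,3)] by (auto simp: interlaced_def)
  show "weight U B = 2 ^ card (U - B)" using i by (simp add: weight_def)
  have "\<Sum>U = (\<Sum>e=1..N. cnt B e + of_bool (e \<in> diags A B))"
    unfolding sum_cnt[OF NU] using layer_cnt[OF assms(4,3)] by (intro sum.cong) auto
  also have "\<dots> = \<Sum>B + card ({1..N} \<inter> diags A B)"
    unfolding sum_cnt[OF NB] sum.distrib by (simp add: of_bool_def sum.If_cases flip: Collect_mem_eq)
  also have "{1..N} \<inter> diags A B = diags A B" using diags_subset[OF N, of B] by blast
  finally show "\<Sum>U = \<Sum>B + card (diags A B)" .
qed

lemma inside_sum_eq:
  assumes "parts A" "parts B" "inside B A" "\<Sum>B = \<Sum>A"
  shows "A = B"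
proof -
  obtain N where N: "A \<subseteq> {1..N}" using assms parts_bounded by blast
  then have NB: "B \<subseteq> {1..N}" using assms cnt_le_subset by (auto simp: inside_def)
  have "cnt A e = cnt B e" if "1 \<le> e" for e
  proof (rule ccontr)
    assume *: "cnt A e \<noteq> cnt B e"
    then have "e \<in> {1..N}" using that cnt_high[OF N, of e] cnt_high[OF NB, of e] by (cases "e \<le> N") auto
    then have "(\<Sum>e=1..N. cnt B e) < (\<Sum>e=1..N. cnt A e)"
      using * assms(3) by (intro sum_strict_mono_ex1) (auto simp: inside_def intro!: bexI[of _ e] le_neq_trans)
    then show False using assms(4) sum_cnt[OF N] sum_cnt[OF NB] by simp
  qed
  then have "e \<in> A \<longleftrightarrow> e \<in> B" if "1 \<le> e" for e
    using that cnt_mem[of A e] cnt_mem[of B e] assms by simp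
  then show ?thesis using N NB by auto
qed

lemma inside_sum: "parts A \<Longrightarrow> parts B \<Longrightarrow> inside B A \<Longrightarrow> \<Sum>B \<le> \<Sum>A"
  unfolding inside_def by (rule interlaced_sum) auto

text \<open>Since operators commute, the first exponent may be read off from the inner boundary.\<close>

lemma strips_inner:
  assumes "A \<subseteq> {1..N}"
  shows "strips (\<phi> # u) A B = (\<Sum>S\<in>Pow {1..N}. strips u A S * strips [\<phi>] S B)"
proof -
  have "strips (\<phi> # u) A B = strips (u @ [\<phi>]) A B"
    using strips_perm[of A "\<phi> # u" "u @ [\<phi>]"] assms parts_subset by force
  then show ?thesis using strips_append[OF assms] by simp
qed

lemma Qc_inner:
  assumes "A \<subseteq> {1..N}"
  shows "Qc (k # w) A B = (\<Sum>S\<in>Pow {1..N}. Qc w A S * strips [delta k] S B)"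
  using strips_inner[OF assms] by simp

lemma Qc_inner_ge:
  assumes "parts A" "finite F" "\<And>S. S \<in> F \<Longrightarrow> parts S" "parts B"
  shows "(\<Sum>S\<in>F. Qc w A S * strip (delta k) S B) \<le> Qc (k # w) A B"
proof -
  have "finite (\<Union>F)" using assms by (auto intro!: finite_Union)
  then have "parts (A \<union> \<Union>F)" using assms unfolding parts_def by blast
  then obtain N where N: "A \<union> \<Union>F \<subseteq> {1..N}" using parts_bounded by blast
  have "(\<Sum>S\<in>F. Qc w A S * strip (delta k) S B) = (\<Sum>S\<in>F. Qc w A S * strips [delta k] S B)"
    using assms by (intro sum.cong) (auto simp: strips_single)
  also have "\<dots> \<le> (\<Sum>S\<in>Pow {1..N}. Qc w A S * strips [delta k] S B)"
    using N Qc_nonneg[of "[k]"] by (intro sum_mono2) auto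
  also have "\<dots> = Qc (k # w) A B" using N by (subst Qc_inner[of _ N]) auto
  finally show ?thesis .
qed

text \<open>Every set reached from \<open>B\<close> by one strip inside \<open>A\<close> lies inside
  \<open>U\<close>. So it has at most as many boxes as \<open>U\<close>, and equally many only if it
  is \<open>U\<close>; the layer has one box on each nonempty diagonal.\<close>

lemma strips_top:
  assumes "parts A" "parts B" "inside B A" "layer A B U"
  shows strips_top_le: "strips (delta k # u) A B \<noteq> 0 \<Longrightarrow> k \<le> card (diags A B)"
    and strips_top_eq: "strips (delta (card (diags A B)) # u) A B = 2 ^ card (U - B) * strips u A U"
proof -
  note P = layer_props[OF assms]
  obtain N where N: "A \<subseteq> {1..N}" using assms parts_bounded by blast
  have NU: "U \<subseteq> {1..N}" using P N cnt_le_subset by (auto simp: inside_def)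
  have *: "k < card (diags A B) \<or> k = card (diags A B) \<and> S = U"
    if S: "S \<in> Pow {1..N}" and nz: "strips u A S * strips [delta k] S B \<noteq> 0" for S k
  proof -
    have pS: "parts S" using S parts_subset by auto
    have strip: "strip (delta k) S B \<noteq> 0" using nz strips_single[OF pS assms(2)] by auto
    then have i: "interlaced S B" and k: "\<Sum>S - \<Sum>B = k" by (auto simp: strip_delta weight_def split: if_splits)
    have "inside S A" using nz strips_nonzero_inside[OF assms(1)] by auto
    then have "inside S U" using i assms(4) by (auto simp: layer_def inside_def interlaced_def)
    moreover from this have "\<Sum>S \<le> \<Sum>U" using inside_sum P pS by blast
    moreover have "\<Sum>B \<le> \<Sum>S" using inside_sum pS assms interlaced_inside[OF i] by blast
    moreover have "\<Sum>S = \<Sum>U \<Longrightarrow> S = U" using inside_sum_eq[OF P(1) pS] \<open>inside S U\<close> by simp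
    moreover have "\<Sum>U = \<Sum>B + card (diags A B)" by (rule P(4))
    ultimately show ?thesis using k by linarith
  qed
  show "k \<le> card (diags A B)" if nz: "strips (delta k # u) A B \<noteq> 0"
  proof -
    obtain S where "S \<in> Pow {1..N}" "strips u A S * strips [delta k] S B \<noteq> 0"
      using nz unfolding strips_inner[OF N] by (meson sum.not_neutral_contains_not_neutral)
    then have "k < card (diags A B) \<or> k = card (diags A B) \<and> S = U" by (rule *)
    then show ?thesis by linarith
  qed
  have "strips (delta (card (diags A B)) # u) A B = (\<Sum>S\<in>Pow {1..N}. if S = U then strips u A U * strips [delta (card (diags A B))] U B else 0)"
    unfolding strips_inner[OF N]
  proof (rule sum.cong[OF refl])
    fix S assume S: "S \<in> Pow {1..N}"
    show "strips u A S * strips [delta (card (diags A B))] S B = (if S = U then strips u A U * strips [delta (card (diags A B))] U B else 0)"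
    proof (cases "S = U")
      case True
      show ?thesis unfolding True by (simp only: if_True refl)
    next
      case False
      then show ?thesis using *[OF S, of "card (diags A B)"] by (metis less_irrefl)
    qed
  qed
  also have "\<dots> = strips u A U * strips [delta (card (diags A B))] U B" using NU by simp
  also have "\<dots> = 2 ^ card (U - B) * strips u A U"
    using P assms by (simp add: strips_single strip_delta)
  finally show "strips (delta (card (diags A B)) # u) A B = 2 ^ card (U - B) * strips u A U" .
qed

lemma Qc_top:
  assumes "parts A" "parts B" "inside B A" "layer A B U"
  shows Qc_top_le: "Qc (k # w) A B \<noteq> 0 \<Longrightarrow> k \<le> card (diags A B)"
    and Qc_top_eq: "Qc (card (diags A B) # w) A B = 2 ^ card (U - B) * Qc w A U"
  using strips_top_le[OF assms, of k "map delta w"] strips_top_eq[OF assms, of "map delta w"] by simp_all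

lemma diags_eq_empty: "parts A \<Longrightarrow> parts B \<Longrightarrow> inside B A \<Longrightarrow> diags A B = {} \<Longrightarrow> A = B"
proof -
  assume *: "parts A" "parts B" "inside B A" "diags A B = {}"
  then have "cnt A e = cnt B e" if "1 \<le> e" for e
    using that by (force simp: diags_def inside_def)
  then have "e \<in> A \<longleftrightarrow> e \<in> B" if "1 \<le> e" for e
    using that cnt_mem[of A e] cnt_mem[of B e] * by simp
  then show "A = B" using * by (metis One_nat_def Suc_leI gr0I parts_def subsetI subset_antisym)
qed

text \<open>Removing one layer after another produces a word of top exponents whose coefficient is a
  product of powers of 2.\<close>

lemma Qc_pos: "parts A \<Longrightarrow> parts B \<Longrightarrow> inside B A \<Longrightarrow> \<exists>w. Qc w A B > 0"
proof (induction "\<Sum>A - \<Sum>B" arbitrary: B rule: less_induct)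
  case less
  show ?case
  proof (cases "A = B")
    case True
    then show ?thesis using Qc_Nil_pos by (metis zero_less_one)
  next
    case False
    obtain U where U: "layer A B U" using layer_exists less.prems by blast
    note P = layer_props[OF less.prems U]
    have "diags A B \<noteq> {}" using diags_eq_empty less.prems False by blast
    then have "card (diags A B) > 0" using finite_diags less.prems by (simp add: card_gt_0_iff)
    moreover have "\<Sum>U \<le> \<Sum>A" using inside_sum P less.prems by blast
    ultimately obtain w where "Qc w A U > 0" using less.hyps[of U] P less.prems by force
    then have "Qc (card (diags A B) # w) A B > 0" by (subst Qc_top_eq[OF less.prems U]) simp
    then show ?thesis by blast
  qed
qed

lemma layer_diff_pos: "parts A \<Longrightarrow> parts B \<Longrightarrow> inside B A \<Longrightarrow> layer A B U \<Longrightarrow> A \<noteq> B \<Longrightarrow> 0 < card (U - B)"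
proof (rule ccontr)
  assume *: "parts A" "parts B" "inside B A" "layer A B U" "A \<noteq> B" "\<not> 0 < card (U - B)"
  note P = layer_props[OF *(1-4)]
  have "U - B = {}" using * P by (simp add: card_gt_0_iff)
  then have "\<Sum>U \<le> \<Sum>B" using * by (intro sum_mono2) auto
  moreover have "card (diags A B) > 0" using diags_eq_empty finite_diags * by (auto simp: card_gt_0_iff)
  ultimately show False using P by simp
qed

text \<open>For subsets \<open>A\<close>, \<open>B\<close> of \<open>{1..n}\<close>, the condition \<open>inside B A\<close> says that no diagonal up to \<open>Suc n\<close> of the pair
  \<open>insert (Suc n) A\<close>, \<open>B\<close> is empty.\<close>

lemma inside_insert_Suc:
  assumes "A \<subseteq> {1..n}" "B \<subseteq> {1..n}" "inside B A"
  shows "inside B (insert (Suc n) A)" "layer (insert (Suc n) A) B (insert (Suc n) B)"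
    "diags (insert (Suc n) A) B = {1..Suc n}"
proof -
  show "inside B (insert (Suc n) A)" using assms by (auto simp: inside_def cnt_insert_Suc le_SucI)
  have z: "cnt A e = 0 \<and> cnt B e = 0" if "Suc n < e" for e
    using that cnt_high[OF assms(1), of e] cnt_high[OF assms(2), of e] by auto
  show "layer (insert (Suc n) A) B (insert (Suc n) B)"
    unfolding layer_def using assms parts_insert_Suc z by (auto simp: inside_def cnt_insert_Suc min_def not_less_eq_eq)
  show "diags (insert (Suc n) A) B = {1..Suc n}"
    using assms z by (auto simp: diags_def cnt_insert_Suc inside_def less_Suc_eq_le not_le[symmetric] split: if_splits)
qed

lemma strips_insert_top:
  assumes "A \<subseteq> {1..n}" "B \<subseteq> {1..n}" "inside B A"
  shows "strips (delta k # u) (insert (Suc n) A) B \<noteq> 0 \<Longrightarrow> k \<le> Suc n"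
    and "strips (delta (Suc n) # u) (insert (Suc n) A) B = 2 * strips u A B"
proof -
  note c = inside_insert_Suc[OF assms]
  have p: "parts (insert (Suc n) A)" "parts B" using assms parts_insert_Suc parts_subset by auto
  have "insert (Suc n) B - B = {Suc n}" using assms by auto
  then show "strips (delta (Suc n) # u) (insert (Suc n) A) B = 2 * strips u A B"
    using strips_top_eq[OF p c(1,2)] strips_insert_Suc[OF assms(1,2)] c(3) by simp
  show "k \<le> Suc n" if "strips (delta k # u) (insert (Suc n) A) B \<noteq> 0"
    using strips_top_le[OF p c(1,2) that] c(3) by simp
qed

lemma Qc_insert_top:
  assumes "A \<subseteq> {1..n}" "B \<subseteq> {1..n}" "inside B A"
  shows "Qc (k # w) (insert (Suc n) A) B \<noteq> 0 \<Longrightarrow> k \<le> Suc n"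
    and "Qc (Suc n # w) (insert (Suc n) A) B = 2 * Qc w A B"
  using strips_insert_top[OF assms] by simp_all

lemma parts_cases:
  assumes "parts C" "C \<noteq> {}"
  obtains n C' where "C = insert (Suc n) C'" "C' \<subseteq> {1..n}"
proof -
  have "Max C \<in> C" using assms by simp
  then obtain n where n: "Max C = Suc n" using assms by (cases "Max C") (auto simp: parts_def)
  have "C - {Suc n} \<subseteq> {1..n}"
  proof
    fix x assume x: "x \<in> C - {Suc n}"
    then have "x \<le> Suc n" using assms n Max_ge[of C x] by auto
    moreover have "x \<noteq> 0" using x assms by (auto simp: parts_def intro: ccontr)
    ultimately show "x \<in> {1..n}" using x by auto
  qed
  moreover have "C = insert (Suc n) (C - {Suc n})" using \<open>Max C \<in> C\<close> n by auto
  ultimately show thesis using that by blast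
qed

lemma Qc_straight_zero: "Qc (k # w) {} {} \<noteq> 0 \<Longrightarrow> k = 0"
  using Qc_sum[of "{}" "k # w" "{}"] by (auto simp: parts_def)

text \<open>Over the empty set the layer is the first row, so the top coefficient belonging to
  \<open>C\<close> is twice the Q-function of \<open>C\<close> without its largest part. Matching
  top exponents and top coefficients gives an equation of the same kind one layer further in, with
  larger constants.\<close>

lemma straight_top:
  assumes "parts A" "parts B" "inside B A" "layer A B U" "A \<noteq> B" "parts C"
    and eq: "\<And>w. a * Qc w A B = b * Qc w C {}" and ab: "a > 0" "b > 0"
  obtains n C' where "card (diags A B) = Suc n" "C = insert (Suc n) C'" "C' \<subseteq> {1..n}"
    "\<And>w. a * 2 ^ card (U - B) * Qc w A U = b * 2 * Qc w C' {}"
proof -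
  note P = layer_props[OF assms(1-4)]
  have k0: "card (diags A B) > 0"
    using diags_eq_empty finite_diags assms by (auto simp: card_gt_0_iff)
  obtain w where "Qc w A U > 0" using Qc_pos P assms by blast
  then have "Qc (card (diags A B) # w) A B > 0" by (subst Qc_top_eq[OF assms(1-4)]) simp
  then have pos: "Qc (card (diags A B) # w) C {} \<noteq> 0" using eq[of "card (diags A B) # w"] ab by auto
  have "C \<noteq> {}"
  proof
    assume "C = {}"
    have "Qc (card (diags A B) # w) {} {} \<noteq> 0" using pos unfolding \<open>C = {}\<close> .
    then show False using Qc_straight_zero[of "card (diags A B)" w] k0 by linarith
  qed
  then obtain n C' where C: "C = insert (Suc n) C'" "C' \<subseteq> {1..n}" using parts_cases assms by blast
  note T = Qc_insert_top[OF C(2), of "{}", simplified, folded C(1)]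
  have le: "card (diags A B) \<le> Suc n" using T(1) pos by simp
  obtain v where "Qc v C' {} > 0" using Qc_pos[of C' "{}"] C parts_subset by (auto simp: parts_def)
  then have "Qc (Suc n # v) C {} \<noteq> 0" using T(2) by simp
  then have "Qc (Suc n # v) A B \<noteq> 0" using eq[of "Suc n # v"] ab by auto
  then have "Suc n \<le> card (diags A B)" using Qc_top_le[OF assms(1-4)] by simp
  with le have n: "card (diags A B) = Suc n" by simp
  show thesis
  proof (rule that[OF n C])
    fix w
    show "a * 2 ^ card (U - B) * Qc w A U = b * 2 * Qc w C' {}"
      using eq[of "Suc n # w"] Qc_top_eq[OF assms(1-4), of w] T(2)[of w] n by simp
  qed
qed

text \<open>Each layer multiplies the left side by at least 2 and the right side by exactly 2, and
  both sides are used up after equally many layers. The exponents \<open>a\<close> and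
  \<open>b\<close> carry this balance through the induction.\<close>

lemma weight_le:
  assumes "parts A" "parts B" "inside B A" "parts C" "\<And>w. 2 ^ a * Qc w A B = 2 ^ b * Qc w C {}"
  shows "a \<le> (b::nat)"
  using assms
proof (induction "\<Sum>A - \<Sum>B" arbitrary: B C a b rule: less_induct)
  case less
  show ?case
  proof (cases "A = B")
    case True
    then show ?thesis using less.prems(5)[of "[]"] by (cases "C = {}") auto
  next
    case False
    obtain U where U: "layer A B U" using layer_exists less.prems by blast
    note P = layer_props[OF less.prems(1-3) U]
    obtain n C' where n: "card (diags A B) = Suc n" "C = insert (Suc n) C'" "C' \<subseteq> {1..n}"
      "\<And>w. 2 ^ a * 2 ^ card (U - B) * Qc w A U = 2 ^ b * 2 * Qc w C' {}"
      using straight_top[OF less.prems(1-3) U False less.prems(4,5)] by auto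
    have "\<Sum>U \<le> \<Sum>A" using inside_sum P less.prems by blast
    then have "a + card (U - B) \<le> b + 1"
      using n P less.prems parts_subset by (intro less.hyps[of U C']) (auto simp: power_add)
    then show ?thesis using layer_diff_pos[OF less.prems(1-3) U False] by simp
  qed
qed

definition strange_pair :: "nat set \<Rightarrow> nat set \<Rightarrow> bool" where
  "strange_pair A B \<longleftrightarrow> (\<exists>C. parts C \<and> (\<forall>w. Qc w A B = Qc w C {}))"

text \<open>A layer with two components would set a factor of at least 4 against a factor 2, which
  \<open>weight_le\<close> excludes for the diagrams that remain.\<close>

lemma strange_pair_top:
  assumes "parts A" "parts B" "inside B A" "layer A B U" "A \<noteq> B" "parts C" "\<And>w. Qc w A B = Qc w C {}"
  obtains n C' where "card (diags A B) = Suc n" "C = insert (Suc n) C'" "C' \<subseteq> {1..n}"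
    "\<And>w. Qc w A U = Qc w C' {}" "card (U - B) = 1"
proof -
  note P = layer_props[OF assms(1-4)]
  obtain n C' where n: "card (diags A B) = Suc n" "C = insert (Suc n) C'" "C' \<subseteq> {1..n}"
      "\<And>w. 1 * 2 ^ card (U - B) * Qc w A U = 1 * 2 * Qc w C' {}"
    using straight_top[OF assms(1-6), of 1 1] assms(7) by auto
  have "card (U - B) \<le> 1"
    using n parts_subset P assms by (intro weight_le[of A U C' _ 1]) auto
  then have "card (U - B) = 1" using layer_diff_pos[OF assms(1-5)] by simp
  then show thesis using n by (intro that[of n C']) auto
qed

text \<open>A part is a drop of the diagonal lengths, and \<open>U\<close> exceeds \<open>B\<close>
  by one exactly on the nonempty diagonals. So a new part appears where a run of such diagonals
  ends.\<close>

lemma layer_diff: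
  assumes "parts A" "parts B" "inside B A" "layer A B U"
  shows "U - B = {e \<in> diags A B. Suc e \<notin> diags A B}"
proof -
  note P = layer_props[OF assms]
  have "e \<in> U - B \<longleftrightarrow> e \<in> diags A B \<and> Suc e \<notin> diags A B" if "1 \<le> e" for e
    using layer_cnt[OF assms(4,3), of e] layer_cnt[OF assms(4,3), of "Suc e"] that
      cnt_Suc[of U e] cnt_Suc[of B e] P(1) assms(2)
    by (cases "e \<in> U"; cases "e \<in> B"; cases "e \<in> diags A B"; cases "Suc e \<in> diags A B") auto
  moreover have "0 \<notin> U" "0 \<notin> diags A B" using P by (auto simp: parts_def diags_def)
  ultimately show ?thesis by (auto simp: gr0_conv_Suc not_less_eq_eq) (metis One_nat_def Suc_leI neq0_conv)+
qed

lemma one_run: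
  assumes "finite E" "card {e \<in> E. Suc e \<notin> E} = 1" "0 \<notin> E"
  obtains f g where "f < g" "E = {f<..g}" "{e \<in> E. Suc e \<notin> E} = {g}"
proof -
  obtain g where g: "{e \<in> E. Suc e \<notin> E} = {g}" using assms(2) card_1_singletonE by blast
  then have gE: "g \<in> E" by auto
  have le: "x \<le> g" if "x \<in> E" for x
  proof -
    have "Suc (Max E) \<notin> E" using assms(1) Max_ge by fastforce
    then have "Max E = g" using g that assms(1) Max_in by blast
    then show ?thesis using that assms(1) by auto
  qed
  define f where "f = Max {e. e < g \<and> e \<notin> E}"
  have "g \<noteq> 0" using gE assms(3) by (auto intro: ccontr)
  then have ne: "{e. e < g \<and> e \<notin> E} \<noteq> {}" using assms(3) by auto
  have f: "f < g" "f \<notin> E" using Max_in[OF _ ne] by (auto simp: f_def)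
  have up: "x \<in> E" if "f < x" "x \<le> g" for x
  proof (rule ccontr)
    assume "x \<notin> E"
    then have "x < g" using that gE by (cases "x = g") auto
    then have "x \<le> f" unfolding f_def using \<open>x \<notin> E\<close> by (intro Max_ge) auto
    then show False using that by simp
  qed
  have low: "x \<notin> E" if "x \<le> f" for x
  proof
    assume "x \<in> E"
    define h where "h = Max {e \<in> E. e \<le> f}"
    have "h \<in> {e \<in> E. e \<le> f}" unfolding h_def using \<open>x \<in> E\<close> that assms(1) by (intro Max_in) auto
    moreover have "Suc h \<notin> E"
    proof
      assume "Suc h \<in> E"
      moreover have "h < f" using \<open>h \<in> {e \<in> E. e \<le> f}\<close> f by (auto simp: order_le_less)
      ultimately have "Suc h \<le> h" unfolding h_def using assms(1) by (intro Max_ge) (auto simp: h_def)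
      then show False by simp
    qed
    ultimately have "h \<in> {e \<in> E. Suc e \<notin> E}" by auto
    then show False using g f \<open>h \<in> {e \<in> E. e \<le> f}\<close> by auto
  qed
  have "E = {f<..g}" using up low le by (auto simp: not_le[symmetric])
  then show thesis using that f g by blast
qed

text \<open>\<open>U - B\<close> consists of the upper ends of the runs of nonempty diagonals;
  having one element, it leaves one run.\<close>

lemma strange_pair_interval:
  assumes "parts A" "parts B" "inside B A" "strange_pair A B" "A \<noteq> B" "layer A B U"
  obtains f g where "f < g" "diags A B = {f<..g}" "U - B = {g}"
proof -
  obtain C where "parts C" "\<And>w. Qc w A B = Qc w C {}" using assms by (auto simp: strange_pair_def)
  then have "card (U - B) = 1" using strange_pair_top[OF assms(1-3,6,5)] by metis
  then show thesis
    using that one_run[of "diags A B"] layer_diff[OF assms(1-3,6)] finite_diags assms(1)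
    by (metis (mono_tags, lifting) diags_def mem_Collect_eq not_one_le_zero)
qed

section \<open>Tableaux and strips\<close>

text \<open>Membership is tested along diagonals instead of rows, so that containment of diagrams
  becomes \<open>inside\<close> and a strip has at most one box for each \<open>e\<close>.\<close>

definition boxes :: "nat set \<Rightarrow> box set" where
  "boxes A = {(x, y). 1 \<le> x \<and> x \<le> y \<and> nat x \<le> cnt A (nat (y - x + 1))}"

lemma boxes_mem: "(x, y) \<in> boxes A \<longleftrightarrow> 1 \<le> x \<and> x \<le> y \<and> nat x \<le> cnt A (nat (y - x + 1))"
  by (simp add: boxes_def)

lemma cnt_shift: "finite A \<Longrightarrow> cnt A e \<le> cnt A (e + d) + d"
proof (induction d)
  case (Suc d)
  then show ?case using cnt_Suc[of A "e + d"] by (cases "e + d \<in> A") auto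
qed simp

lemma boxes_ideal:
  assumes "finite A" "(x, y) \<in> boxes A" "1 \<le> x'" "x' \<le> x" "x' \<le> y'" "y' \<le> y"
  shows "(x', y') \<in> boxes A"
proof -
  have "nat x \<le> cnt A (nat (y - x + 1))" and xy: "x \<le> y" using assms by (auto simp: boxes_mem)
  moreover have "cnt A (nat (y - x + 1)) \<le> cnt A (nat (y - x + 1) + nat (x - x')) + nat (x - x')"
    by (rule cnt_shift[OF assms(1)])
  moreover have "nat (y - x + 1) + nat (x - x') = nat (y - x' + 1)" using assms xy by linarith
  moreover have "nat x = nat x' + nat (x - x')" using assms by linarith
  ultimately have "nat x' \<le> cnt A (nat (y - x' + 1))" by simp
  also have "\<dots> \<le> cnt A (nat (y' - x' + 1))" using assms by (intro cnt_antimono) auto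
  finally show ?thesis using assms by (simp add: boxes_mem)
qed

definition box_at :: "nat \<Rightarrow> nat \<Rightarrow> box" where
  "box_at e i = (int i, int i + int e - 1)"

lemma box_at_mem: "1 \<le> e \<Longrightarrow> box_at e i \<in> boxes A \<longleftrightarrow> 1 \<le> i \<and> i \<le> cnt A e"
  by (auto simp: box_at_def boxes_mem)

lemma box_at_cases:
  assumes "1 \<le> x" "x \<le> y"
  obtains e i where "(x, y) = box_at e i" "1 \<le> e" "1 \<le> i"
  using assms by (intro that[of "nat (y - x + 1)" "nat x"]) (auto simp: box_at_def)

lemma box_at_inj: "box_at e i = box_at f j \<longleftrightarrow> e = f \<and> i = j"
  by (auto simp: box_at_def)

lemma boxes_subset_iff: "boxes B \<subseteq> boxes A \<longleftrightarrow> inside B A"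
proof
  assume *: "boxes B \<subseteq> boxes A"
  have "cnt B e \<le> cnt A e" if "1 \<le> e" for e
  proof (cases "cnt B e = 0")
    case False
    then have "box_at e (cnt B e) \<in> boxes B" using that by (simp add: box_at_mem)
    then show ?thesis using * that box_at_mem by blast
  qed simp
  then show "inside B A" by (simp add: inside_def)
next
  assume *: "inside B A"
  show "boxes B \<subseteq> boxes A"
  proof (rule subrelI)
    fix x y assume "(x, y) \<in> boxes B"
    then have "1 \<le> x" "x \<le> y" "nat x \<le> cnt B (nat (y - x + 1))" by (auto simp: boxes_mem)
    moreover have "cnt B (nat (y - x + 1)) \<le> cnt A (nat (y - x + 1))"
      using * \<open>x \<le> y\<close> by (simp add: inside_def)
    ultimately show "(x, y) \<in> boxes A" by (simp add: boxes_mem)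
  qed
qed

lemma boxes_eq_box_at:
  assumes "A \<subseteq> {1..N}"
  shows "boxes A = (\<lambda>(e, i). box_at e i) ` (SIGMA e:{1..N}. {1..cnt A e})"
proof
  show "boxes A \<subseteq> (\<lambda>(e, i). box_at e i) ` (SIGMA e:{1..N}. {1..cnt A e})"
  proof (rule subrelI)
    fix x y assume *: "(x, y) \<in> boxes A"
    then have "1 \<le> x" "x \<le> y" by (auto simp: boxes_mem)
    then obtain e i where ei: "(x, y) = box_at e i" "1 \<le> e" "1 \<le> i" using box_at_cases by blast
    then have "i \<le> cnt A e" using * box_at_mem by metis
    moreover from this have "e \<le> N" using cnt_high[OF assms, of e] ei(3) by (cases "e \<le> N") auto
    ultimately show "(x, y) \<in> (\<lambda>(e, i). box_at e i) ` (SIGMA e:{1..N}. {1..cnt A e})" using ei by auto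
  qed
next
  show "(\<lambda>(e, i). box_at e i) ` (SIGMA e:{1..N}. {1..cnt A e}) \<subseteq> boxes A" using box_at_mem by auto
qed

lemma card_boxes:
  assumes "parts A"
  shows "finite (boxes A)" "card (boxes A) = \<Sum>A"
proof -
  obtain N where N: "A \<subseteq> {1..N}" using parts_bounded assms by blast
  show "finite (boxes A)" unfolding boxes_eq_box_at[OF N] by (intro finite_imageI finite_SigmaI) auto
  have "inj_on (\<lambda>(e, i). box_at e i) (SIGMA e:{1..N}. {1..cnt A e})"
    by (auto simp: inj_on_def box_at_inj)
  then have "card (boxes A) = card (SIGMA e:{1..N}. {1..cnt A e})"
    unfolding boxes_eq_box_at[OF N] by (rule card_image)
  also have "\<dots> = \<Sum>A" unfolding sum_cnt[OF N] by (subst card_SigmaI) auto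
  finally show "card (boxes A) = \<Sum>A" .
qed

lemma initial_segment:
  assumes "finite I" "0 \<notin> I" "\<And>i. Suc i \<in> I \<Longrightarrow> i = 0 \<or> i \<in> I"
  shows "I = {1..card I}"
proof (cases "I = {}")
  case False
  have down: "j \<in> I \<Longrightarrow> 1 \<le> i \<Longrightarrow> i \<le> j \<Longrightarrow> i \<in> I" for i j
  proof (induction j)
    case (Suc j)
    then show ?case using assms(3)[of j] by (cases "i = Suc j") auto
  qed simp
  have "I = {1..Max I}"
  proof
    show "I \<subseteq> {1..Max I}" using assms by (auto simp: Suc_le_eq intro: gr0I)
    show "{1..Max I} \<subseteq> I" using down[OF Max_in[OF assms(1) False]] by auto
  qed
  then show ?thesis by (metis card_atLeastAtMost diff_Suc_1)
qed simp

text \<open>Closure towards the upper left makes every diagonal an initial segment. The left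
  neighbour of a box shows that the lengths decrease along the diagonals, the upper neighbour that
  they drop by at most one.\<close>

lemma ideal_is_boxes:
  assumes A: "A \<subseteq> {1..N}" and I: "I \<subseteq> boxes A"
    and closed: "\<And>x y x' y'. (x, y) \<in> I \<Longrightarrow> 1 \<le> x' \<Longrightarrow> x' \<le> x \<Longrightarrow> x' \<le> y' \<Longrightarrow> y' \<le> y \<Longrightarrow> (x', y') \<in> I"
  shows "\<exists>S\<subseteq>{1..N}. boxes S = I"
proof -
  define J where "J e = {i. box_at e i \<in> I}" for e
  define c where "c e = card (J e)" for e
  have J: "J e = {1..c e} \<and> J e \<subseteq> {1..cnt A e}" if e: "1 \<le> e" for e
  proof -
    have sub: "J e \<subseteq> {1..cnt A e}" using I e box_at_mem by (auto simp: J_def)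
    moreover have "i = 0 \<or> i \<in> J e" if "Suc i \<in> J e" for i
      using that e closed[of "int (Suc i)" "int (Suc i) + int e - 1" "int i" "int i + int e - 1"]
      by (cases "i = 0") (auto simp: J_def box_at_def)
    moreover have "finite (J e)" using sub finite_subset by blast
    moreover have "0 \<notin> J e" using sub by auto
    ultimately have "J e = {1..c e}" unfolding c_def by (intro initial_segment) auto
    with sub show ?thesis by blast
  qed
  have "\<exists>S\<subseteq>{1..N}. \<forall>e\<ge>1. cnt S e = c e"
  proof (rule cnt_exists)
    fix e :: nat assume e: "1 \<le> e"
    have "J (Suc e) \<subseteq> J e"
    proof
      fix i assume i: "i \<in> J (Suc e)"
      then have "1 \<le> i" using J[of "Suc e"] by auto
      then show "i \<in> J e"
        using i e closed[of "int i" "int i + int (Suc e) - 1" "int i" "int i + int e - 1"]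
        by (auto simp: J_def box_at_def)
    qed
    moreover have "finite (J e)" using J[OF e] finite_subset by blast
    ultimately have 1: "c (Suc e) \<le> c e" unfolding c_def by (intro card_mono)
    have "c e \<le> Suc (c (Suc e))"
    proof (cases "c e \<le> 1")
      case False
      then have "c e \<in> J e" using J[OF e] by auto
      then have "box_at e (c e) \<in> I" by (simp add: J_def)
      then have "box_at (Suc e) (c e - 1) \<in> I"
        using False e closed[of "int (c e)" "int (c e) + int e - 1" "int (c e - 1)" "int (c e - 1) + int (Suc e) - 1"]
        by (auto simp: box_at_def)
      then have "c e - 1 \<in> J (Suc e)" by (simp add: J_def)
      then have "c e - 1 \<in> {1..c (Suc e)}" using J[of "Suc e"] e by simp
      then show ?thesis unfolding atLeastAtMost_iff by linarith
    qed simp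
    with 1 show "c (Suc e) \<le> c e \<and> c e \<le> Suc (c (Suc e))" by simp
  next
    fix e assume "N < e"
    then have "J e = {}" using J[of e] cnt_high[OF A, of e] by auto
    then show "c e = 0" by (simp add: c_def)
  qed
  then obtain S where S: "S \<subseteq> {1..N}" "\<And>e. 1 \<le> e \<Longrightarrow> cnt S e = c e" by blast
  have "boxes S = I"
  proof (rule set_eqI, rule prod_cases)
    fix b :: box and x y
    have *: "box_at e i \<in> boxes S \<longleftrightarrow> box_at e i \<in> I" if "1 \<le> e" for e i
    proof -
      have "box_at e i \<in> I \<longleftrightarrow> i \<in> J e" by (simp add: J_def)
      also have "\<dots> \<longleftrightarrow> i \<in> {1..c e}" using J[OF that] by simp
      finally show ?thesis using S(2)[OF that] that by (simp add: box_at_mem)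
    qed
    have "1 \<le> x \<and> x \<le> y" if "(x, y) \<in> boxes S \<or> (x, y) \<in> I"
      using that I by (auto simp: boxes_mem)
    then show "(x, y) \<in> boxes S \<longleftrightarrow> (x, y) \<in> I" using * box_at_cases[of x y] by metis
  qed
  then show ?thesis using S by blast
qed

lemma letter_le_index: "L \<le> L' \<Longrightarrow> index L \<le> index (L' :: letter)"
  by (auto simp: less_eq_letter_def)

lemma letter_leI: "index L < index L' \<Longrightarrow> L \<le> (L' :: letter)"
  by (auto simp: less_eq_letter_def)

lemma letter_le_marked: "L \<le> L' \<Longrightarrow> index L = index L' \<Longrightarrow> is_marked L' \<Longrightarrow> L = L'"
  by (cases L; cases L') (auto simp: less_eq_letter_def)

lemma letter_ge_unmarked: "L \<le> L' \<Longrightarrow> index L = index L' \<Longrightarrow> \<not> is_marked L \<Longrightarrow> L = L'"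
  by (cases L; cases L') (auto simp: less_eq_letter_def)

text \<open>The letters \<open>Marked k\<close>, \<open>Unmarked k\<close> admissible in a box when \<open>X\<close> is the set of boxes carrying
  a letter of index \<open>k\<close>.\<close>

definition admissible :: "nat \<Rightarrow> box set \<Rightarrow> box \<Rightarrow> letter set" where
  "admissible k X b = {L. index L = k \<and> ((fst b, snd b - 1) \<in> X \<longrightarrow> \<not> is_marked L)
     \<and> ((fst b + 1, snd b) \<in> X \<longrightarrow> is_marked L)}"

definition skew :: "nat set \<Rightarrow> nat set \<Rightarrow> box set" where
  "skew A B = boxes A - boxes B"

lemma skew_convex:
  assumes "finite A" "finite B" "(x, y) \<in> skew A B" "(x', y') \<in> skew A B"
    "x \<le> u" "u \<le> x'" "y \<le> v" "v \<le> y'" "u \<le> v"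
  shows "(u, v) \<in> skew A B"
proof -
  have "1 \<le> x" "x \<le> y" using assms(3) by (auto simp: skew_def boxes_mem)
  then have "(u, v) \<in> boxes A" using assms by (intro boxes_ideal[of A x' y' u v]) (auto simp: skew_def)
  moreover have "(u, v) \<notin> boxes B"
    using boxes_ideal[of B u v x y] assms \<open>1 \<le> x\<close> \<open>x \<le> y\<close> by (auto simp: skew_def)
  ultimately show ?thesis by (simp add: skew_def)
qed

lemma gsyt_row: "T \<in> gsyt D \<Longrightarrow> (x, y) \<in> D \<Longrightarrow> (x, y') \<in> D \<Longrightarrow> y \<le> y' \<Longrightarrow> T (x, y) \<le> T (x, y')"
  unfolding gsyt_def by blast

lemma gsyt_col: "T \<in> gsyt D \<Longrightarrow> (x, y) \<in> D \<Longrightarrow> (x', y) \<in> D \<Longrightarrow> x \<le> x' \<Longrightarrow> T (x, y) \<le> T (x', y)"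
  unfolding gsyt_def by blast

lemma gsyt_row_marked: "T \<in> gsyt D \<Longrightarrow> (x, y) \<in> D \<Longrightarrow> (x, y') \<in> D \<Longrightarrow> is_marked (T (x, y))
    \<Longrightarrow> T (x, y) = T (x, y') \<Longrightarrow> y = y'"
  unfolding gsyt_def by blast

lemma gsyt_col_unmarked: "T \<in> gsyt D \<Longrightarrow> (x, y) \<in> D \<Longrightarrow> (x', y) \<in> D \<Longrightarrow> \<not> is_marked (T (x, y))
    \<Longrightarrow> T (x, y) = T (x', y) \<Longrightarrow> x = x'"
  unfolding gsyt_def by blast

text \<open>The corner \<open>(x, y')\<close> connects the two boxes by a row and a column, and
  convexity puts it into the diagram.\<close>

lemma gsyt_mono:
  assumes T: "T \<in> gsyt (skew A B)" and fin: "finite A" "finite B"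
    and "(x, y) \<in> skew A B" "(x', y') \<in> skew A B" "x \<le> x'" "y \<le> y'"
  shows "T (x, y) \<le> T (x', y')"
proof -
  have "x' \<le> y'" using assms by (auto simp: skew_def boxes_mem)
  then have "(x, y') \<in> skew A B"
    using skew_convex[OF fin assms(4,5), of x y'] assms by auto
  then have "T (x, y) \<le> T (x, y')" "T (x, y') \<le> T (x', y')"
    using assms gsyt_row[OF T] gsyt_col[OF T] by blast+
  then show ?thesis by (rule order_trans)
qed

lemma gsyt_admissible:
  assumes T: "T \<in> gsyt D" and b: "b \<in> {b \<in> D. index (T b) = k}"
  shows "T b \<in> admissible k {b \<in> D. index (T b) = k} b"
proof -
  obtain x y where xy: "b = (x, y)" by (cases b)
  have bD: "(x, y) \<in> D" "index (T (x, y)) = k" using b xy by auto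
  have "\<not> is_marked (T b)" if "(x, y - 1) \<in> D" "index (T (x, y - 1)) = k"
  proof
    assume m: "is_marked (T b)"
    have "T (x, y - 1) \<le> T (x, y)" using gsyt_row[OF T that(1) bD(1)] by simp
    then have "T (x, y - 1) = T (x, y)" using m bD that xy by (intro letter_le_marked) auto
    then have "y - 1 = y" using gsyt_row_marked[OF T that(1) bD(1)] m xy by simp
    then show False by simp
  qed
  moreover have "is_marked (T b)" if "(x + 1, y) \<in> D" "index (T (x + 1, y)) = k"
  proof (rule ccontr)
    assume m: "\<not> is_marked (T b)"
    have "T (x, y) \<le> T (x + 1, y)" using gsyt_col[OF T bD(1) that(1)] by simp
    then have "T (x, y) = T (x + 1, y)" using m bD that xy by (intro letter_ge_unmarked) auto
    then have "x = x + 1" using gsyt_col_unmarked[OF T bD(1) that(1)] m xy by simp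
    then show False by simp
  qed
  ultimately show ?thesis using b xy by (auto simp: admissible_def)
qed

definition tableaux :: "nat set \<Rightarrow> nat set \<Rightarrow> nat \<Rightarrow> (nat \<Rightarrow> nat) \<Rightarrow> (box \<Rightarrow> letter) set" where
  "tableaux A B n a = {T \<in> gsyt (skew A B). (\<forall>b\<in>skew A B. index (T b) \<le> n) \<and> content (skew A B) T = a}"

lemma finite_skew: "parts A \<Longrightarrow> finite (skew A B)"
  using card_boxes by (simp add: skew_def)

lemma finite_tableaux: "parts A \<Longrightarrow> finite (tableaux A B n a)"
  by (rule finite_subset[OF _ finite_gsyt_content[OF finite_skew, of A B a]]) (auto simp: tableaux_def)

text \<open>By monotonicity, \<open>B\<close> and the boxes of index at most \<open>n\<close> form
  an order ideal, hence the diagram of a set \<open>S\<close>. The marking rules make the rest a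
  strip.\<close>

lemma tableaux_cover:
  assumes A: "parts A" and B: "parts B" and BA: "inside B A" and T: "T \<in> tableaux A B (Suc n) a"
  obtains S where "S \<in> below A" "inside B S" "\<Sum>A - \<Sum>S = a (Suc n)"
    "{b \<in> skew A B. index (T b) \<le> n} = skew S B"
proof -
  define X where "X = {b \<in> skew A B. index (T b) = Suc n}"
  have gT: "T \<in> gsyt (skew A B)" and le: "\<And>b. b \<in> skew A B \<Longrightarrow> index (T b) \<le> Suc n"
    and ct: "content (skew A B) T = a"
    using T by (auto simp: tableaux_def)
  obtain N where N: "A \<subseteq> {1..N}" using parts_bounded A by blast
  define I where "I = boxes B \<union> {b \<in> skew A B. index (T b) \<le> n}"
  have BsA: "boxes B \<subseteq> boxes A" using BA boxes_subset_iff by blast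
  have closedI: "(x', y') \<in> I" if xy: "(x, y) \<in> I" "1 \<le> x'" "x' \<le> x" "x' \<le> y'" "y' \<le> y" for x y x' y'
  proof (cases "(x', y') \<in> boxes B")
    case False
    then have nB: "(x, y) \<notin> boxes B" using boxes_ideal[of B x y x' y'] B xy by auto
    then have xyD: "(x, y) \<in> skew A B" "index (T (x, y)) \<le> n" using xy by (auto simp: I_def)
    then have "(x', y') \<in> boxes A" using boxes_ideal[of A x y x' y'] A xy by (auto simp: skew_def)
    then have D: "(x', y') \<in> skew A B" using False by (simp add: skew_def)
    then have "T (x', y') \<le> T (x, y)" using gsyt_mono[OF gT _ _ D xyD(1)] A B xy by auto
    then have "index (T (x', y')) \<le> n" using letter_le_index[of "T (x', y')" "T (x, y)"] xyD by linarith
    then show ?thesis using D by (simp add: I_def)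
  qed (simp add: I_def)
  have IA: "I \<subseteq> boxes A" using BsA by (auto simp: I_def skew_def)
  have "\<exists>S\<subseteq>{1..N}. boxes S = I"
  proof (rule ideal_is_boxes[OF N IA])
    show "(x', y') \<in> I" if "(x, y) \<in> I" "1 \<le> x'" "x' \<le> x" "x' \<le> y'" "y' \<le> y" for x y x' y'
      using that by (rule closedI)
  qed
  then obtain S where S: "S \<subseteq> {1..N}" "boxes S = I" by blast
  have pS: "parts S" using S parts_subset by blast
  have XS: "X = boxes A - boxes S"
    unfolding S(2) using le BsA by (force simp: X_def I_def skew_def)
  have SB: "{b \<in> skew A B. index (T b) \<le> n} = skew S B"
    unfolding skew_def S(2) by (auto simp: I_def skew_def)
  have SA: "inside S A" using S IA boxes_subset_iff by blast
  have BS: "inside B S" unfolding boxes_subset_iff[symmetric] S(2) by (simp add: I_def)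
  have "card X = a (Suc n)" using ct by (auto simp: content_def X_def)
  moreover have "card X = \<Sum>A - \<Sum>S"
    unfolding XS using card_boxes A pS SA boxes_subset_iff by (subst card_Diff_subset) auto
  moreover have "interlaced A S"
    unfolding interlaced_def
  proof (intro allI impI conjI)
    fix e :: nat assume e: "1 \<le> e"
    show "cnt S e \<le> cnt A e" using SA e by (simp add: inside_def)
    show "cnt A e \<le> Suc (cnt S e)"
    proof (rule ccontr)
      define i where "i = Suc (cnt S e)"
      assume "\<not> ?thesis"
      then have b1: "box_at e i \<in> X" and b2: "box_at e (Suc i) \<in> X"
        unfolding XS using e by (auto simp: box_at_mem i_def)
      \<comment> \<open>This box is right of the first and above the second of the two boxes. Its
        left neighbour forbids a mark, its lower neighbour demands one.\<close>
      have b3: "box_at (Suc e) i \<in> X"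
      proof -
        have "box_at e i \<in> skew A S" "box_at e (Suc i) \<in> skew A S" using b1 b2 by (auto simp: XS skew_def)
        then show ?thesis
          using skew_convex[of A S _ _ _ _ "int i" "int i + int e"] A pS
          by (force simp: XS skew_def[symmetric] box_at_def)
      qed
      have "T (box_at (Suc e) i) \<in> admissible (Suc n) X (box_at (Suc e) i)"
        unfolding X_def by (rule gsyt_admissible[OF gT]) (use b3 in \<open>simp add: X_def\<close>)
      then show False using b1 b2 by (auto simp: admissible_def box_at_def algebra_simps)
    qed
  qed
  ultimately show thesis using that[of S] pS BS SB by (auto simp: below_def)
qed

text \<open>Within the strip only neighbours matter: of two strip boxes in one row, the right one
  has its left neighbour in the strip by convexity and is therefore unmarked; of two in one column,
  the upper one is marked.\<close>

lemma gsyt_extend: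
  assumes A: "parts A" and S: "parts S" and SA: "inside S A"
    and T: "T \<in> gsyt (skew S B)" "\<And>b. b \<in> skew S B \<Longrightarrow> index (T b) \<le> n"
    and g: "\<And>b. b \<in> boxes A - boxes S \<Longrightarrow> g b \<in> admissible (Suc n) (boxes A - boxes S) b"
    and B: "parts B" and BS: "inside B S"
  shows "(\<lambda>b. if b \<in> boxes A - boxes S then g b else T b) \<in> gsyt (skew A B)"
proof -
  define X where "X = boxes A - boxes S"
  define D where "D = skew A B"
  define T' where "T' b = (if b \<in> X then g b else T b)" for b
  have D: "D = skew S B \<union> X"
    using SA BS unfolding D_def X_def skew_def boxes_subset_iff[symmetric] by auto
  have disj: "b \<notin> X" if "b \<in> skew S B" for b using that by (auto simp: X_def skew_def)
  have idx: "index (T' b) = Suc n" if "b \<in> X" for b using g[of b] that by (simp add: T'_def X_def admissible_def)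
  have low: "T' b = T b" "index (T' b) \<le> n" if "b \<in> skew S B" for b
    using disj[OF that] T(2)[OF that] by (auto simp: T'_def)
  \<comment> \<open>A box of the strip never precedes a box of \<open>S\<close>, because
    \<open>S\<close> is closed towards the upper left.\<close>
  have cases: "(b \<in> skew S B \<and> b' \<in> skew S B) \<or> (b \<in> skew S B \<and> b' \<in> X) \<or> (b \<in> X \<and> b' \<in> X)"
    if "b \<in> D" "b' \<in> D" "fst b \<le> fst b'" "snd b \<le> snd b'" for b b'
  proof (rule ccontr)
    assume "\<not> ?thesis"
    then have *: "b \<in> X" "b' \<in> boxes S" using that D by (auto simp: skew_def)
    have "1 \<le> fst b" "fst b \<le> snd b" using * by (auto simp: X_def boxes_def)
    then have "b \<in> boxes S" using boxes_ideal[of S "fst b'" "snd b'" "fst b" "snd b"] * S that by auto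
    then show False using * by (auto simp: X_def)
  qed
  have left: "\<not> is_marked (T' (x, y'))" if "(x, y) \<in> X" "(x, y') \<in> X" "y < y'" for x y y'
  proof -
    have "x \<le> y" using that by (auto simp: X_def boxes_mem)
    then have "(x, y' - 1) \<in> X"
      using skew_convex[of A S x y x y' x "y' - 1"] A S that by (auto simp: X_def skew_def)
    then show ?thesis using g[of "(x, y')"] that by (auto simp: T'_def X_def admissible_def)
  qed
  have up: "is_marked (T' (x, y))" if "(x, y) \<in> X" "(x', y) \<in> X" "x < x'" for x x' y
  proof -
    have "x' \<le> y" using that by (auto simp: X_def boxes_mem)
    then have "(x + 1, y) \<in> X"
      using skew_convex[of A S x y x' y "x + 1" y] A S that by (auto simp: X_def skew_def)
    then show ?thesis using g[of "(x, y)"] that by (auto simp: T'_def X_def admissible_def)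
  qed
  have "T' \<in> gsyt D"
    unfolding gsyt_def
  proof (intro CollectI conjI allI impI)
    have "T' b \<in> alphabet" if "b \<in> D" for b
    proof (cases "b \<in> X")
      case False
      then have "b \<in> skew S B" using that D by auto
      then show ?thesis using T(1) low by (auto simp: gsyt_def)
    qed (auto simp: alphabet_def idx)
    moreover have "T' b = undefined" if "b \<notin> D" for b
      using that T(1) D by (auto simp: T'_def gsyt_def)
    ultimately show "T' \<in> D \<rightarrow>\<^sub>E alphabet" by (simp add: PiE_iff extensional_def)
  next
    fix x y y' assume *: "(x, y) \<in> D \<and> (x, y') \<in> D \<and> y \<le> y'"
    then consider "(x, y) \<in> skew S B" "(x, y') \<in> skew S B" | "(x, y) \<in> skew S B" "(x, y') \<in> X"
      | "(x, y) \<in> X" "(x, y') \<in> X" using cases[of "(x, y)" "(x, y')"] by auto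
    then show "T' (x, y) \<le> T' (x, y')"
    proof cases
      case 1
      then show ?thesis using gsyt_row[OF T(1) 1] * by (simp add: low)
    next
      case 2
      then show ?thesis using low(2)[OF 2(1)] idx[OF 2(2)] by (intro letter_leI) simp
    next
      case 3
      then show ?thesis using left[of x y y'] * idx by (cases "y = y'") (auto simp: less_eq_letter_def)
    qed
  next
    fix x x' y assume *: "(x, y) \<in> D \<and> (x', y) \<in> D \<and> x \<le> x'"
    then consider "(x, y) \<in> skew S B" "(x', y) \<in> skew S B" | "(x, y) \<in> skew S B" "(x', y) \<in> X"
      | "(x, y) \<in> X" "(x', y) \<in> X" using cases[of "(x, y)" "(x', y)"] by auto
    then show "T' (x, y) \<le> T' (x', y)"
    proof cases
      case 1
      then show ?thesis using gsyt_col[OF T(1) 1] * by (simp add: low)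
    next
      case 2
      then show ?thesis using low(2)[OF 2(1)] idx[OF 2(2)] by (intro letter_leI) simp
    next
      case 3
      then show ?thesis using up[of x y x'] * idx by (cases "x = x'") (auto simp: less_eq_letter_def)
    qed
  next
    fix x y y' assume *: "(x, y) \<in> D \<and> (x, y') \<in> D \<and> is_marked (T' (x, y)) \<and> T' (x, y) = T' (x, y')"
    have **: "y = y'" if "(x, y) \<in> D" "(x, y') \<in> D" "is_marked (T' (x, y))" "T' (x, y) = T' (x, y')" "y \<le> y'" for y y'
    proof -
      note h = that
      consider "(x, y) \<in> skew S B" "(x, y') \<in> skew S B" | "(x, y) \<in> skew S B" "(x, y') \<in> X"
        | "(x, y) \<in> X" "(x, y') \<in> X" using cases[of "(x, y)" "(x, y')"] h by auto
      then show ?thesis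
      proof cases
        case 1
        then show ?thesis using gsyt_row_marked[OF T(1) 1] that by (simp add: low)
      next
        case 2
        then show ?thesis using low(2)[OF 2(1)] idx[OF 2(2)] that by auto
      next
        case 3
        then show ?thesis using left[of x y y'] that by (cases "y = y'") auto
      qed
    qed
    have "is_marked (T' (x, y'))" using * by metis
    then show "y = y'" using **[of y y'] **[of y' y] * linear[of y y'] by metis
  next
    fix x x' y assume *: "(x, y) \<in> D \<and> (x', y) \<in> D \<and> \<not> is_marked (T' (x, y)) \<and> T' (x, y) = T' (x', y)"
    have **: "x = x'" if "(x, y) \<in> D" "(x', y) \<in> D" "\<not> is_marked (T' (x, y))" "T' (x, y) = T' (x', y)" "x \<le> x'" for x x'
    proof -
      note h = that
      consider "(x, y) \<in> skew S B" "(x', y) \<in> skew S B" | "(x, y) \<in> skew S B" "(x', y) \<in> X"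
        | "(x, y) \<in> X" "(x', y) \<in> X" using cases[of "(x, y)" "(x', y)"] h by auto
      then show ?thesis
      proof cases
        case 1
        then show ?thesis using gsyt_col_unmarked[OF T(1) 1] that by (simp add: low)
      next
        case 2
        then show ?thesis using low(2)[OF 2(1)] idx[OF 2(2)] that by auto
      next
        case 3
        then show ?thesis using up[of x y x'] that by (cases "x = x'") auto
      qed
    qed
    have "\<not> is_marked (T' (x', y))" using * by metis
    then show "x = x'" using **[of x x'] **[of x' x] * linear[of x x'] by metis
  qed
  then show ?thesis by (simp add: T'_def[abs_def] D_def X_def)
qed

text \<open>Both cardinalities count the runs of consecutive numbers in \<open>E\<close>.\<close>

lemma card_run_starts:
  assumes "finite E" "0 \<notin> E"
  shows "card {e \<in> E. e - 1 \<notin> E} = card {e \<in> E. Suc e \<notin> E}"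
proof -
  have "bij_betw Suc {e \<in> E. Suc e \<in> E} {e \<in> E. e - 1 \<in> E}"
  proof (rule bij_betwI')
    fix y assume "y \<in> {e \<in> E. e - 1 \<in> E}"
    moreover from this have "y \<noteq> 0" using assms by (auto intro: ccontr)
    ultimately show "\<exists>x\<in>{e \<in> E. Suc e \<in> E}. y = Suc x" by (intro bexI[of _ "y - 1"]) auto
  qed auto
  then have "card {e \<in> E. Suc e \<in> E} = card {e \<in> E. e - 1 \<in> E}" by (rule bij_betw_same_card)
  moreover have "card E = card {e \<in> E. P e} + card {e \<in> E. \<not> P e}" for P
    using assms by (subst card_Un_disjoint[symmetric]) (auto intro: arg_cong[where f=card])
  from this[of "\<lambda>e. Suc e \<in> E"] this[of "\<lambda>e. e - 1 \<in> E"]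
  have "card {e \<in> E. Suc e \<in> E} + card {e \<in> E. Suc e \<notin> E}
      = card {e \<in> E. e - 1 \<in> E} + card {e \<in> E. e - 1 \<notin> E}" by linarith
  ultimately show ?thesis by linarith
qed

lemma interlaced_diff:
  assumes "parts A" "parts S" "interlaced A S"
  shows "card (A - S) = card {e \<in> diags A S. e - 1 \<notin> diags A S}"
proof -
  have "layer A S A" using assms by (auto simp: layer_def interlaced_def min_def)
  then have "A - S = {e \<in> diags A S. Suc e \<notin> diags A S}"
    using layer_diff[OF assms(1,2) interlaced_inside[OF assms(3)]] by blast
  then show ?thesis
    using card_run_starts[of "diags A S"] finite_diags[OF assms(1)] by (simp add: diags_def)
qed

lemma card_admissible:
  assumes "\<not> (P \<and> Q)"
  shows "card {L. index L = k \<and> (P \<longrightarrow> \<not> is_marked L) \<and> (Q \<longrightarrow> is_marked L)} = (if P \<or> Q then 1 else 2)"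
proof -
  have "{L. index L = k \<and> (P \<longrightarrow> \<not> is_marked L) \<and> (Q \<longrightarrow> is_marked L)}
      = (if P then {Unmarked k} else if Q then {Marked k} else {Marked k, Unmarked k})" (is "?L = ?R")
  proof (rule set_eqI)
    fix L show "L \<in> ?L \<longleftrightarrow> L \<in> ?R" using assms by (cases L) auto
  qed
  then show ?thesis using assms by auto
qed

text \<open>The left and the lower neighbour of a box both lie on the preceding diagonal, where the
  strip has at most one box. So the letter is forced unless a run of diagonals starts at this box,
  and then it has two values.\<close>

lemma prod_card_admissible:
  assumes A: "parts A" and S: "parts S" and i: "interlaced A S"
  shows "(\<Prod>b\<in>skew A S. card (admissible k (skew A S) b)) = 2 ^ card (A - S)"
proof -
  define E where "E = diags A S"
  define h where "h e = box_at e (cnt A e)" for e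
  have E1: "1 \<le> e" if "e \<in> E" for e using that by (simp add: E_def diags_def)
  have X: "box_at e j \<in> skew A S \<longleftrightarrow> e \<in> E \<and> j = cnt A e" if "1 \<le> e" for e j
    using that i by (auto simp: skew_def box_at_mem E_def diags_def interlaced_def)
  have Xh: "skew A S = h ` E"
  proof (rule set_eqI, rule prod_cases)
    fix b :: box and x y
    show "(x, y) \<in> skew A S \<longleftrightarrow> (x, y) \<in> h ` E"
    proof
      assume *: "(x, y) \<in> skew A S"
      then have "1 \<le> x" "x \<le> y" by (auto simp: skew_def boxes_mem)
      then obtain e j where "(x, y) = box_at e j" "1 \<le> e" using box_at_cases by metis
      then show "(x, y) \<in> h ` E" using * X by (auto simp: h_def)
    next
      assume "(x, y) \<in> h ` E"
      then show "(x, y) \<in> skew A S" using X E1 by (auto simp: h_def)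
    qed
  qed
  have inj: "inj_on h E" by (auto simp: inj_on_def h_def box_at_inj)
  have fin: "finite E" using finite_diags[OF A] by (simp add: E_def)
  have "card (admissible k (skew A S) (h e)) = (if e - 1 \<in> E then 1 else 2)" if e: "e \<in> E" for e
  proof -
    define P where "P \<longleftrightarrow> (fst (h e), snd (h e) - 1) \<in> skew A S"
    define Q where "Q \<longleftrightarrow> (fst (h e) + 1, snd (h e)) \<in> skew A S"
    obtain d where d: "e = Suc d" using E1[OF e] by (cases e) auto
    have "(P \<longleftrightarrow> d \<in> E \<and> cnt A e = cnt A d) \<and> (Q \<longleftrightarrow> d \<in> E \<and> Suc (cnt A e) = cnt A d)"
    proof (cases "d = 0")
      case True
      then show ?thesis using E1[of 0] d by (auto simp: P_def Q_def h_def box_at_def skew_def boxes_mem)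
    next
      case False
      have "(fst (h e), snd (h e) - 1) = box_at d (cnt A e)" "(fst (h e) + 1, snd (h e)) = box_at d (Suc (cnt A e))"
        using d by (auto simp: h_def box_at_def)
      then show ?thesis using X[of d] False by (simp add: P_def Q_def)
    qed
    moreover have "cnt A d = cnt A e \<or> cnt A d = Suc (cnt A e)" using cnt_Suc[of A d] A d by auto
    ultimately have "\<not> (P \<and> Q)" "P \<or> Q \<longleftrightarrow> e - 1 \<in> E" using d by auto
    then show ?thesis using card_admissible[of P Q k] by (simp add: admissible_def P_def Q_def)
  qed
  then have "(\<Prod>b\<in>skew A S. card (admissible k (skew A S) b)) = (\<Prod>e\<in>E. if e - 1 \<in> E then 1 else 2)"
    unfolding Xh prod.reindex[OF inj] by (simp add: Xh)
  also have "\<dots> = 2 ^ card {e \<in> E. e - 1 \<notin> E}"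
    using fin by (simp add: prod.If_cases Int_def)
  finally show ?thesis using interlaced_diff[OF A S i] by (simp add: E_def)
qed

lemma gsyt_restrict: "T \<in> gsyt D \<Longrightarrow> D' \<subseteq> D \<Longrightarrow> restrict T D' \<in> gsyt D'"
proof -
  assume T: "T \<in> gsyt D" and D: "D' \<subseteq> D"
  have "T b \<in> alphabet" if "b \<in> D'" for b using T D that by (auto simp: gsyt_def)
  moreover have "T (x, y) \<le> T (x, y')" if "(x, y) \<in> D'" "(x, y') \<in> D'" "y \<le> y'" for x y y'
    using gsyt_row[OF T] D that by blast
  moreover have "T (x, y) \<le> T (x', y)" if "(x, y) \<in> D'" "(x', y) \<in> D'" "x \<le> x'" for x x' y
    using gsyt_col[OF T] D that by blast
  moreover have "y = y'" if "(x, y) \<in> D'" "(x, y') \<in> D'" "is_marked (T (x, y))" "T (x, y) = T (x, y')" for x y y'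
    using gsyt_row_marked[OF T] D that by blast
  moreover have "x = x'" if "(x, y) \<in> D'" "(x', y) \<in> D'" "\<not> is_marked (T (x, y))" "T (x, y) = T (x', y)" for x x' y
    using gsyt_col_unmarked[OF T] D that by blast
  ultimately have *: "(\<forall>x y y'. (x, y) \<in> D' \<and> (x, y') \<in> D' \<and> y \<le> y' \<longrightarrow> T (x, y) \<le> T (x, y')) \<and>
     (\<forall>x x' y. (x, y) \<in> D' \<and> (x', y) \<in> D' \<and> x \<le> x' \<longrightarrow> T (x, y) \<le> T (x', y)) \<and>
     (\<forall>x y y'. (x, y) \<in> D' \<and> (x, y') \<in> D' \<and> is_marked (T (x, y)) \<and> T (x, y) = T (x, y') \<longrightarrow> y = y') \<and>
     (\<forall>x x' y. (x, y) \<in> D' \<and> (x', y) \<in> D' \<and> \<not> is_marked (T (x, y)) \<and> T (x, y) = T (x', y) \<longrightarrow> x = x')"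
     "restrict T D' \<in> D' \<rightarrow>\<^sub>E alphabet" by (intro conjI allI impI; (elim conjE)?; blast | simp)+
  then show ?thesis
    unfolding gsyt_def mem_Collect_eq by (simp cong: conj_cong)
qed

definition tableaux_over :: "nat set \<Rightarrow> nat set \<Rightarrow> nat \<Rightarrow> (nat \<Rightarrow> nat) \<Rightarrow> nat set \<Rightarrow> (box \<Rightarrow> letter) set" where
  "tableaux_over A B n a S = {T \<in> tableaux A B (Suc n) a. {b \<in> skew A B. index (T b) \<le> n} = skew S B}"

lemma skew_split:
  assumes "inside B S" "inside S A"
  shows "skew A B = skew S B \<union> skew A S" "skew S B \<inter> skew A S = {}"
  using assms unfolding boxes_subset_iff[symmetric] skew_def by auto

text \<open>Restriction splits a tableau into its smaller letters and the letters of the strip, and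
  these are chosen independently.\<close>

lemma card_tableaux_over:
  assumes A: "parts A" and B: "parts B" and S: "S \<in> below A" and BS: "inside B S"
    and sz: "\<Sum>A - \<Sum>S = a (Suc n)"
  shows "card (tableaux_over A B n a S) = card (tableaux S B n (a(Suc n := 0))) * 2 ^ card (A - S)"
proof -
  define X where "X = skew A S"
  define f where "f = (\<lambda>(T :: box \<Rightarrow> letter, g :: box \<Rightarrow> letter) b. if b \<in> X then g b else T b)"
  define f' where "f' T = (restrict T (skew S B), restrict T X)" for T :: "box \<Rightarrow> letter"
  have pS: "parts S" and i: "interlaced A S" using S by (auto simp: below_def)
  note SA = interlaced_inside[OF i]
  note D = skew_split[OF BS SA, folded X_def]
  have finX: "finite X" using finite_skew[OF A] by (simp add: X_def)
  have cX: "card X = a (Suc n)"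
    unfolding X_def skew_def using card_boxes A pS SA boxes_subset_iff sz by (subst card_Diff_subset) auto
  have "bij_betw f (tableaux S B n (a(Suc n := 0)) \<times> PiE X (admissible (Suc n) X)) (tableaux_over A B n a S)"
  proof (rule bij_betw_byWitness[of _ f'])
    show "\<forall>p\<in>tableaux S B n (a(Suc n := 0)) \<times> PiE X (admissible (Suc n) X). f' (f p) = p"
    proof
      fix p assume "p \<in> tableaux S B n (a(Suc n := 0)) \<times> PiE X (admissible (Suc n) X)"
      then obtain T g where p: "p = (T, g)" and T: "T \<in> extensional (skew S B)" and g: "g \<in> extensional X"
        by (auto simp: tableaux_def gsyt_def PiE_def)
      have "restrict (f (T, g)) (skew S B) = T"
        using D(2) T by (intro ext) (auto simp: f_def restrict_def extensional_def)
      moreover have "restrict (f (T, g)) X = g"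
        using g by (intro ext) (auto simp: f_def restrict_def extensional_def)
      ultimately show "f' (f p) = p" by (simp add: p f'_def)
    qed
    show "\<forall>T\<in>tableaux_over A B n a S. f (f' T) = T"
    proof
      fix T assume "T \<in> tableaux_over A B n a S"
      then have "T \<in> extensional (skew A B)" by (auto simp: tableaux_over_def tableaux_def gsyt_def PiE_def)
      then show "f (f' T) = T"
        unfolding D by (intro ext) (auto simp: f_def f'_def restrict_def extensional_def)
    qed
    show "f ` (tableaux S B n (a(Suc n := 0)) \<times> PiE X (admissible (Suc n) X)) \<subseteq> tableaux_over A B n a S"
    proof (rule image_subsetI)
      fix p assume "p \<in> tableaux S B n (a(Suc n := 0)) \<times> PiE X (admissible (Suc n) X)"
      then obtain T g where p: "p = (T, g)" and T: "T \<in> tableaux S B n (a(Suc n := 0))" and g: "g \<in> PiE X (admissible (Suc n) X)"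
        by auto
      have T1: "T \<in> gsyt (skew S B)" "\<And>b. b \<in> skew S B \<Longrightarrow> index (T b) \<le> n"
        and ct: "content (skew S B) T = a(Suc n := 0)"
        using T by (auto simp: tableaux_def)
      have g1: "g b \<in> admissible (Suc n) X b" if "b \<in> X" for b using g that by auto
      have fp: "f p = (\<lambda>b. if b \<in> X then g b else T b)" by (simp add: f_def p)
      have gs: "f p \<in> gsyt (skew A B)"
        unfolding fp X_def skew_def[of A S]
        by (rule gsyt_extend[OF A pS SA T1 _ B BS]) (use g1 in \<open>auto simp: X_def skew_def\<close>)
      have idX: "index (f p b) = Suc n" if "b \<in> X" for b using g1[OF that] that by (simp add: fp admissible_def)
      have idS: "index (f p b) = index (T b)" "index (T b) \<le> n" if "b \<in> skew S B" for b
        using that D(2) T1(2)[OF that] by (auto simp: fp)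
      have le: "index (f p b) \<le> Suc n" if "b \<in> skew A B" for b
        using that idX idS unfolding D by fastforce
      have "content (skew A B) (f p) s = a s" for s
      proof (cases "s = Suc n")
        case True
        have "{b \<in> skew A B. index (f p b) = s} = X"
          unfolding D True using idX idS by fastforce
        then show ?thesis using True cX by (simp add: content_def)
      next
        case False
        have "{b \<in> skew A B. index (f p b) = s} = {b \<in> skew S B. index (T b) = s}"
          unfolding D using idX idS False by fastforce
        then show ?thesis using fun_cong[OF ct, of s] False by (simp add: content_def)
      qed
      moreover have "{b \<in> skew A B. index (f p b) \<le> n} = skew S B"
        unfolding D using idX idS by fastforce
      ultimately show "f p \<in> tableaux_over A B n a S" using gs le by (auto simp: tableaux_over_def tableaux_def)
    qed
    show "f' ` tableaux_over A B n a S \<subseteq> tableaux S B n (a(Suc n := 0)) \<times> PiE X (admissible (Suc n) X)"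
    proof (rule image_subsetI)
      fix T assume "T \<in> tableaux_over A B n a S"
      then have gs: "T \<in> gsyt (skew A B)" and le: "\<And>b. b \<in> skew A B \<Longrightarrow> index (T b) \<le> Suc n"
        and ct: "content (skew A B) T = a" and SB: "{b \<in> skew A B. index (T b) \<le> n} = skew S B"
        by (auto simp: tableaux_over_def tableaux_def)
      have idS: "index (T b) \<le> n" if "b \<in> skew S B" for b using that SB by blast
      have X: "{b \<in> skew A B. index (T b) = Suc n} = X"
      proof (rule set_eqI)
        fix b
        have "index (T b) = Suc n \<longleftrightarrow> \<not> index (T b) \<le> n" if "b \<in> skew A B"
          using le[OF that] by linarith
        then have "b \<in> {b \<in> skew A B. index (T b) = Suc n}
            \<longleftrightarrow> b \<in> skew A B \<and> b \<notin> {b \<in> skew A B. index (T b) \<le> n}" by blast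
        then show "b \<in> {b \<in> skew A B. index (T b) = Suc n} \<longleftrightarrow> b \<in> X"
          unfolding SB using D by blast
      qed
      have "restrict T X \<in> PiE X (admissible (Suc n) X)"
        using gsyt_admissible[OF gs, of _ "Suc n"] unfolding X by auto
      moreover have "restrict T (skew S B) \<in> gsyt (skew S B)"
        using gsyt_restrict[OF gs] D by blast
      moreover have "content (skew S B) (restrict T (skew S B)) s = (a(Suc n := 0)) s" for s
      proof (cases "s = Suc n")
        case True
        have "{b \<in> skew S B. index (restrict T (skew S B) b) = s} = {}"
          using idS True by fastforce
        then have "content (skew S B) (restrict T (skew S B)) s = 0"
          unfolding content_def by (simp only: card.empty)
        then show ?thesis using True by simp
      next
        case False
        have "{b \<in> skew S B. index (restrict T (skew S B) b) = s} = {b \<in> skew A B. index (T b) = s}"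
          unfolding D using X False by auto
        then show ?thesis using fun_cong[OF ct, of s] False by (simp add: content_def)
      qed
      ultimately show "f' T \<in> tableaux S B n (a(Suc n := 0)) \<times> PiE X (admissible (Suc n) X)"
        using idS by (auto simp: f'_def tableaux_def)
    qed
  qed
  then have "card (tableaux_over A B n a S) = card (tableaux S B n (a(Suc n := 0)) \<times> PiE X (admissible (Suc n) X))"
    using bij_betw_same_card by metis
  also have "\<dots> = card (tableaux S B n (a(Suc n := 0))) * 2 ^ card (A - S)"
    unfolding card_cartesian_product card_PiE[OF finX] using prod_card_admissible[OF A pS i] by (simp add: X_def)
  finally show ?thesis .
qed

lemma card_tableaux_Suc:
  assumes A: "parts A" and B: "parts B" and BA: "inside B A"
  shows "real (card (tableaux A B (Suc n) a))
    = (\<Sum>S\<in>below A. strip (delta (a (Suc n))) A S * (if inside B S then real (card (tableaux S B n (a(Suc n := 0)))) else 0))"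
proof -
  define F where "F = {S \<in> below A. inside B S \<and> \<Sum>A - \<Sum>S = a (Suc n)}"
  have finF: "finite F" using finite_below[OF A] by (simp add: F_def)
  have "tableaux A B (Suc n) a = (\<Union>S\<in>F. tableaux_over A B n a S)"
  proof
    show "tableaux A B (Suc n) a \<subseteq> (\<Union>S\<in>F. tableaux_over A B n a S)"
    proof
      fix T assume T: "T \<in> tableaux A B (Suc n) a"
      obtain S where "S \<in> below A" "inside B S" "\<Sum>A - \<Sum>S = a (Suc n)"
          "{b \<in> skew A B. index (T b) \<le> n} = skew S B" by (rule tableaux_cover[OF A B BA T])
      then show "T \<in> (\<Union>S\<in>F. tableaux_over A B n a S)" using T by (auto simp: F_def tableaux_over_def)
    qed
  qed (auto simp: tableaux_over_def)
  moreover have "card (\<Union>S\<in>F. tableaux_over A B n a S) = (\<Sum>S\<in>F. card (tableaux_over A B n a S))"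
  proof (rule card_UN_disjoint[OF finF])
    show "\<forall>S\<in>F. finite (tableaux_over A B n a S)" using finite_tableaux[OF A] by (auto simp: tableaux_over_def)
    show "\<forall>S\<in>F. \<forall>S'\<in>F. S \<noteq> S' \<longrightarrow> tableaux_over A B n a S \<inter> tableaux_over A B n a S' = {}"
    proof (intro ballI impI, rule ccontr)
      fix S S' assume SS: "S \<in> F" "S' \<in> F" "S \<noteq> S'" "tableaux_over A B n a S \<inter> tableaux_over A B n a S' \<noteq> {}"
      then have "skew S B = skew S' B" by (auto simp: tableaux_over_def)
      moreover have "boxes B \<subseteq> boxes S" "boxes B \<subseteq> boxes S'" using SS boxes_subset_iff by (auto simp: F_def)
      ultimately have "boxes S = boxes S'" by (auto simp: skew_def)
      moreover have "parts S" "parts S'" using SS by (auto simp: F_def below_def)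
      ultimately have "S = S'"
        using inside_sum_eq boxes_subset_iff inside_sum by (metis order_antisym order_refl)
      then show False using SS by simp
    qed
  qed
  ultimately have "real (card (tableaux A B (Suc n) a)) = (\<Sum>S\<in>F. real (card (tableaux_over A B n a S)))" by simp
  also have "\<dots> = (\<Sum>S\<in>F. strip (delta (a (Suc n))) A S * real (card (tableaux S B n (a(Suc n := 0)))))"
  proof (rule sum.cong[OF refl])
    fix S assume S: "S \<in> F"
    then have "weight A S = 2 ^ card (A - S)" by (auto simp: F_def below_def weight_def)
    then show "real (card (tableaux_over A B n a S)) = strip (delta (a (Suc n))) A S * real (card (tableaux S B n (a(Suc n := 0))))"
      using S card_tableaux_over[OF A B, of S a n] by (simp add: F_def strip_delta)
  qed
  also have "\<dots> = (\<Sum>S\<in>below A. strip (delta (a (Suc n))) A S * (if inside B S then real (card (tableaux S B n (a(Suc n := 0)))) else 0))"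
    using finite_below[OF A] by (intro sum.mono_neutral_cong_left) (auto simp: F_def strip_delta)
  finally show ?thesis .
qed

lemma gsyt_index: "T \<in> gsyt D \<Longrightarrow> b \<in> D \<Longrightarrow> 1 \<le> index (T b)"
  unfolding gsyt_def alphabet_def by blast

lemma content_0:
  assumes "T \<in> gsyt D"
  shows "content D T 0 = 0"
proof -
  have "{b \<in> D. index (T b) = 0} = {}" using gsyt_index[OF assms] by force
  then show ?thesis unfolding content_def by (simp only: card.empty)
qed

text \<open>The word lists the exponents from the largest letter downwards, since the largest
  letters fill the outermost strip.\<close>

theorem card_tableaux:
  assumes "parts A" "parts B" "inside B A" "a 0 = 0" "\<And>s. s > n \<Longrightarrow> a s = 0"
  shows "real (card (tableaux A B n a)) = Qc (map a (rev [1..<Suc n])) A B"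
  using assms
proof (induction n arbitrary: A a)
  case 0
  show ?case
  proof (cases "A = B")
    case True
    have "a s = 0" for s using 0 by (cases s) auto
    then have "a = (\<lambda>_. 0)" by blast
    then have "tableaux A B 0 a = {\<lambda>_. undefined}"
      using True by (auto simp: tableaux_def skew_def gsyt_def content_def)
    then show ?thesis using True by simp
  next
    case False
    have "tableaux A B 0 a = {}"
    proof (rule equals0I)
      fix T assume T: "T \<in> tableaux A B 0 a"
      then have "b \<notin> skew A B" for b
        using gsyt_index[of T "skew A B" b] by (auto simp: tableaux_def)
      then have "skew A B = {}" by blast
      then have "inside A B" by (simp add: skew_def flip: boxes_subset_iff)
      then show False using False 0 inside_sum_eq inside_sum by (metis order_antisym)
    qed
    then show ?thesis using False by simp
  qed
next
  case (Suc n)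
  have "(if inside B S then real (card (tableaux S B n (a(Suc n := 0)))) else 0) = Qc (map a (rev [1..<Suc n])) S B"
    if "S \<in> below A" for S
  proof (cases "inside B S")
    case True
    have "real (card (tableaux S B n (a(Suc n := 0)))) = Qc (map (a(Suc n := 0)) (rev [1..<Suc n])) S B"
      using Suc.prems that True by (intro Suc.IH) (auto simp: below_def)
    moreover have "map (a(Suc n := 0)) (rev [1..<Suc n]) = map a (rev [1..<Suc n])" by auto
    ultimately show ?thesis using True by simp
  next
    case False
    then show ?thesis using strips_nonzero_inside[of S] that by (auto simp: below_def)
  qed
  then show ?case
    unfolding card_tableaux_Suc[OF Suc.prems(1-3)] by (simp add: strips.simps)
qed

lemma content_pos: "finite D \<Longrightarrow> b \<in> D \<Longrightarrow> content D T (index (T b)) \<noteq> 0"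
  unfolding content_def by (subst card_0_eq) (simp, blast)

lemma Q_diagram_tableaux:
  assumes "parts A" "parts B" "inside B A"
  shows "a 0 = 0 \<Longrightarrow> (\<And>s. s > n \<Longrightarrow> a s = 0)
    \<Longrightarrow> real_of_int (Q_diagram (skew A B) a) = Qc (map a (rev [1..<Suc n])) A B"
    and "\<not> (a 0 = 0 \<and> (\<exists>n. \<forall>s>n. a s = 0)) \<Longrightarrow> Q_diagram (skew A B) a = 0"
proof -
  have fin: "finite (skew A B)" using finite_skew assms by blast
  show "real_of_int (Q_diagram (skew A B) a) = Qc (map a (rev [1..<Suc n])) A B"
    if a: "a 0 = 0" "\<And>s. s > n \<Longrightarrow> a s = 0"
  proof -
    have "{T \<in> gsyt (skew A B). content (skew A B) T = a} = tableaux A B n a"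
    proof -
      have "index (T b) \<le> n" if "content (skew A B) T = a" "b \<in> skew A B" for T b
        using content_pos[OF fin that(2), of T] a(2)[of "index (T b)"] that(1) by (metis not_le)
      then show ?thesis unfolding tableaux_def by blast
    qed
    then show ?thesis using card_tableaux[of A B a n] assms a by (simp add: Q_diagram_def)
  qed
  show "Q_diagram (skew A B) a = 0" if a: "\<not> (a 0 = 0 \<and> (\<exists>n. \<forall>s>n. a s = 0))"
  proof -
    have "content (skew A B) T \<noteq> a" if T: "T \<in> gsyt (skew A B)" for T
    proof
      assume c: "content (skew A B) T = a"
      have "content (skew A B) T s = 0" if "s > Max ((\<lambda>b. index (T b)) ` skew A B)" for s
      proof -
        have "index (T b) \<noteq> s" if "b \<in> skew A B" for b
          using Max_ge[of "(\<lambda>b. index (T b)) ` skew A B" "index (T b)"] that fin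
            \<open>s > Max ((\<lambda>b. index (T b)) ` skew A B)\<close> by fastforce
        then have "{b \<in> skew A B. index (T b) = s} = {}" by blast
        then show ?thesis unfolding content_def by (simp only: card.empty)
      qed
      then show False using content_0[OF T] a c by blast
    qed
    then have "{T \<in> gsyt (skew A B). content (skew A B) T = a} = {}" by blast
    then show ?thesis unfolding Q_diagram_def by (simp only: card.empty of_nat_0)
  qed
qed

text \<open>Every word is the reversed beginning of some exponent vector, and vectors not of this
  form have coefficient 0 on both sides; so comparing words is comparing power series.\<close>

lemma Q_diagram_eq_iff:
  assumes A: "parts A" "parts B" "inside B A" and A': "parts A'" "parts B'" "inside B' A'"
  shows "Q_diagram (skew A B) = Q_diagram (skew A' B') \<longleftrightarrow> (\<forall>w. Qc w A B = Qc w A' B')"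
proof
  assume Q: "Q_diagram (skew A B) = Q_diagram (skew A' B')"
  show "\<forall>w. Qc w A B = Qc w A' B'"
  proof
    fix w :: "nat list"
    define n where "n = length w"
    define a where "a s = (if 1 \<le> s \<and> s \<le> n then rev w ! (s - 1) else 0)" for s
    have "map a (rev [1..<Suc n]) = w"
      by (rule nth_equalityI) (auto simp: n_def a_def rev_nth simp del: upt_Suc)
    moreover have "a 0 = 0" "\<And>s. s > n \<Longrightarrow> a s = 0" by (auto simp: a_def)
    ultimately show "Qc w A B = Qc w A' B'"
      using Q_diagram_tableaux(1)[OF A, of a n] Q_diagram_tableaux(1)[OF A', of a n] Q by simp
  qed
next
  assume Qc: "\<forall>w. Qc w A B = Qc w A' B'"
  show "Q_diagram (skew A B) = Q_diagram (skew A' B')"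
  proof
    fix a
    show "Q_diagram (skew A B) a = Q_diagram (skew A' B') a"
    proof (cases "a 0 = 0 \<and> (\<exists>n. \<forall>s>n. a s = 0)")
      case True
      then obtain n where "a 0 = 0" "\<And>s. s > n \<Longrightarrow> a s = 0" by blast
      then show ?thesis
        using Q_diagram_tableaux(1)[OF A, of a n] Q_diagram_tableaux(1)[OF A', of a n] Qc by (metis of_int_eq_iff)
    next
      case False
      then show ?thesis using Q_diagram_tableaux(2)[OF A, of a] Q_diagram_tableaux(2)[OF A', of a] by simp
    qed
  qed
qed

section \<open>Translation of diagrams\<close>

lemma mem_translate: "(x, y) \<in> translate a b D \<longleftrightarrow> (x - a, y - b) \<in> D"
  by (force simp: translate_def)

lemma translate_translate: "translate a b (translate c d D) = translate (a + c) (b + d) D"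
  by (auto simp: mem_translate algebra_simps set_eq_iff)

lemma translate_0 [simp]: "translate 0 0 D = D"
  by (auto simp: mem_translate set_eq_iff)

definition shift_tab :: "int \<Rightarrow> int \<Rightarrow> (box \<Rightarrow> letter) \<Rightarrow> box \<Rightarrow> letter" where
  "shift_tab a b T = (\<lambda>(x, y). T (x - a, y - b))"

lemma shift_tab_gsyt:
  assumes T: "T \<in> gsyt D"
  shows "shift_tab a b T \<in> gsyt (translate a b D)"
proof -
  have "shift_tab a b T \<in> translate a b D \<rightarrow>\<^sub>E alphabet"
  proof -
    have "T \<in> D \<rightarrow>\<^sub>E alphabet" using T unfolding gsyt_def by blast
    then show ?thesis by (auto simp: PiE_iff extensional_def shift_tab_def mem_translate)
  qed
  moreover have "shift_tab a b T (x, y) \<le> shift_tab a b T (x, y')"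
    if "(x, y) \<in> translate a b D" "(x, y') \<in> translate a b D" "y \<le> y'" for x y y'
    using gsyt_row[OF T, of "x - a" "y - b" "y' - b"] that by (simp add: shift_tab_def mem_translate)
  moreover have "shift_tab a b T (x, y) \<le> shift_tab a b T (x', y)"
    if "(x, y) \<in> translate a b D" "(x', y) \<in> translate a b D" "x \<le> x'" for x x' y
    using gsyt_col[OF T, of "x - a" "y - b" "x' - a"] that by (simp add: shift_tab_def mem_translate)
  moreover have "y = y'"
    if "(x, y) \<in> translate a b D" "(x, y') \<in> translate a b D"
      "is_marked (shift_tab a b T (x, y))" "shift_tab a b T (x, y) = shift_tab a b T (x, y')" for x y y'
    using gsyt_row_marked[OF T, of "x - a" "y - b" "y' - b"] that by (simp add: shift_tab_def mem_translate)
  moreover have "x = x'"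
    if "(x, y) \<in> translate a b D" "(x', y) \<in> translate a b D"
      "\<not> is_marked (shift_tab a b T (x, y))" "shift_tab a b T (x, y) = shift_tab a b T (x', y)" for x x' y
    using gsyt_col_unmarked[OF T, of "x - a" "y - b" "x' - a"] that by (simp add: shift_tab_def mem_translate)
  ultimately show ?thesis unfolding gsyt_def mem_Collect_eq by (intro conjI allI impI) blast+
qed

lemma shift_tab_content: "content (translate a b D) (shift_tab a b T) = content D T"
proof
  fix s
  have "bij_betw (\<lambda>(x, y). (x + a, y + b)) {c \<in> D. index (T c) = s}
      {c \<in> translate a b D. index (shift_tab a b T c) = s}"
    by (rule bij_betw_byWitness[of _ "\<lambda>(x, y). (x - a, y - b)"])
       (auto simp: mem_translate shift_tab_def)
  from bij_betw_same_card[OF this]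
  show "content (translate a b D) (shift_tab a b T) s = content D T s"
    unfolding content_def by (rule sym)
qed

lemma Q_diagram_translate: "Q_diagram (translate a b D) = Q_diagram D"
proof
  fix e
  have inv: "shift_tab (- a) (- b) (shift_tab a b T) = T" "shift_tab a b (shift_tab (- a) (- b) T) = T" for T
    by (auto simp: shift_tab_def)
  have "bij_betw (shift_tab a b) {T \<in> gsyt D. content D T = e}
      {T \<in> gsyt (translate a b D). content (translate a b D) T = e}"
  proof (rule bij_betw_byWitness[of _ "shift_tab (- a) (- b)"])
    show "shift_tab (- a) (- b) ` {T \<in> gsyt (translate a b D). content (translate a b D) T = e}
        \<subseteq> {T \<in> gsyt D. content D T = e}"
      using shift_tab_gsyt[of _ "translate a b D" "- a" "- b"]
        shift_tab_content[of "- a" "- b" "translate a b D"] by (auto simp: translate_translate)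
  qed (auto simp: inv shift_tab_gsyt shift_tab_content)
  from bij_betw_same_card[OF this]
  show "Q_diagram (translate a b D) e = Q_diagram D e"
    unfolding Q_diagram_def by (simp only:)
qed

section \<open>Restriction to an interval of diagonals\<close>

lemma cnt_slice:
  assumes "finite A" "1 \<le> e" "e \<le> Suc N"
  shows "cnt {x \<in> {1..N}. x + f \<in> A} e + cnt A (Suc (N + f)) = cnt A (e + f)"
proof -
  have "{x \<in> A. e + f \<le> x} = (\<lambda>x. x + f) ` {x \<in> {x \<in> {1..N}. x + f \<in> A}. e \<le> x} \<union> {x \<in> A. Suc (N + f) \<le> x}"
    (is "_ = ?I \<union> ?R")
  proof
    show "{x \<in> A. e + f \<le> x} \<subseteq> ?I \<union> ?R"
    proof
      fix x assume x: "x \<in> {x \<in> A. e + f \<le> x}"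
      show "x \<in> ?I \<union> ?R"
      proof (cases "x \<le> N + f")
        case True
        then have "x = (x - f) + f" "x - f \<in> {x \<in> {x \<in> {1..N}. x + f \<in> A}. e \<le> x}" using x assms by auto
        then show ?thesis by blast
      qed (use x in auto)
    qed
  qed (use assms in auto)
  moreover have "?I \<inter> ?R = {}" by auto
  ultimately have "card {x \<in> A. e + f \<le> x} = card ?I + card ?R"
    using assms by (simp add: card_Un_disjoint)
  moreover have "card ?I = card {x \<in> {x \<in> {1..N}. x + f \<in> A}. e \<le> x}"
    by (rule card_image) (auto simp: inj_on_def)
  ultimately show ?thesis by (simp add: cnt_def)
qed

text \<open>Off the diagonals \<open>{f<..g}\<close> the two counts agree, so only parts between
  \<open>f\<close> and \<open>g\<close> matter. The part \<open>g\<close> belongs to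
  \<open>A\<close> alone and becomes \<open>Suc n\<close>. The translation skips \<open>f\<close>
  diagonals and the \<open>h\<close> rows whose parts exceed \<open>g\<close> on both sides.\<close>

lemma slice:
  assumes A: "parts A" and B: "parts B" and BA: "inside B A" and d: "diags A B = {f<..g}" and fg: "f < g"
    and n: "Suc n = g - f" and A1: "A1 = {x \<in> {1..n}. x + f \<in> A}" and B1: "B1 = {x \<in> {1..n}. x + f \<in> B}"
  shows "g \<in> A" "g \<notin> B" "A1 \<subseteq> {1..n}" "B1 \<subseteq> {1..n}" "inside B1 A1"
    "\<exists>a b. skew A B = translate a b (skew (insert (Suc n) A1) B1)"
proof -
  show s: "A1 \<subseteq> {1..n}" "B1 \<subseteq> {1..n}" by (auto simp: A1 B1)
  define h where "h = cnt A (Suc g)"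
  have eq: "cnt A e = cnt B e" if "1 \<le> e" "e \<notin> {f<..g}" for e
    using that BA unfolding d[symmetric] by (auto simp: diags_def inside_def intro: order_antisym)
  have less: "cnt B e < cnt A e" if "e \<in> {f<..g}" for e
    using that unfolding d[symmetric] by (simp add: diags_def)
  have hB: "cnt B (Suc g) = h" using eq[of "Suc g"] by (simp add: h_def)
  have gAB: "g \<in> A \<and> g \<notin> B"
    using less[of g] cnt_Suc[of A g] cnt_Suc[of B g] hB A B fg
    by (cases "g \<in> A"; cases "g \<in> B") (auto simp: h_def)
  then show "g \<in> A" "g \<notin> B" by auto
  have gn: "g = Suc (n + f)" using n fg by linarith
  have iA: "insert (Suc n) A1 = {x \<in> {1..Suc n}. x + f \<in> A}"
    using gAB gn by (auto simp: A1 le_Suc_eq)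
  have iB: "B1 = {x \<in> {1..Suc n}. x + f \<in> B}"
    using gAB gn by (auto simp: B1 le_Suc_eq)
  have cA: "cnt (insert (Suc n) A1) e + h = cnt A (e + f)" and cB: "cnt B1 e + h = cnt B (e + f)"
    if "1 \<le> e" "e \<le> Suc (Suc n)" for e
    using cnt_slice[of A e "Suc n" f, folded iA] cnt_slice[of B e "Suc n" f, folded iB] that A B hB
    by (simp_all add: h_def gn)
  show "inside B1 A1"
    unfolding inside_def
  proof (intro allI impI)
    fix e :: nat assume e: "1 \<le> e"
    show "cnt B1 e \<le> cnt A1 e"
    proof (cases "e \<le> Suc n")
      case True
      then show ?thesis using cA[OF e] cB[OF e] less[of "e + f"] e s by (simp add: gn cnt_insert_Suc)
    next
      case False
      then show ?thesis using cnt_high[OF s(2), of e] by simp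
    qed
  qed
  have "(x, y) \<in> skew A B \<longleftrightarrow> (x, y) \<in> translate (int h) (int (h + f)) (skew (insert (Suc n) A1) B1)" for x y
  proof
    assume *: "(x, y) \<in> skew A B"
    then have "1 \<le> x" "x \<le> y" by (auto simp: skew_def boxes_mem)
    then obtain e i where ei: "(x, y) = box_at e i" "1 \<le> e" "1 \<le> i" using box_at_cases by blast
    then have i: "cnt B e < i" "i \<le> cnt A e" using * by (auto simp: skew_def box_at_mem)
    then have "e \<in> {f<..g}" using eq[of e] ei by force
    then obtain e' where e': "e = e' + f" "1 \<le> e'" "e' \<le> Suc n"
      using gn by (intro that[of "e - f"]) auto
    have "h \<le> i" using cB[of e'] e' i by simp
    then obtain i' where i': "i = i' + h" by (metis add.commute le_Suc_ex)
    have "box_at e' i' \<in> skew (insert (Suc n) A1) B1"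
      using cA[of e'] cB[of e'] e' i i' by (simp add: skew_def box_at_mem)
    moreover have "box_at e' i' = (x - int h, y - int (h + f))" using ei e' i' by (auto simp: box_at_def)
    ultimately show "(x, y) \<in> translate (int h) (int (h + f)) (skew (insert (Suc n) A1) B1)"
      by (simp add: mem_translate)
  next
    assume "(x, y) \<in> translate (int h) (int (h + f)) (skew (insert (Suc n) A1) B1)"
    then have *: "(x - int h, y - int (h + f)) \<in> skew (insert (Suc n) A1) B1" by (simp add: mem_translate)
    then have "1 \<le> x - int h" "x - int h \<le> y - int (h + f)" by (auto simp: skew_def boxes_mem)
    then obtain e i where ei: "(x - int h, y - int (h + f)) = box_at e i" "1 \<le> e" "1 \<le> i" using box_at_cases by blast
    then have i: "cnt B1 e < i" "i \<le> cnt (insert (Suc n) A1) e" using * by (auto simp: skew_def box_at_mem)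
    have "e \<le> Suc n"
    proof (rule ccontr)
      assume "\<not> e \<le> Suc n"
      then have "cnt (insert (Suc n) A1) e = 0" using s by (intro cnt_high[of _ "Suc n"]) auto
      then show False using i by simp
    qed
    then have "box_at (e + f) (i + h) \<in> skew A B"
      using cA[of e] cB[of e] i ei by (simp add: skew_def box_at_mem)
    moreover have "box_at (e + f) (i + h) = (x, y)" using ei by (auto simp: box_at_def)
    ultimately show "(x, y) \<in> skew A B" by simp
  qed
  then have "skew A B = translate (int h) (int (h + f)) (skew (insert (Suc n) A1) B1)" by auto
  then show "\<exists>a b. skew A B = translate a b (skew (insert (Suc n) A1) B1)" by blast
qed

lemma slice_Qc:
  assumes "parts A" "parts B" "inside B A" "diags A B = {f<..g}" "f < g"
    "Suc n = g - f" "A1 = {x \<in> {1..n}. x + f \<in> A}" "B1 = {x \<in> {1..n}. x + f \<in> B}"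
  shows "Qc w A B = Qc w (insert (Suc n) A1) B1"
proof -
  note s = slice[OF assms]
  have "Q_diagram (skew A B) = Q_diagram (skew (insert (Suc n) A1) B1)"
    using s(6) Q_diagram_translate by metis
  moreover have "parts (insert (Suc n) A1)" "parts B1" "inside B1 (insert (Suc n) A1)"
    using s parts_insert_Suc parts_subset inside_insert_Suc(1) by blast+
  ultimately show ?thesis using Q_diagram_eq_iff assms by blast
qed

section \<open>Strange diagrams\<close>

text \<open>The coefficients of the product of \<open>q\<^sub>1\<close> with the series \<open>f\<close>.\<close>

fun times_q1 :: "(nat list \<Rightarrow> real) \<Rightarrow> nat list \<Rightarrow> real" where
  "times_q1 f [] = 0"
| "times_q1 f (k # w) = (if k = 0 then 0 else 2 * f ((k - 1) # w)) + times_q1 (\<lambda>v. f (k # v)) w"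

lemma times_q1_sum: "times_q1 (\<lambda>v. \<Sum>S\<in>F. c S * f S v) w = (\<Sum>S\<in>F. c S * times_q1 (f S) w)"
proof (induction w arbitrary: f)
  case (Cons k w)
  show ?case
    using Cons.IH[of "\<lambda>S v. f S (k # v)"]
    by (simp add: sum_distrib_left sum.distrib distrib_left mult.left_commute)
qed simp

lemma times_q1_zero: "(\<And>v. f v = 0) \<Longrightarrow> times_q1 f w = 0"
  by (induction w arbitrary: f) auto

text \<open>Peeling off the last box of the first row; equality holds if that box is disconnected from the
  rest.\<close>

lemma Qc_first_box:
  assumes "A \<subseteq> {1..Suc m}" "B \<subseteq> {1..m}"
  shows "Qc w (insert (Suc (Suc m)) A) (insert (Suc m) B) \<le> times_q1 (\<lambda>v. Qc v A B) w \<and>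
    (A \<subseteq> {1..m} \<longrightarrow> Qc w (insert (Suc (Suc m)) A) (insert (Suc m) B) = times_q1 (\<lambda>v. Qc v A B) w)"
  using assms(1)
proof (induction w arbitrary: A)
  case Nil
  have "Suc (Suc m) \<notin> insert (Suc m) B" using assms by auto
  then have "insert (Suc (Suc m)) A \<noteq> insert (Suc m) B" by blast
  then show ?case by simp
next
  case (Cons k w)
  let ?t = "Suc (Suc m)" and ?B = "insert (Suc m) B"
  let ?T = "\<lambda>S. strip (delta k) (insert ?t A) S * Qc w S ?B"
  have pA: "insert ?t A \<subseteq> {1..?t}" using Cons.prems by auto
  have z: "Qc w S ?B = 0" if "S \<subseteq> {1..m}" for S
    by (rule strips_eq_0[of _ "Suc m"]) (use that assms parts_subset in \<open>auto simp: cnt_insert_Suc cnt_high\<close>)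
  \<comment> \<open>The first strip either leaves the last box of the first row, so that the
    induction hypothesis applies, or takes it (\<open>low\<close>), which uses up one unit of the
    exponent \<open>k\<close>.\<close>
  have up: "?T (insert ?t S) = strip (delta k) A S * Qc w (insert ?t S) ?B" if "S \<in> Pow {1..Suc m}" for S
    using that Cons.prems by (subst strip_insert_Suc) auto
  have low: "?T (insert (Suc m) S) \<le> (if k = 0 then 0 else 2 * (strip (delta (k - 1)) A S * Qc w S B)) \<and>
     (A \<subseteq> {1..m} \<longrightarrow> ?T (insert (Suc m) S) = (if k = 0 then 0 else 2 * (strip (delta (k - 1)) A S * Qc w S B)))"
    if S: "S \<in> Pow {1..m}" for S
  proof -
    have S': "S \<subseteq> {1..m}" "S \<subseteq> {1..Suc m}" using S by auto
    have Qc: "Qc w (insert (Suc m) S) ?B = Qc w S B" by (rule strips_insert_Suc[OF S'(1) assms(2)])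
    have il: "interlaced (insert ?t A) (insert (Suc m) S) \<longleftrightarrow> interlaced A S"
    proof -
      have "cnt (insert (Suc m) S) e \<le> cnt (insert ?t A) e \<and> cnt (insert ?t A) e \<le> Suc (cnt (insert (Suc m) S) e)
          \<longleftrightarrow> cnt S e \<le> cnt A e \<and> cnt A e \<le> Suc (cnt S e)" if "1 \<le> e" for e
        using cnt_high[OF S'(1), of e] cnt_high[OF Cons.prems, of e] Cons.prems S'
        by (cases "e \<le> Suc m"; cases "e \<le> ?t") (auto simp: cnt_insert_Suc)
      then show ?thesis by (auto simp: interlaced_def)
    qed
    show ?thesis
    proof (cases "interlaced A S")
      case False
      then show ?thesis using il by (simp add: strip_def weight_def)
    next
      case True
      have "\<Sum>S \<le> \<Sum>A" using inside_sum[OF _ _ interlaced_inside[OF True]] Cons.prems S' parts_subset by blast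
      then have sz: "\<Sum>(insert ?t A) - \<Sum>(insert (Suc m) S) = Suc (\<Sum>A - \<Sum>S)"
        unfolding sum_insert_Suc[OF Cons.prems] sum_insert_Suc[OF S'(1)] by simp
      have fin: "finite A" using Cons.prems finite_subset by blast
      have d: "insert ?t A - insert (Suc m) S = insert ?t (A - S - {Suc m})" using S' by auto
      have t: "?t \<notin> A - S - {Suc m}" using Cons.prems by auto
      have c: "card (insert ?t A - insert (Suc m) S) = Suc (card (A - S - {Suc m}))"
        unfolding d using t fin by (subst card_insert_disjoint) auto
      \<comment> \<open>If \<open>Suc m\<close> is in \<open>A - S\<close>, the strip also takes the
        box directly below the one in the first row. Both then share a component, and one factor 2
        is lost.\<close>
      have le: "card (A - S - {Suc m}) \<le> card (A - S)" using fin by (intro card_mono) auto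
      have eq: "card (A - S - {Suc m}) = card (A - S)" if "A \<subseteq> {1..m}"
        using that by (intro arg_cong[where f=card]) auto
      have weight: "weight (insert ?t A) (insert (Suc m) S) = 2 * 2 ^ card (A - S - {Suc m})"
        using True il c by (simp add: weight_def)
      have tw2: "weight A S = 2 ^ card (A - S)" using True by (simp add: weight_def)
      have "weight (insert ?t A) (insert (Suc m) S) \<le> 2 * weight A S" unfolding weight tw2 using le by simp
      moreover have "weight (insert ?t A) (insert (Suc m) S) = 2 * weight A S" if "A \<subseteq> {1..m}"
        unfolding weight tw2 eq[OF that] ..
      moreover from calculation have "weight (insert ?t A) (insert (Suc m) S) * Qc w S B \<le> 2 * weight A S * Qc w S B"
        by (intro mult_right_mono) auto
      ultimately show ?thesis
        unfolding Qc strip_delta sz by (auto simp: algebra_simps)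
    qed
  qed
  have L: "Qc (k # w) (insert ?t A) ?B
      = (\<Sum>S\<in>Pow {1..m}. ?T (insert (Suc m) S)) + (\<Sum>S\<in>Pow {1..Suc m}. strip (delta k) A S * Qc w (insert ?t S) ?B)"
  proof -
    have "Qc (k # w) (insert ?t A) ?B = (\<Sum>S\<in>Pow {1..?t}. ?T S)"
      unfolding list.map by (rule strips_Cons[OF pA])
    also have "\<dots> = (\<Sum>S\<in>Pow {1..Suc m}. ?T S) + (\<Sum>S\<in>Pow {1..Suc m}. ?T (insert ?t S))"
      by (simp only: sum_Pow_Suc[of _ "Suc m"] sum.distrib)
    also have "(\<Sum>S\<in>Pow {1..Suc m}. ?T S) = (\<Sum>S\<in>Pow {1..m}. ?T (insert (Suc m) S))"
      unfolding sum_Pow_Suc[of _ m] using z by (intro sum.cong) auto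
    also have "(\<Sum>S\<in>Pow {1..Suc m}. ?T (insert ?t S)) = (\<Sum>S\<in>Pow {1..Suc m}. strip (delta k) A S * Qc w (insert ?t S) ?B)"
      using up by (intro sum.cong) auto
    finally show ?thesis .
  qed
  \<comment> \<open>Sets \<open>S\<close> containing \<open>Suc m\<close> would keep the box below
    while the first row loses its own. They are missing on the left, which gives the inequality; if
    \<open>A\<close> lies in \<open>{1..m}\<close> they contribute nothing anyway.\<close>
  have drop: "(\<Sum>S\<in>Pow {1..m}. strip \<phi> A S * Qc w S B) \<le> K' \<and> (A \<subseteq> {1..m} \<longrightarrow> (\<Sum>S\<in>Pow {1..m}. strip \<phi> A S * Qc w S B) = K')"
    if "K' = strips (\<phi> # map delta w) A B" "\<And>n. 0 \<le> \<phi> n" for \<phi> K'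
  proof -
    have "strips (\<phi> # map delta w) A B = (\<Sum>S\<in>Pow {1..Suc m}. strip \<phi> A S * Qc w S B)" by (rule strips_Cons[OF Cons.prems])
    moreover have "(\<Sum>S\<in>Pow {1..m}. strip \<phi> A S * Qc w S B) \<le> (\<Sum>S\<in>Pow {1..Suc m}. strip \<phi> A S * Qc w S B)"
      using that by (intro sum_mono2) (auto simp: strip_def weight_nonneg intro!: mult_nonneg_nonneg)
    ultimately show ?thesis using that(1) strips_Cons[of A m \<phi> "map delta w" B] by auto
  qed
  have R: "times_q1 (\<lambda>v. Qc v A B) (k # w) = (if k = 0 then 0 else 2 * Qc ((k - 1) # w) A B)
      + (\<Sum>S\<in>Pow {1..Suc m}. strip (delta k) A S * times_q1 (\<lambda>v. Qc v S B) w)"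
  proof -
    have "times_q1 (\<lambda>v. Qc (k # v) A B) w = times_q1 (\<lambda>v. \<Sum>S\<in>Pow {1..Suc m}. strip (delta k) A S * Qc v S B) w"
      by (intro arg_cong2[where f=times_q1] ext refl) (simp only: list.map strips_Cons[OF Cons.prems])
    then show ?thesis by (simp only: times_q1.simps times_q1_sum)
  qed
  have 1: "(\<Sum>S\<in>Pow {1..m}. ?T (insert (Suc m) S)) \<le> (if k = 0 then 0 else 2 * Qc ((k - 1) # w) A B)"
  proof -
    have "(\<Sum>S\<in>Pow {1..m}. ?T (insert (Suc m) S))
        \<le> (\<Sum>S\<in>Pow {1..m}. if k = 0 then 0 else 2 * (strip (delta (k - 1)) A S * Qc w S B))"
      using low by (intro sum_mono) blast
    also have "\<dots> \<le> (if k = 0 then 0 else 2 * Qc ((k - 1) # w) A B)"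
      using drop[of "Qc ((k - 1) # w) A B" "delta (k - 1)"]
      by (auto simp: delta_def simp flip: sum_distrib_left)
    finally show ?thesis .
  qed
  have eq1: "(\<Sum>S\<in>Pow {1..m}. ?T (insert (Suc m) S)) = (if k = 0 then 0 else 2 * Qc ((k - 1) # w) A B)"
    if A: "A \<subseteq> {1..m}"
  proof -
    have "(\<Sum>S\<in>Pow {1..m}. ?T (insert (Suc m) S))
        = (\<Sum>S\<in>Pow {1..m}. if k = 0 then 0 else 2 * (strip (delta (k - 1)) A S * Qc w S B))"
      using low A by (intro sum.cong) blast+
    also have "\<dots> = (if k = 0 then 0 else 2 * Qc ((k - 1) # w) A B)"
      using drop[of "Qc ((k - 1) # w) A B" "delta (k - 1)"] A
      by (auto simp: delta_def simp flip: sum_distrib_left)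
    finally show ?thesis .
  qed
  have Mnn: "0 \<le> strip (delta k) A S" for S by (simp add: strip_delta weight_nonneg)
  have 2: "(\<Sum>S\<in>Pow {1..Suc m}. strip (delta k) A S * Qc w (insert ?t S) ?B)
      \<le> (\<Sum>S\<in>Pow {1..Suc m}. strip (delta k) A S * times_q1 (\<lambda>v. Qc v S B) w)"
    using Cons.IH Mnn by (intro sum_mono mult_left_mono) auto
  have eq2: "(\<Sum>S\<in>Pow {1..Suc m}. strip (delta k) A S * Qc w (insert ?t S) ?B)
      = (\<Sum>S\<in>Pow {1..Suc m}. strip (delta k) A S * times_q1 (\<lambda>v. Qc v S B) w)" if A: "A \<subseteq> {1..m}"
  proof (rule sum.cong[OF refl])
    fix S assume S: "S \<in> Pow {1..Suc m}"
    show "strip (delta k) A S * Qc w (insert ?t S) ?B = strip (delta k) A S * times_q1 (\<lambda>v. Qc v S B) w"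
    proof (cases "S \<subseteq> {1..m}")
      case True
      then show ?thesis using Cons.IH[of S] S by auto
    next
      case False
      then have "\<not> interlaced A S" using cnt_le_subset[OF A, of S] S parts_subset by (auto simp: interlaced_def)
      then show ?thesis by (simp add: strip_def weight_def)
    qed
  qed
  show ?case unfolding L R using 1 eq1 2 eq2 by linarith
qed

text \<open>Removal of the last box of the lowest row, which lies on diagonal
  \<open>Min B\<close>.\<close>

definition dec_min :: "nat set \<Rightarrow> nat set" where
  "dec_min B = (B - {Min B}) \<union> ({Min B - 1} - {0})"

lemma dec_min_props:
  assumes "B \<subseteq> {1..n}" "B \<noteq> {}"
  shows "dec_min B \<subseteq> {1..n}" "\<And>e. 1 \<le> e \<Longrightarrow> cnt (dec_min B) e + of_bool (e = Min B) = cnt B e"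
    "Suc (\<Sum>(dec_min B)) = \<Sum>B" "card (insert (Suc n) (dec_min B) - B) = (if Min B = 1 then 1 else 2)"
proof -
  define m where "m = Min B"
  define B' where "B' = B - {m}"
  have fin: "finite B" "finite B'" using assms finite_subset by (auto simp: B'_def)
  have m: "m \<in> B" "1 \<le> m" "m \<le> n" using Min_in[OF fin(1) assms(2)] assms by (auto simp: m_def)
  have B: "B = insert m B'" "m \<notin> B'" using m by (auto simp: B'_def)
  have low: "x \<notin> B" if "x < m" for x
    using that Min_le[OF fin(1), of x] unfolding m_def by linarith
  have d: "dec_min B = (if m = 1 then B' else insert (m - 1) B')"
    using m by (auto simp: dec_min_def B'_def m_def)
  show "dec_min B \<subseteq> {1..n}" using assms m by (auto simp: d B'_def)
  have l: "m - 1 \<notin> B'" using low[of "m - 1"] m by (auto simp: B'_def)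
  have c: "cnt B e = cnt B' e + of_bool (e \<le> m)" for e
    using cnt_insert[OF fin(2) B(2)] B(1) by simp
  have c': "cnt (insert (m - 1) B') e = cnt B' e + of_bool (e \<le> m - 1)" for e
    by (rule cnt_insert[OF fin(2) l])
  show "cnt (dec_min B) e + of_bool (e = Min B) = cnt B e" if "1 \<le> e" for e
    using that m c[of e] c'[of e] unfolding d m_def[symmetric] by (auto split: if_splits)
  have "\<Sum>B = m + \<Sum>B'" using B fin by (metis sum.insert)
  moreover have "\<Sum>(insert (m - 1) B') = m - 1 + \<Sum>B'" using l fin by simp
  ultimately show "Suc (\<Sum>(dec_min B)) = \<Sum>B" using m by (auto simp: d)
  have "insert (Suc n) (dec_min B) - B = (if m = 1 then {Suc n} else {Suc n, m - 1})"
    using assms l m by (auto simp: d B'_def)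
  then show "card (insert (Suc n) (dec_min B) - B) = (if Min B = 1 then 1 else 2)"
    using m by (auto simp: m_def[symmetric])
qed

text \<open>This strip has a box on every diagonal up to \<open>Suc n\<close> except
  \<open>Min B\<close>. It is connected if the missing diagonal is the lowest one, and has two
  components otherwise.\<close>

lemma strip_dec_min:
  assumes "B \<subseteq> {1..n}" "B \<noteq> {}"
  shows "strip (delta n) (insert (Suc n) (dec_min B)) B = (if Min B = 1 then 2 else 4)"
proof -
  note d = dec_min_props[OF assms]
  have "interlaced (insert (Suc n) (dec_min B)) B"
    unfolding interlaced_def
  proof (intro allI impI)
    fix e :: nat assume e: "1 \<le> e"
    have "Min B \<le> n" using Min_in[of B] assms finite_subset by fastforce
    then show "cnt B e \<le> cnt (insert (Suc n) (dec_min B)) e \<and> cnt (insert (Suc n) (dec_min B)) e \<le> Suc (cnt B e)"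
      using d(2)[OF e] by (cases "e = Min B") (auto simp: cnt_insert_Suc[OF d(1)])
  qed
  then show ?thesis using d(3,4) by (simp add: strip_delta weight_def sum_insert_Suc[OF d(1)])
qed

lemma strips_delta_empty:
  assumes S: "parts S" and k: "1 \<le> k"
  shows "strips [delta k] S {} = (if S = {k} then 2 else 0)"
proof (cases "S = {k}")
  case True
  have "interlaced {k} {}" using cnt_insert[of "{}" k] by (auto simp: interlaced_def)
  then show ?thesis using True strips_single[of "{k}" "{}"] k by (simp add: parts_def strip_delta weight_def)
next
  case False
  have "\<not> (interlaced S {} \<and> \<Sum>S = k)"
  proof
    assume *: "interlaced S {} \<and> \<Sum>S = k"
    then have "cnt S 1 \<le> 1" by (auto simp: interlaced_def)
    then have "card S \<le> 1" using cnt_0[of S] cnt_0'[of S] S by (auto simp: parts_def)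
    moreover have "card S \<noteq> 0" using * S k by auto
    ultimately have "card S = 1" by linarith
    then obtain x where "S = {x}" by (rule card_1_singletonE)
    then show False using * False by simp
  qed
  then have "strips [delta k] S {} = 0" using strips_single[OF S, of "{}"] by (auto simp: parts_def strip_delta weight_def)
  then show ?thesis using False by simp
qed

text \<open>Comparison of the coefficients of \<open>x\<^sub>1 ^ m\<close> in a skew Q-function and in the Q-function it equals, where
  \<open>m + 1\<close> is the largest possible exponent.\<close>

lemma second_coeff:
  assumes A: "A \<subseteq> {1..Suc m}" and B: "B \<subseteq> {1..m}" and BA: "inside B A" and Bne: "B \<noteq> {}"
    and C: "C \<subseteq> {1..Suc m}" and eq: "\<And>w. Qc w (insert (Suc (Suc m)) A) B = Qc w (insert (Suc (Suc m)) C) {}"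
  shows "2 * Qc w (insert (Suc (Suc m)) A) (insert (Suc m) B)
      + (if Min B = 1 then 2 else 4) * Qc w A (dec_min B) \<le> 2 * times_q1 (\<lambda>v. Qc v A B) w"
proof -
  let ?t = "Suc (Suc m)" and ?n = "Suc m"
  have B': "B \<subseteq> {1..?n}" using B by auto
  note d = dec_min_props[OF B' Bne]
  have "?t \<notin> insert ?n B" using B by auto
  then have ne: "insert ?n B \<noteq> insert ?t (dec_min B)" by blast
  have M1: "strip (delta ?n) (insert ?n B) B = 2"
  proof -
    have "interlaced (insert ?n B) B" using cnt_high[OF B] by (auto simp: interlaced_def cnt_insert_Suc[OF B])
    moreover have "insert ?n B - B = {?n}" using B by auto
    ultimately show ?thesis by (simp add: strip_delta weight_def sum_insert_Suc[OF B])
  qed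
  \<comment> \<open>Two of the strips of size \<open>m + 1\<close> along \<open>B\<close>: the full
    layer without its box on the highest diagonal, and the full layer without its box on diagonal
    \<open>Min B\<close>. All other strips contribute nonnegative amounts.\<close>
  have "Qc w (insert ?t A) (insert ?n B) * strip (delta ?n) (insert ?n B) B
      + Qc w (insert ?t A) (insert ?t (dec_min B)) * strip (delta ?n) (insert ?t (dec_min B)) B
      \<le> Qc (?n # w) (insert ?t A) B"
    using Qc_inner_ge[of "insert ?t A" "{insert ?n B, insert ?t (dec_min B)}" B w ?n] ne
      parts_insert_Suc A B d(1) parts_subset by auto
  also have "Qc w (insert ?t A) (insert ?t (dec_min B)) = Qc w A (dec_min B)"
    by (rule strips_insert_Suc[OF A d(1)])
  also have "Qc (?n # w) (insert ?t A) B = Qc (?n # w) (insert ?t C) {}" by (rule eq)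
  also have "\<dots> = 2 * Qc w (insert ?t C) {?n}"
  proof -
    have pC: "insert ?t C \<subseteq> {1..?t}" using C by auto
    have "Qc (?n # w) (insert ?t C) {} = (\<Sum>S\<in>Pow {1..?t}. if S = {?n} then 2 * Qc w (insert ?t C) {?n} else 0)"
      unfolding Qc_inner[OF pC] using parts_subset by (intro sum.cong) (auto simp: strips_delta_empty)
    then show ?thesis by simp
  qed
  also have "\<dots> \<le> 2 * times_q1 (\<lambda>v. Qc v C {}) w"
    using Qc_first_box[OF C, of "{}" w] by simp
  \<comment> \<open>The coefficients at the top exponent \<open>m + 2\<close> identify the two
    series.\<close>
  also have "(\<lambda>v. Qc v C {}) = (\<lambda>v. Qc v A B)"
  proof
    fix v
    show "Qc v C {} = Qc v A B"
      using eq[of "?t # v"] Qc_insert_top(2)[OF A B' BA, of v] Qc_insert_top(2)[OF C, of "{}" v] by simp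
  qed
  finally show ?thesis unfolding M1 strip_dec_min[OF B' Bne] by (simp add: algebra_simps)
qed

text \<open>All diagonals up to \<open>Suc n\<close> are nonempty, so \<open>Suc n\<close> is also
  the largest part of the straight partition. Taking the top coefficient removes it on both
  sides.\<close>

lemma strange_pair_insert_Suc:
  assumes A: "A \<subseteq> {1..n}" and B: "B \<subseteq> {1..n}" and BA: "inside B A" and s: "strange_pair (insert (Suc n) A) B"
  obtains C where "C \<subseteq> {1..n}" "\<forall>w. Qc w (insert (Suc n) A) B = Qc w (insert (Suc n) C) {}"
    "\<forall>w. Qc w A B = Qc w C {}"
proof -
  obtain C where C: "parts C" "\<And>w. Qc w (insert (Suc n) A) B = Qc w C {}" using s by (auto simp: strange_pair_def)
  note c = inside_insert_Suc[OF A B BA]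
  have ne: "insert (Suc n) A \<noteq> B" using B by auto
  obtain k C' where k: "card (diags (insert (Suc n) A) B) = Suc k" "C = insert (Suc k) C'" "C' \<subseteq> {1..k}"
    "\<And>w. Qc w (insert (Suc n) A) (insert (Suc n) B) = Qc w C' {}"
    using strange_pair_top[OF parts_insert_Suc[OF A] parts_subset[OF B] c(1,2) ne C] by blast
  then have "k = n" using c(3) by simp
  then show thesis using that[of C'] k C strips_insert_Suc[OF A B] by simp
qed

text \<open>Without the part \<open>n\<close> the box at the end of the first row is disconnected,
  and the first term of \<open>second_coeff\<close> already exhausts the bound. The second term
  would have to vanish, but it is positive for some word.\<close>

lemma no_second_part:
  assumes A: "A \<subseteq> {1..n}" and B: "B \<subseteq> {1..n}" and BA: "inside B A" and s: "strange_pair (insert (Suc n) A) B"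
    and n: "n \<notin> A"
  shows "B = {}"
proof (rule ccontr)
  assume Bne: "B \<noteq> {}"
  then obtain m where nm: "n = Suc m" using B by (cases n) auto
  have A': "A \<subseteq> {1..m}" using A n by (auto simp: nm le_Suc_eq)
  then have B': "B \<subseteq> {1..m}" using BA cnt_le_subset parts_subset[OF B] by (auto simp: inside_def)
  obtain C where C: "C \<subseteq> {1..n}" "\<forall>w. Qc w (insert (Suc n) A) B = Qc w (insert (Suc n) C) {}"
    "\<forall>w. Qc w A B = Qc w C {}"
    by (rule strange_pair_insert_Suc[OF A B BA s])
  note d = dec_min_props[OF B' Bne]
  have "(if Min B = 1 then 2 else 4) * Qc w A (dec_min B) \<le> 0" for w
    using second_coeff[OF A[unfolded nm] B' BA Bne C(1)[unfolded nm] C(2)[unfolded nm, rule_format], of w]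
      Qc_first_box[OF A[unfolded nm] B', of w] A' by simp
  moreover have "inside (dec_min B) A"
    unfolding inside_def
  proof (intro allI impI)
    fix e :: nat assume e: "1 \<le> e"
    have "cnt B e \<le> cnt A e" using BA e by (simp add: inside_def)
    then show "cnt (dec_min B) e \<le> cnt A e" using d(2)[OF e] by linarith
  qed
  then obtain w where "0 < Qc w A (dec_min B)" using Qc_pos[OF parts_subset[OF A] parts_subset[OF d(1)]] by blast
  ultimately show False using not_le by (metis mult_pos_pos zero_less_numeral)
qed

text \<open>A part \<open>n\<close> of \<open>B\<close> is a missing part \<open>n\<close> of its
  complement, which is the outer set after reflection; so \<open>no_second_part\<close> empties the
  complement of \<open>A\<close>.\<close>

lemma next_in_inner:
  assumes A: "A \<subseteq> {1..n}" and B: "B \<subseteq> {1..n}" and BA: "inside B A" and s: "strange_pair (insert (Suc n) A) B"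
    and n: "n \<in> B"
  shows "A = {1..n}"
proof -
  have sub: "insert (Suc n) A \<subseteq> {1..Suc n}" "B \<subseteq> {1..Suc n}" using A B by auto
  have c: "{1..Suc n} - B = insert (Suc n) ({1..n} - B)" "{1..Suc n} - insert (Suc n) A = {1..n} - A"
    using A B by auto
  have Qc: "Qc w (insert (Suc n) ({1..n} - B)) ({1..n} - A) = Qc w (insert (Suc n) A) B" for w
    using strips_compl[OF sub, of "map delta w"] unfolding c .
  have "inside ({1..n} - A) ({1..n} - B)"
    unfolding inside_def
  proof (intro allI impI)
    fix e :: nat assume e: "1 \<le> e"
    show "cnt ({1..n} - A) e \<le> cnt ({1..n} - B) e"
      using cnt_compl[OF A e] cnt_compl[OF B e] BA e by (auto simp: inside_def)
  qed
  moreover have "strange_pair (insert (Suc n) ({1..n} - B)) ({1..n} - A)" using s Qc by (simp add: strange_pair_def)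
  ultimately have "{1..n} - A = {}" using n by (intro no_second_part[of "{1..n} - B" n]) auto
  then show ?thesis using A by auto
qed

text \<open>Evaluate \<open>second_coeff\<close> at the word \<open>Suc k # w\<close>, where
  \<open>k\<close> counts the nonempty diagonals of \<open>A\<close>, \<open>B\<close>. In units of
  \<open>X\<close>, the right side is 8 and the left side at least 4 + 8. For \<open>f = 1\<close>
  the 8 on the left would shrink to 4, because the additional box on diagonal 1 then touches the
  layer.\<close>

lemma gap_one:
  assumes A: "A \<subseteq> {1..n}" and B: "B \<subseteq> {1..m}" and nm: "n = Suc m" and BA: "inside B A"
    and C: "C \<subseteq> {1..n}" and eq: "\<And>w. Qc w (insert (Suc n) A) B = Qc w (insert (Suc n) C) {}"
    and U: "layer A B U" and d: "diags A B = {f<..n}" and Un: "U - B = {n}" and f: "1 \<le> f" "f < n"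
  shows "f = 1"
proof (rule ccontr)
  assume "f \<noteq> 1"
  then have f2: "2 \<le> f" using f by simp
  have B': "B \<subseteq> {1..n}" using B nm by auto
  have p: "parts A" "parts B" using A B parts_subset by auto
  note P = layer_props[OF p BA U]
  have cU: "cnt U e = cnt B e + of_bool (f < e \<and> e \<le> n)" if "1 \<le> e" for e
    using layer_cnt[OF U BA that] d by simp
  have Usub: "U \<subseteq> {1..n}" using cnt_le_subset[OF A P(1)] P(3) by (auto simp: inside_def)
  define k where "k = card (diags A B)"
  obtain w where w: "0 < Qc w A U" using Qc_pos[OF p(1) P(1,3)] by blast
  define X where "X = Qc w A U"
  have fB: "f \<in> B"
  proof -
    have "cnt A f = cnt B f" "cnt B (Suc f) < cnt A (Suc f)"
    proof -
      have "f \<notin> diags A B" "Suc f \<in> diags A B" using d f by auto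
      then show "cnt A f = cnt B f" "cnt B (Suc f) < cnt A (Suc f)"
        using BA f by (auto simp: diags_def inside_def intro: order_antisym)
    qed
    then show ?thesis using cnt_Suc[of A f] cnt_Suc[of B f] p by (cases "f \<in> A"; cases "f \<in> B") auto
  qed
  then have Bne: "B \<noteq> {}" by auto
  define b where "b = Min B"
  have b: "b \<in> B" "b \<le> f" "1 \<le> b" using fB Min_in[of B] Min_le[of B f] p Bne B by (auto simp: b_def)
  note dc = dec_min_props[OF B Bne]
  \<comment> \<open>The exponent of the first variable in the series of \<open>A\<close>,
    \<open>B\<close> is at most \<open>k\<close>, so the missing unit comes from \<open>q_1\<close>:
    a factor 2 for it and another 2 for the connected layer.\<close>
  have R: "times_q1 (\<lambda>v. Qc v A B) (Suc k # w) = 4 * X"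
  proof -
    have "Qc (Suc k # v) A B = 0" for v
      using Qc_top_le[OF p BA U, of "Suc k" v] by (fastforce simp: k_def)
    then have "times_q1 (\<lambda>v. Qc (Suc k # v) A B) w = 0" by (rule times_q1_zero)
    moreover have "Qc (k # w) A B = 2 * X"
      using Qc_top_eq[OF p BA U, of w] Un by (simp add: k_def X_def)
    ultimately show ?thesis by simp
  qed
  \<comment> \<open>The layer together with the box at the end of the first row, on diagonal
    \<open>Suc n\<close>, is still connected.\<close>
  have L1: "2 * X \<le> Qc (Suc k # w) (insert (Suc n) A) (insert n B)"
  proof -
    have il: "interlaced (insert (Suc n) U) (insert n B)"
      unfolding interlaced_def
    proof (intro allI impI)
      fix e :: nat assume e: "1 \<le> e"
      show "cnt (insert n B) e \<le> cnt (insert (Suc n) U) e \<and> cnt (insert (Suc n) U) e \<le> Suc (cnt (insert n B) e)"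
        using cU[OF e] cnt_high[OF B', of e] f cnt_insert_Suc[OF B, of e, folded nm]
        by (auto simp: cnt_insert_Suc[OF Usub])
    qed
    have "insert (Suc n) U - insert n B = {Suc n}" using Un B' by auto
    moreover have "\<Sum>(insert (Suc n) U) - \<Sum>(insert n B) = Suc k"
      using sum_insert_Suc[OF Usub] sum_insert_Suc[OF B, folded nm] P(4) by (simp add: k_def del: sum.insert)
    ultimately have "strip (delta (Suc k)) (insert (Suc n) U) (insert n B) = 2"
      using il by (simp add: strip_delta weight_def del: sum.insert)
    moreover have "Qc w (insert (Suc n) A) (insert (Suc n) U) = X"
      unfolding X_def by (rule strips_insert_Suc[OF A Usub])
    ultimately show ?thesis
      using Qc_inner_ge[of "insert (Suc n) A" "{insert (Suc n) U}" "insert n B" w "Suc k"]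
        parts_insert_Suc[OF A] parts_insert_Suc[OF Usub] parts_insert_Suc[OF B] nm by simp
  qed
  \<comment> \<open>The layer together with the box on diagonal \<open>Min B\<close>, which is at
    most \<open>f\<close>. If \<open>Min B = 1\<close>, this box is isolated because
    \<open>f\<close> is at least 2, so the weight is at least 4 against the coefficient 2; otherwise
    the coefficient 4 and the weight 2 suffice.\<close>
  have L2: "8 * X \<le> (if Min B = 1 then 2 else 4) * Qc (Suc k # w) A (dec_min B)"
  proof -
    have ps: "parts (dec_min B)" using dc(1) parts_subset by blast
    have il: "interlaced U (dec_min B)"
      unfolding interlaced_def
    proof (intro allI impI)
      fix e :: nat assume e: "1 \<le> e"
      show "cnt (dec_min B) e \<le> cnt U e \<and> cnt U e \<le> Suc (cnt (dec_min B) e)"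
        using cU[OF e] dc(2)[OF e, folded b_def] b by (cases "e = b") auto
    qed
    have sz: "\<Sum>U - \<Sum>(dec_min B) = Suc k" using P(4) dc(3) by (simp add: k_def)
    have nd: "n \<in> U - dec_min B" using Un dc(1) nm by auto
    have fin: "finite (U - dec_min B)" using P(1) by simp
    have c: "(if Min B = 1 then 2 else 1) \<le> card (U - dec_min B)"
    proof (cases "b = 1")
      case True
      have "b \<in> U" using cU[of b] cU[of "Suc b"] True f2 cnt_Suc[of U b] cnt_Suc[of B b] b p P(1)
        by (cases "b \<in> U") auto
      moreover have "b \<notin> dec_min B" using b by (auto simp: dec_min_def b_def[symmetric])
      ultimately have "{b, n} \<subseteq> U - dec_min B" using nd by auto
      moreover have "b \<noteq> n" using b f by simp
      ultimately have "2 \<le> card (U - dec_min B)" using card_mono[OF fin, of "{b, n}"] by simp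
      then show ?thesis by simp
    next
      case False
      have "{n} \<subseteq> U - dec_min B" using nd by auto
      then have "1 \<le> card (U - dec_min B)" using card_mono[OF fin, of "{n}"] by simp
      then show ?thesis using False by (simp add: b_def)
    qed
    have "(2::real) ^ (if Min B = 1 then 2 else 1) \<le> 2 ^ card (U - dec_min B)"
      using c by (rule power_increasing) simp
    also have "\<dots> = strip (delta (Suc k)) U (dec_min B)" using il sz by (simp add: strip_delta weight_def)
    finally have "X * 2 ^ (if Min B = 1 then 2 else 1) \<le> X * strip (delta (Suc k)) U (dec_min B)"
      using w by (intro mult_left_mono) (auto simp: X_def)
    also have "\<dots> \<le> Qc (Suc k # w) A (dec_min B)"
      using Qc_inner_ge[of A "{U}" "dec_min B" w "Suc k"] p P(1) ps by (simp add: X_def)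
    finally show ?thesis by (auto split: if_splits)
  qed
  have "2 * Qc (Suc k # w) (insert (Suc n) A) (insert n B)
      + (if Min B = 1 then 2 else 4) * Qc (Suc k # w) A (dec_min B) \<le> 2 * times_q1 (\<lambda>v. Qc v A B) (Suc k # w)"
    using second_coeff[OF A[unfolded nm] B BA Bne C[unfolded nm] eq[unfolded nm], of "Suc k # w"]
    unfolding nm .
  then show False using R L1 L2 w unfolding X_def[symmetric] by linarith
qed

text \<open>Outside the first two cases \<open>n\<close> belongs to \<open>A\<close> and not to
  \<open>B\<close>. Deleting the largest part then leaves a strange pair whose nonempty diagonals
  are \<open>{f<..n}\<close>, with \<open>f\<close> equal to 0 or 1 by
  \<open>gap_one\<close>.\<close>

theorem strange_classification:
  assumes "A \<subseteq> {1..n}" "B \<subseteq> {1..n}" "inside B A" "strange_pair (insert (Suc n) A) B"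
  shows "B = {} \<or> insert (Suc n) A = {1..Suc n} \<or>
    (\<exists>p q. 1 \<le> p \<and> 1 \<le> q \<and> p + q \<le> Suc n \<and> insert (Suc n) A = {p..Suc n} \<and> B = {1..q})"
  using assms
proof (induction n arbitrary: A B rule: less_induct)
  case (less n)
  note A = less.prems(1) and B = less.prems(2) and BA = less.prems(3) and s = less.prems(4)
  show ?case
  proof (cases "B = {} \<or> A = {1..n}")
    case True
    moreover have "insert (Suc n) {1..n} = {1..Suc n}" by auto
    ultimately show ?thesis by auto
  next
    case False
    then have nA: "n \<in> A" and nB: "n \<notin> B"
      using no_second_part[OF less.prems] next_in_inner[OF less.prems] by auto
    obtain m where nm: "n = Suc m" using nA A by (cases n) auto
    define A' where "A' = A - {n}"
    have A': "A' \<subseteq> {1..m}" "A = insert (Suc m) A'" using A nA by (auto simp: A'_def nm le_Suc_eq)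
    have B': "B \<subseteq> {1..m}" using B nB by (auto simp: nm le_Suc_eq)
    have p: "parts A" "parts B" using A B parts_subset by auto
    obtain C where C: "C \<subseteq> {1..n}" "\<forall>w. Qc w (insert (Suc n) A) B = Qc w (insert (Suc n) C) {}"
        "\<forall>w. Qc w A B = Qc w C {}"
      by (rule strange_pair_insert_Suc[OF less.prems])
    have sAB: "strange_pair A B" unfolding strange_pair_def using C(3) parts_subset[OF C(1)] by blast
    have ne: "A \<noteq> B" using nA nB by blast
    obtain U where U: "layer A B U" using layer_exists[OF p] by blast
    obtain f g where fg: "f < g" "diags A B = {f<..g}" "U - B = {g}"
      by (rule strange_pair_interval[OF p BA sAB ne U])
    have "n \<in> diags A B"
      using cnt_high[OF B', of n] nA cnt_eq_0_iff[of A n] p by (auto simp: diags_def nm)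
    moreover have "g \<in> diags A B" using fg by auto
    then have "g \<le> n" using diags_subset[OF A, of B] by auto
    ultimately have g: "g = n" using fg by auto
    show ?thesis
    \<comment> \<open>For \<open>f = 0\<close> the induction hypothesis applies to \<open>A\<close>
      and \<open>B\<close> themselves; for \<open>f = 1\<close> it applies to their slice, two sizes
      smaller.\<close>
    proof (cases "f = 0")
      case True
      have "inside B A'"
        unfolding inside_def
      proof (intro allI impI)
        fix e :: nat assume e: "1 \<le> e"
        show "cnt B e \<le> cnt A' e"
        proof (cases "e \<le> n")
          case le: True
          then have "e \<in> diags A B" using fg(2) e True g by simp
          then have "cnt B e < cnt A e" by (simp add: diags_def)
          then show ?thesis using le cnt_insert_Suc[OF A'(1), of e] A'(2) nm by simp
        next
          case False
          then show ?thesis using cnt_high[OF B, of e] by simp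
        qed
      qed
      then have "B = {} \<or> A = {1..n} \<or> (\<exists>p q. 1 \<le> p \<and> 1 \<le> q \<and> p + q \<le> n \<and> A = {p..n} \<and> B = {1..q})"
        using less.IH[of m A' B] A' B' sAB nm by simp
      then obtain p q where pq: "1 \<le> p" "1 \<le> q" "p + q \<le> n" "A = {p..n}" "B = {1..q}"
        using False by auto
      then have "insert (Suc n) A = {p..Suc n}" by auto
      then show ?thesis using pq by (intro disjI2 exI[of _ p] exI[of _ q]) simp
    next
      case f0: False
      have f: "f = 1"
        using gap_one[OF A B' nm BA C(1) C(2)[rule_format] U, of f] fg f0 unfolding g by linarith
      then obtain n' where n': "n = Suc (Suc n')" using fg(1) g by (cases n; cases "n - 1") auto
      define A1 where "A1 = {x \<in> {1..n'}. x + 1 \<in> A}"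
      define B1 where "B1 = {x \<in> {1..n'}. x + 1 \<in> B}"
      have d1: "diags A B = {1<..n}" "1 < n" "Suc n' = n - 1" using fg f g n' by auto
      note sl = slice[OF p BA d1 A1_def B1_def]
      have Qc: "Qc w A B = Qc w (insert (Suc n') A1) B1" for w
        by (rule slice_Qc[OF p BA d1 A1_def B1_def])
      have "strange_pair (insert (Suc n') A1) B1" using sAB Qc by (simp add: strange_pair_def)
      then have IH: "B1 = {} \<or> insert (Suc n') A1 = {1..Suc n'} \<or>
          (\<exists>p q. 1 \<le> p \<and> 1 \<le> q \<and> p + q \<le> Suc n' \<and> insert (Suc n') A1 = {p..Suc n'} \<and> B1 = {1..q})"
        using less.IH[of n' A1 B1] sl n' by simp
      have c1: "cnt A 1 = cnt B 1" and c2: "cnt B 2 < cnt A 2"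
      proof -
        have "1 \<notin> diags A B" "2 \<in> diags A B" using d1 by auto
        then show "cnt A 1 = cnt B 1" "cnt B 2 < cnt A 2"
          using BA by (auto simp: diags_def inside_def intro: order_antisym)
      qed
      have m1: "1 \<in> B" "1 \<notin> A"
        using c1 c2 cnt_Suc[of A 1] cnt_Suc[of B 1] p
        by (cases "1 \<in> A"; cases "1 \<in> B"; simp add: numeral_2_eq_2)+
      have AS: "A = Suc ` insert (Suc n') A1"
      proof
        show "A \<subseteq> Suc ` insert (Suc n') A1"
        proof
          fix x assume x: "x \<in> A"
          then have "1 \<le> x" "x \<noteq> 1" "x \<le> n" using A m1 by auto
          then have "2 \<le> x" "x \<le> n" by auto
          then show "x \<in> Suc ` insert (Suc n') A1" using x n' by (cases x) (auto simp: A1_def image_iff)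
        qed
      qed (use nA n' in \<open>auto simp: A1_def\<close>)
      have BS: "B = insert 1 (Suc ` B1)"
      proof
        show "B \<subseteq> insert 1 (Suc ` B1)"
        proof
          fix x assume x: "x \<in> B"
          then have "1 \<le> x" "x \<le> Suc n'" using B' nm n' by auto
          then show "x \<in> insert 1 (Suc ` B1)" using x by (cases x) (auto simp: B1_def image_iff)
        qed
      qed (use m1 in \<open>auto simp: B1_def\<close>)
      have "card A = card B" using c1 cnt_0 cnt_0' p by (metis parts_def)
      moreover have "card A = card (insert (Suc n') A1)"
        unfolding AS by (rule card_image) (simp add: inj_on_def)
      moreover have "card B = Suc (card B1)"
      proof -
        have "finite B1" "1 \<notin> Suc ` B1" by (auto simp: B1_def)
        then have "card B = Suc (card (Suc ` B1))" unfolding BS by (intro card_insert_disjoint) auto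
        moreover have "card (Suc ` B1) = card B1" by (rule card_image) (simp add: inj_on_def)
        ultimately show ?thesis by simp
      qed
      \<comment> \<open>The empty diagonal 1 means that \<open>A\<close> and \<open>B\<close> have
        equally many parts. In every case of the induction hypothesis this leaves only a
        parallelogram.\<close>
      ultimately have card: "card (insert (Suc n') A1) = Suc (card B1)" by simp
      have conc: ?thesis if "A = {p..n}" "B = {1..q}" "p + q = Suc n" "1 \<le> p" "1 \<le> q" for p q
      proof -
        have "insert (Suc n) A = {p..Suc n}" using that by auto
        then show ?thesis using that by (intro disjI2 exI[of _ p] exI[of _ q]) simp
      qed
      from IH show ?thesis
      proof (elim disjE exE conjE)
        assume B1: "B1 = {}"
        have "finite A1" "Suc n' \<notin> A1" by (auto simp: A1_def)
        then have "A1 = {}" using card B1 by simp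
        then show ?thesis using AS BS B1 n' by (intro conc[of n 1]) auto
      next
        assume A1: "insert (Suc n') A1 = {1..Suc n'}"
        then have "card B1 = card {1..n'}" using card by simp
        then have "B1 = {1..n'}" using sl(4) card_subset_eq[of "{1..n'}" B1] by simp
        moreover have "Suc ` {1..Suc n'} = {2..n}" unfolding image_Suc_atLeastAtMost n' by simp
        moreover have "insert 1 (Suc ` {1..n'}) = {1..Suc n'}" unfolding image_Suc_atLeastAtMost by auto
        ultimately show ?thesis using AS BS A1 n' by (intro conc[of 2 "Suc n'"]) auto
      next
        fix p q assume pq: "1 \<le> p" "1 \<le> q" "p + q \<le> Suc n'" "insert (Suc n') A1 = {p..Suc n'}" "B1 = {1..q}"
        then have "Suc (Suc n') - p = Suc q" using card by simp
        moreover have "Suc ` {p..Suc n'} = {Suc p..n}" unfolding image_Suc_atLeastAtMost n' by simp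
        moreover have "insert 1 (Suc ` {1..q}) = {1..Suc q}" unfolding image_Suc_atLeastAtMost by auto
        ultimately show ?thesis using AS BS pq n' by (intro conc[of "Suc p" "Suc q"]) auto
      qed
    qed
  qed
qed

section \<open>Skewing operators and P-functions\<close>

text \<open>A formal linear combination of words acts as an operator; \<open>comb (dual C)\<close> is the operator skewing
  by the element dual to the Q-function of \<open>C\<close>, so \<open>comb (dual C) A B\<close> is the coefficient of the Q-function of
  \<open>C\<close> in the skew Q-function of \<open>A\<close>, \<open>B\<close>.\<close>

definition comb :: "(real \<times> nat list) list \<Rightarrow> nat set \<Rightarrow> nat set \<Rightarrow> real" where
  "comb P A B = (\<Sum>(c, v)\<leftarrow>P. c * Qc v A B)"

lemma comb_Nil [simp]: "comb [] A B = 0"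
  by (simp add: comb_def)

lemma comb_Cons [simp]: "comb ((c, v) # P) A B = c * Qc v A B + comb P A B"
  by (simp add: comb_def)

lemma comb_append [simp]: "comb (P @ R) A B = comb P A B + comb R A B"
  by (simp add: comb_def)

lemma comb_scale: "comb (map (\<lambda>(c, v). (a * c, v)) P) A B = a * comb P A B"
  by (induction P) (auto simp: algebra_simps)

lemma comb_sum_exists: "finite F \<Longrightarrow> \<exists>P. \<forall>A B. comb P A B = (\<Sum>i\<in>F. c i * comb (R i) A B)"
proof (induction F rule: finite_induct)
  case empty
  then show ?case by (metis comb_Nil sum.empty)
next
  case (insert i F)
  then obtain P where "\<forall>A B. comb P A B = (\<Sum>i\<in>F. c i * comb (R i) A B)" by blast
  then show ?case
    using insert by (intro exI[of _ "map (\<lambda>(b, v). (c i * b, v)) (R i) @ P"]) (simp add: comb_scale)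
qed

lemma comb_commute:
  assumes "A \<subseteq> {1..N}"
  shows "(\<Sum>S\<in>Pow {1..N}. strips u A S * comb P S B) = (\<Sum>S\<in>Pow {1..N}. comb P A S * strips u S B)"
proof (induction P)
  case (Cons p P)
  obtain c v where p: "p = (c, v)" by (cases p)
  have "(\<Sum>S\<in>Pow {1..N}. strips u A S * Qc v S B) = (\<Sum>S\<in>Pow {1..N}. Qc v A S * strips u S B)"
    using strips_append[OF assms, of u "map delta v" B] strips_append[OF assms, of "map delta v" u B]
      strips_perm[of A "u @ map delta v" "map delta v @ u" B] parts_subset[OF assms] by simp
  then have "c * (\<Sum>S\<in>Pow {1..N}. strips u A S * Qc v S B) = c * (\<Sum>S\<in>Pow {1..N}. Qc v A S * strips u S B)" by simp
  then show ?case using Cons.IH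
    by (simp add: p distrib_left distrib_right sum.distrib sum_distrib_left mult_ac)
qed simp

lemma comb_commute2:
  assumes "A \<subseteq> {1..N}"
  shows "(\<Sum>S\<in>Pow {1..N}. comb R A S * comb P S B) = (\<Sum>S\<in>Pow {1..N}. comb P A S * comb R S B)"
proof (induction R)
  case (Cons p R)
  obtain c v where p: "p = (c, v)" by (cases p)
  have "c * (\<Sum>S\<in>Pow {1..N}. Qc v A S * comb P S B) = c * (\<Sum>S\<in>Pow {1..N}. comb P A S * Qc v S B)"
    using comb_commute[OF assms, of "map delta v" P B] by simp
  then show ?case using Cons.IH
    by (simp add: p distrib_left distrib_right sum.distrib sum_distrib_left mult_ac)
qed simp

lemma comb_linear:
  assumes "\<And>w. Qc w A B = (\<Sum>i\<in>F. c i * Qc w (f i) (g i))"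
  shows "comb P A B = (\<Sum>i\<in>F. c i * comb P (f i) (g i))"
proof (induction P)
  case (Cons p P)
  then show ?case
    using assms by (cases p) (simp add: distrib_left sum.distrib sum_distrib_left mult.left_commute)
qed simp

lemma comb_prefix:
  assumes "parts A"
  shows "comb (map (\<lambda>(c, v). (c, k # v)) P) A B = (\<Sum>S\<in>below A. strip (delta k) A S * comb P S B)"
  by (induction P) (auto simp: strips.simps sum.distrib sum_distrib_left distrib_left mult.left_commute)

lemma finite_parts: "finite {C. parts C \<and> \<Sum>C = s}"
proof (rule finite_subset)
  show "{C. parts C \<and> \<Sum>C = s} \<subseteq> Pow {1..s}"
  proof
    fix C assume C: "C \<in> {C. parts C \<and> \<Sum>C = s}"
    have "x \<in> {1..s}" if "x \<in> C" for x
      using C that member_le_sum[of x C "\<lambda>x. x"] by (cases x) (auto simp: parts_def)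
    then show "C \<in> Pow {1..s}" by blast
  qed
qed simp

lemma parts_sum_subset: "parts C \<Longrightarrow> C \<subseteq> {1..\<Sum>C}"
proof
  fix x assume "parts C" "x \<in> C"
  then show "x \<in> {1..\<Sum>C}"
    using member_le_sum[of x C "\<lambda>x. x"] by (cases x) (auto simp: parts_def)
qed

lemma Max_insert_Suc: "A \<subseteq> {1..n} \<Longrightarrow> Max (insert (Suc n) A) = Suc n"
  using finite_subset[of A "{1..n}"] by (intro Max_eqI) auto

text \<open>Triangularity in the largest part: prefixing \<open>Suc n\<close> to the words dual to
  \<open>C'\<close> gives an operator that kills every set with a smaller largest part and, among
  those with largest part \<open>Suc n\<close>, detects \<open>C\<close> alone, with value 2. The
  finitely many sets with a larger largest part are corrected by induction.\<close>

lemma dual_exists_step: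
  assumes IH1: "\<And>D. parts D \<Longrightarrow> \<Sum>D < s \<Longrightarrow> \<exists>P. \<forall>E. parts E \<longrightarrow> comb P E {} = of_bool (E = D)"
    and "parts C" "\<Sum>C = s"
  shows "\<exists>P. \<forall>D. parts D \<longrightarrow> comb P D {} = of_bool (D = C)"
  using assms(2,3)
proof (induction "s - Max C" arbitrary: C rule: less_induct)
  case less
  note IH2 = less.hyps
  show ?case
  proof (cases "C = {}")
    case True
    then have "\<forall>D. parts D \<longrightarrow> comb [(1, [])] D {} = of_bool (D = C)" by simp
    then show ?thesis by blast
  next
    case False
    then obtain n C' where C: "C = insert (Suc n) C'" "C' \<subseteq> {1..n}" using parts_cases less.prems by blast
    have pC': "parts C'" using C parts_subset by blast
    have mC: "Max C = Suc n" using Max_insert_Suc[OF C(2)] C(1) by simp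
    have "\<Sum>C' < \<Sum>C" using sum_insert_Suc[OF C(2)] C(1) by simp
    then obtain P where P: "\<And>D. parts D \<Longrightarrow> comb P D {} = of_bool (D = C')"
      using IH1[of C'] less.prems pC' by auto
    define X where "X = map (\<lambda>(c, v). (c, Suc n # v)) P"
    have X0: "comb X D {} = (if C' \<in> below D then strip (delta (Suc n)) D C' else 0)" if "parts D" for D
    proof -
      have "comb X D {} = (\<Sum>S\<in>below D. if S = C' then strip (delta (Suc n)) D C' else 0)"
        unfolding X_def comb_prefix[OF that] using P below_parts by (intro sum.cong) auto
      then show ?thesis using finite_below[OF that] by simp
    qed
    have X1: "\<Sum>D = \<Sum>C" if "parts D" "comb X D {} \<noteq> 0" for D
    proof -
      have *: "C' \<in> below D" "strip (delta (Suc n)) D C' \<noteq> 0" using X0[OF that(1)] that(2) by (auto split: if_splits)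
      then have "\<Sum>C' \<le> \<Sum>D" using inside_sum[OF that(1) pC'] interlaced_inside by (auto simp: below_def)
      then show ?thesis using * sum_insert_Suc[OF C(2)] C(1) by (auto simp: strip_delta split: if_splits)
    qed
    have X2: "comb X (insert (Suc k) D') {} = (if k = n then 2 * of_bool (D' = C') else 0)"
      if D': "D' \<subseteq> {1..k}" "k \<le> n" for k D'
    proof -
      have "comb (map (\<lambda>(c, v). (c, Suc n # v)) R) (insert (Suc k) D') {} = (if k = n then 2 * comb R D' {} else 0)" for R
      proof (induction R)
        case (Cons p R)
        obtain c v where p: "p = (c, v)" by (cases p)
        have "Qc (Suc n # v) (insert (Suc k) D') {} = (if k = n then 2 * Qc v D' {} else 0)"
          using Qc_insert_top[OF D'(1), of "{}"] D'(2) by fastforce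
        then show ?case using Cons.IH unfolding p by (simp add: algebra_simps)
      qed simp
      then show ?thesis using P[of D'] D' parts_subset unfolding X_def by auto
    qed
    define T where "T = {D. parts D \<and> \<Sum>D = \<Sum>C \<and> Suc n < Max D}"
    have finT: "finite T" using finite_parts[of "\<Sum>C"] by (rule rev_finite_subset) (auto simp: T_def)
    have "\<exists>R. \<forall>E. parts E \<longrightarrow> comb R E {} = of_bool (E = D)" if D: "D \<in> T" for D
    proof -
      have "D \<noteq> {}" using D less.prems C sum_insert_Suc[OF C(2)] by (auto simp: T_def)
      then have "Max D \<le> \<Sum>D" using D parts_sum_subset[of D] Max_in[of D] by (auto simp: T_def)
      then show ?thesis using D mC less.prems by (intro IH2) (auto simp: T_def)
    qed
    then obtain R where R: "\<And>D E. D \<in> T \<Longrightarrow> parts E \<Longrightarrow> comb (R D) E {} = of_bool (E = D)" by metis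
    obtain Y where Y: "\<And>A B. comb Y A B = (\<Sum>D\<in>T. comb X D {} * comb (R D) A B)"
      using comb_sum_exists[OF finT, of "\<lambda>D. comb X D {}" R] by blast
    define W where "W = map (\<lambda>(c, v). (1/2 * c, v)) (X @ map (\<lambda>(c, v). (- 1 * c, v)) Y)"
    have W: "comb W E {} = (comb X E {} - comb Y E {}) / 2" for E
      unfolding W_def comb_scale comb_append by simp
    have YE: "comb Y E {} = (if E \<in> T then comb X E {} else 0)" if "parts E" for E
    proof -
      have "comb Y E {} = (\<Sum>D\<in>T. if D = E then comb X E {} else 0)"
        unfolding Y using R that by (intro sum.cong) auto
      then show ?thesis using finT by simp
    qed
    have "comb W E {} = of_bool (E = C)" if E: "parts E" for E
    proof (cases "E \<in> T")
      case True
      then have "E \<noteq> C" using mC by (auto simp: T_def)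
      then show ?thesis using W[of E] YE[OF E] True by simp
    next
      case nT: False
      have "comb X E {} = 2 * of_bool (E = C)"
      proof (cases "E = {}")
        case True
        then show ?thesis using X1[of "{}"] E sum_insert_Suc[OF C(2)] C(1) by fastforce
      next
        case False
        then obtain k E' where E': "E = insert (Suc k) E'" "E' \<subseteq> {1..k}" using parts_cases E by blast
        have mE: "Max E = Suc k" using Max_insert_Suc[OF E'(2)] E'(1) by simp
        show ?thesis
        proof (cases "k \<le> n")
          case True
          have "E = C \<longleftrightarrow> k = n \<and> E' = C'"
            using E' C mE mC by (metis insert_ident not_mem_Suc diff_Suc_1)
          then show ?thesis using X2[OF E'(2) True] E'(1) by auto
        next
          case k: False
          then have "\<Sum>E \<noteq> \<Sum>C" "E \<noteq> C" using nT E mE mC by (auto simp: T_def)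
          then show ?thesis using X1[OF E] by auto
        qed
      qed
      then show ?thesis using W[of E] YE[OF E] nT by simp
    qed
    then show ?thesis by blast
  qed
qed

lemma dual_exists: "parts C \<Longrightarrow> \<exists>P. \<forall>D. parts D \<longrightarrow> comb P D {} = of_bool (D = C)"
proof (induction "\<Sum>C" arbitrary: C rule: less_induct)
  case less
  show ?case by (rule dual_exists_step[OF _ less.prems refl]) (rule less.hyps)
qed

definition dual :: "nat set \<Rightarrow> (real \<times> nat list) list" where
  "dual C = (SOME P. \<forall>D. parts D \<longrightarrow> comb P D {} = of_bool (D = C))"

lemma comb_dual: "parts C \<Longrightarrow> parts D \<Longrightarrow> comb (dual C) D {} = of_bool (D = C)"
  unfolding dual_def using someI_ex[OF dual_exists] by blast

lemma sum_comb_dual: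
  assumes "C \<subseteq> {1..N}"
  shows "(\<Sum>S\<in>Pow {1..N}. F S * comb (dual C) S {}) = F C"
proof -
  have "(\<Sum>S\<in>Pow {1..N}. F S * comb (dual C) S {}) = (\<Sum>S\<in>Pow {1..N}. if S = C then F C else 0)"
    using assms parts_subset by (intro sum.cong) (auto simp: comb_dual)
  then show ?thesis using assms by simp
qed

text \<open>Both sides are the entry from \<open>A\<close> to the empty set of the product of the
  operators dual to \<open>B\<close> and to \<open>C\<close>, and these commute.\<close>

lemma coeff_symmetric:
  assumes "parts A" "parts B" "parts C"
  shows "comb (dual C) A B = comb (dual B) A C"
proof -
  have "parts (A \<union> B \<union> C)" using assms by (auto simp: parts_def)
  then obtain N where N: "A \<union> B \<union> C \<subseteq> {1..N}" using parts_bounded by blast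
  have "comb (dual C) A B = (\<Sum>S\<in>Pow {1..N}. comb (dual C) A S * comb (dual B) S {})"
    using N by (intro sum_comb_dual[symmetric]) auto
  also have "\<dots> = (\<Sum>S\<in>Pow {1..N}. comb (dual B) A S * comb (dual C) S {})"
    using N by (intro comb_commute2) auto
  also have "\<dots> = comb (dual B) A C" using N by (intro sum_comb_dual) auto
  finally show ?thesis .
qed

text \<open>Insert the dual of \<open>B\<close> at the inner end, move it past \<open>u\<close>, and
  exchange \<open>B\<close> and \<open>C\<close> by symmetry.\<close>

lemma Q_expansion:
  assumes A: "A \<subseteq> {1..N}" and B: "B \<subseteq> {1..N}"
  shows "strips u A B = (\<Sum>C\<in>Pow {1..N}. comb (dual C) A B * strips u C {})"
proof -
  have "strips u A B = (\<Sum>S\<in>Pow {1..N}. strips u A S * comb (dual B) S {})"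
    by (rule sum_comb_dual[OF B, symmetric])
  also have "\<dots> = (\<Sum>S\<in>Pow {1..N}. comb (dual B) A S * strips u S {})" by (rule comb_commute[OF A])
  also have "\<dots> = (\<Sum>C\<in>Pow {1..N}. comb (dual C) A B * strips u C {})"
    using coeff_symmetric parts_subset A B by (intro sum.cong) auto
  finally show ?thesis .
qed

section \<open>Evaluation at real variables and products of P-functions\<close>

abbreviation geom :: "real \<Rightarrow> nat \<Rightarrow> real" where
  "geom x \<equiv> \<lambda>n. x ^ n"

abbreviation Qv :: "real list \<Rightarrow> nat set \<Rightarrow> nat set \<Rightarrow> real" where
  "Qv xs A B \<equiv> strips (map geom xs) A B"

definition Q_poly :: "nat set \<Rightarrow> real list \<Rightarrow> real poly" where
  "Q_poly C ys = (\<Sum>S\<in>below C. monom (weight C S * Qv ys S {}) (\<Sum>C - \<Sum>S))"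

lemma poly_Q_poly: "poly (Q_poly C ys) x = Qv (x # ys) C {}"
  by (simp add: Q_poly_def poly_sum poly_monom strips.simps strip_def mult_ac)

lemma coeff_Q_poly: "coeff (Q_poly C ys) k = strips (delta k # map geom ys) C {}"
  unfolding Q_poly_def coeff_sum coeff_monom strips.simps
  by (intro sum.cong) (auto simp: strip_delta)

text \<open>A relation between values at all points is an identity of polynomials in the first
  variable; its coefficients are relations of the same kind in the other variables.\<close>

lemma Qv_extract:
  assumes "\<And>ys. (\<Sum>S\<in>Pow {1..N}. c S * Qv ys S {}) = 0"
  shows "(\<Sum>S\<in>Pow {1..N}. c S * Qc w S {}) = 0"
  using assms
proof (induction w arbitrary: c)
  case Nil
  then show ?case using Nil[of "[]"] by simp
next
  case (Cons k w)
  define c' where "c' T = (\<Sum>S\<in>Pow {1..N}. c S * strip (delta k) S T)" for T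
  have *: "(\<Sum>S\<in>Pow {1..N}. c S * strips (delta k # u) S {}) = (\<Sum>T\<in>Pow {1..N}. c' T * strips u T {})" for u
  proof -
    have "(\<Sum>S\<in>Pow {1..N}. c S * strips (delta k # u) S {})
        = (\<Sum>S\<in>Pow {1..N}. \<Sum>T\<in>Pow {1..N}. c S * (strip (delta k) S T * strips u T {}))"
      by (simp add: strips_Cons sum_distrib_left)
    also have "\<dots> = (\<Sum>T\<in>Pow {1..N}. \<Sum>S\<in>Pow {1..N}. c S * (strip (delta k) S T * strips u T {}))"
      by (rule sum.swap)
    finally show ?thesis by (simp add: c'_def sum_distrib_right mult.assoc)
  qed
  have "(\<Sum>T\<in>Pow {1..N}. c' T * Qv ys T {}) = 0" for ys
  proof -
    have "(\<Sum>S\<in>Pow {1..N}. smult (c S) (Q_poly S ys)) = 0"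
    proof (rule poly_eq_on_pos)
      fix x :: real
      show "poly (\<Sum>S\<in>Pow {1..N}. smult (c S) (Q_poly S ys)) x = poly 0 x"
        using Cons.prems[of "x # ys"] by (simp only: poly_sum poly_smult poly_Q_poly poly_0)
    qed
    then have "coeff (\<Sum>S\<in>Pow {1..N}. smult (c S) (Q_poly S ys)) k = 0" by simp
    then show ?thesis using *[of "map geom ys"] by (simp only: coeff_sum coeff_smult coeff_Q_poly)
  qed
  then have "(\<Sum>T\<in>Pow {1..N}. c' T * Qc w T {}) = 0" by (rule Cons.IH)
  then show ?case using *[of "map delta w"] by simp
qed

text \<open>Values of the one-row Q-functions: \<open>qv j\<close> is the coefficient of
  \<open>t ^ j\<close> in the product of the factors \<open>(1 + x t) / (1 - x t)\<close>.\<close>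

fun qv :: "nat \<Rightarrow> real list \<Rightarrow> real" where
  "qv j [] = of_bool (j = 0)"
| "qv j (x # xs) = (\<Sum>i\<le>j. (if i = 0 then 1 else 2) * x ^ i * qv (j - i) xs)"

text \<open>A first row far to the right of the rest contributes the factor \<open>qv j\<close>.\<close>

lemma Qv_far:
  assumes "C \<subseteq> {1..m}" "m + j < t"
  shows "Qv xs (insert t C) {t - j} = qv j xs * Qv xs C {}"
  using assms
proof (induction xs arbitrary: C j t)
  case Nil
  have "insert t C = {t - j} \<longleftrightarrow> j = 0 \<and> C = {}"
  proof
    assume *: "insert t C = {t - j}"
    then have "t = t - j" by auto
    then have "j = 0" using Nil by simp
    moreover have "C = {}"
    proof (rule equals0I)
      fix x assume "x \<in> C"
      then have "x = t - j" "x \<le> m" using * Nil by auto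
      then show False using Nil by simp
    qed
    ultimately show "j = 0 \<and> C = {}" by simp
  qed auto
  then show ?case by simp
next
  case (Cons x xs)
  note C = Cons.prems(1) and t = Cons.prems(2)
  have finC: "finite C" using C finite_subset by blast
  have tC: "t \<notin> C" using C t by auto
  \<comment> \<open>A strip takes \<open>i\<close> boxes from the far row and leaves
    \<open>S\<close> from \<open>C\<close>. The far part stays above \<open>m\<close>, so both can
    be recovered from the union.\<close>
  define G where "G = (\<lambda>(i, S). insert (t - i) S)"
  define I where "I = {..j} \<times> Pow {1..m}"
  have inj: "inj_on G I"
  proof (rule inj_onI)
    fix a b assume ab: "a \<in> I" "b \<in> I" "G a = G b"
    obtain i S i' S' where e: "a = (i, S)" "b = (i', S')" by (cases a; cases b)
    have S: "S \<subseteq> {1..m}" "S' \<subseteq> {1..m}" "i \<le> j" "i' \<le> j" using ab e by (auto simp: I_def)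
    have big: "t - i \<notin> {1..m}" "t - i' \<notin> {1..m}" using S t by auto
    have eq: "insert (t - i) S = insert (t - i') S'" using ab e by (simp add: G_def)
    then have "t - i = t - i'" using big S by blast
    moreover from this have "S = S'" using eq big S insert_ident by (metis subsetD)
    ultimately show "a = b" using e S t by auto
  qed
  have cC: "cnt (insert t C) e = cnt C e + of_bool (e \<le> t)" for e
    by (rule cnt_insert[OF finC tC])
  have terms: "strip (geom x) (insert t C) (G (i, S)) * Qv xs (G (i, S)) {t - j}
      = (if i = 0 then 1 else 2) * x ^ i * qv (j - i) xs * (strip (geom x) C S * Qv xs S {})"
    if "(i, S) \<in> I" for i S
  proof -
    have S: "S \<subseteq> {1..m}" "i \<le> j" using that by (auto simp: I_def)
    have finS: "finite S" using S finite_subset by blast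
    have "m < t - i" using S t by linarith
    then have tS: "t - i \<notin> S" and tiC: "t - i \<notin> C" and tS': "t \<notin> S" and "t \<noteq> 0" using S C t by auto
    have cS: "cnt (insert (t - i) S) e = cnt S e + of_bool (e \<le> t - i)" for e
      by (rule cnt_insert[OF finS tS])
    have il: "interlaced (insert t C) (insert (t - i) S) \<longleftrightarrow> interlaced C S"
    proof -
      have "cnt (insert (t - i) S) e \<le> cnt (insert t C) e \<and> cnt (insert t C) e \<le> Suc (cnt (insert (t - i) S) e)
          \<longleftrightarrow> cnt S e \<le> cnt C e \<and> cnt C e \<le> Suc (cnt S e)" if "1 \<le> e" for e
        using cnt_high[OF S(1), of e] cnt_high[OF C, of e] S t
        by (cases "e \<le> m") (auto simp: cC cS)
      then show ?thesis by (auto simp: interlaced_def)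
    qed
    have "strip (geom x) (insert t C) (insert (t - i) S) = (if i = 0 then 1 else 2) * x ^ i * strip (geom x) C S"
    proof (cases "interlaced C S")
      case False
      then show ?thesis using il by (simp add: strip_def weight_def)
    next
      case True
      have le: "\<Sum>S \<le> \<Sum>C" using inside_sum[OF _ _ interlaced_inside[OF True]] C S parts_subset by blast
      have "\<Sum>(insert t C) - \<Sum>(insert (t - i) S) = i + (\<Sum>C - \<Sum>S)"
        using finC finS tC tS le S t by simp
      moreover have "card (insert t C - insert (t - i) S) = card (C - S) + of_bool (i \<noteq> 0)"
      proof -
        have "insert t C - insert (t - i) S = (if i = 0 then C - S else insert t (C - S))"
          using tC tiC tS tS' \<open>t \<noteq> 0\<close> by auto
        then show ?thesis using finC tC by simp
      qed
      ultimately show ?thesis using True il by (simp add: strip_def weight_def power_add del: sum.insert)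
    qed
    moreover have "Qv xs (insert (t - i) S) {t - j} = qv (j - i) xs * Qv xs S {}"
    proof -
      have "Qv xs (insert (t - i) S) {t - i - (j - i)} = qv (j - i) xs * Qv xs S {}"
        using S t by (intro Cons.IH) auto
      moreover have "t - i - (j - i) = t - j" using S by simp
      ultimately show ?thesis by simp
    qed
    ultimately show ?thesis by (simp add: G_def)
  qed
  \<comment> \<open>Reaching \<open>{t - j}\<close> requires an element above \<open>m\<close>, and
    interlacing with \<open>insert t C\<close> permits only one. So every nonzero term comes from
    \<open>G\<close>.\<close>
  have zero: "strip (geom x) (insert t C) S * Qv xs S {t - j} = 0" if S: "S \<in> Pow {1..t} - G ` I" for S
  proof (rule ccontr)
    assume *: "\<not> ?thesis"
    have il: "interlaced (insert t C) S"
    proof (rule ccontr)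
      assume "\<not> interlaced (insert t C) S"
      then have "strip (geom x) (insert t C) S = 0" by (simp add: strip_def weight_def)
      with * show False by simp
    qed
    have pS: "parts S" "S \<subseteq> {1..t}" using S parts_subset by auto
    have "inside {t - j} S" using * strips_nonzero_inside[OF pS(1)] by auto
    then have "cnt {t - j} (t - j) \<le> cnt S (t - j)" using t by (simp add: inside_def)
    then have "cnt S (t - j) \<noteq> 0" using cnt_insert[of "{}" "t - j" "t - j"] by simp
    then obtain y where y: "y \<in> S" "t - j \<le> y" using cnt_eq_0_iff[of S "t - j"] pS by (auto simp: not_less)
    have "S - {y} \<subseteq> {1..m}"
    proof
      fix z assume z: "z \<in> S - {y}"
      show "z \<in> {1..m}"
      proof (rule ccontr)
        assume "z \<notin> {1..m}"
        then have zm: "m < z" using z pS by auto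
        define e where "e = min z y"
        have e: "m < e" using zm y t by (auto simp: e_def)
        have "{z, y} \<subseteq> {u \<in> S. e \<le> u}" using z y by (auto simp: e_def)
        then have "card {z, y} \<le> cnt S e" unfolding cnt_def using pS by (intro card_mono) auto
        then have "2 \<le> cnt S e" using z by simp
        moreover have "cnt S e \<le> cnt (insert t C) e" using il e by (auto simp: interlaced_def)
        moreover have "cnt (insert t C) e \<le> 1" using cC[of e] cnt_high[OF C e] by simp
        ultimately show False by simp
      qed
    qed
    moreover have "y \<le> t" using y pS by auto
    ultimately have "S = G (t - y, S - {y})" "(t - y, S - {y}) \<in> I" using y by (auto simp: G_def I_def)
    then show False using S by blast
  qed
  have sub: "G ` I \<subseteq> Pow {1..t}" using t by (auto simp: G_def I_def)
  have "Qv (x # xs) (insert t C) {t - j} = (\<Sum>S\<in>Pow {1..t}. strip (geom x) (insert t C) S * Qv xs S {t - j})"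
    unfolding list.map by (rule strips_Cons) (use C t in auto)
  also have "\<dots> = (\<Sum>S\<in>G ` I. strip (geom x) (insert t C) S * Qv xs S {t - j})"
    using zero sub by (intro sum.mono_neutral_right) auto
  also have "\<dots> = (\<Sum>(i, S)\<in>I. (if i = 0 then 1 else 2) * x ^ i * qv (j - i) xs * (strip (geom x) C S * Qv xs S {}))"
    unfolding sum.reindex[OF inj] using terms by (intro sum.cong) auto
  also have "\<dots> = qv j (x # xs) * Qv (x # xs) C {}"
    unfolding I_def using C by (simp add: sum.cartesian_product[symmetric] sum_product strips_Cons)
  finally show ?case .
qed

definition Pv :: "nat set \<Rightarrow> real list \<Rightarrow> real" where
  "Pv C xs = Qv xs C {} / 2 ^ card C"

text \<open>The Pieri rule: multiplication by \<open>qv j\<close> in the basis of P-functions is the transpose of \<open>strip (delta j)\<close>.\<close>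

lemma pieri:
  assumes C: "parts C" and N: "\<Sum>C + j \<le> N"
  shows "qv j xs * Pv C xs = (\<Sum>D\<in>Pow {1..N}. strip (delta j) D C * Pv D xs)"
proof -
  define t where "t = Suc N"
  have Cs: "C \<subseteq> {1..\<Sum>C}" by (rule parts_sum_subset[OF C])
  have tN: "\<Sum>C + j < t" using N by (simp add: t_def)
  have finC: "finite C" using C by simp
  have tC: "t \<notin> C" using Cs tN by auto
  have sub: "insert t C \<subseteq> {1..t}" "{t - j} \<subseteq> {1..t}" using Cs tN by auto
  have pt: "parts (insert t C)" "parts {t - j}" using sub parts_subset by blast+
  \<comment> \<open>By symmetry, the coefficient of \<open>D\<close> is that of the single row
    \<open>t - j\<close> over the inner set \<open>D\<close>. The latter is half the weight of one
    strip of size \<open>t - j\<close>, as a single row has coefficient 2.\<close>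
  have coeff: "comb (dual D) (insert t C) {t - j} / 2 ^ card C = strip (delta j) D C / 2 ^ card D"
    if D: "D \<in> Pow {1..t}" for D
  proof -
    have pD: "parts D" "finite D" using D parts_subset finite_subset by auto
    have "strip (delta (t - j)) (insert t C) D = strips [delta (t - j)] (insert t C) D"
      using strips_single pt pD by simp
    also have "\<dots> = (\<Sum>E\<in>Pow {1..t}. comb (dual E) (insert t C) D * strips [delta (t - j)] E {})"
      using sub D by (intro Q_expansion) auto
    also have "\<dots> = (\<Sum>E\<in>Pow {1..t}. if E = {t - j} then 2 * comb (dual {t - j}) (insert t C) D else 0)"
      using tN parts_subset by (intro sum.cong) (auto simp: strips_delta_empty)
    also have "\<dots> = 2 * comb (dual {t - j}) (insert t C) D" using sub by simp
    also have "comb (dual {t - j}) (insert t C) D = comb (dual D) (insert t C) {t - j}"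
      using coeff_symmetric pt pD by blast
    finally have g: "strip (delta (t - j)) (insert t C) D = 2 * comb (dual D) (insert t C) {t - j}" .
    show ?thesis
    proof (cases "\<Sum>D = \<Sum>C + j \<and> interlaced D C")
      case True
      then have szD: "\<Sum>D = \<Sum>C + j" and il: "interlaced D C" by auto
      have Ds: "D \<subseteq> {1..N}" using parts_sum_subset[OF pD(1)] N szD by auto
      then have tD: "t \<notin> D" by (auto simp: t_def)
      have CN: "C \<subseteq> {1..N}" using Cs N by auto
      have "interlaced (insert t C) D"
        unfolding interlaced_def
      proof (intro allI impI)
        fix e :: nat assume e: "1 \<le> e"
        show "cnt D e \<le> cnt (insert t C) e \<and> cnt (insert t C) e \<le> Suc (cnt D e)"
          using il e cnt_high[OF Ds, of e] cnt_high[OF CN, of e] cnt_insert[OF finC tC, of e]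
          by (cases "e \<le> N") (auto simp: interlaced_def t_def)
      qed
      moreover have "\<Sum>(insert t C) - \<Sum>D = t - j" using finC tC szD by simp
      moreover have "card (insert t C - D) = Suc (card (C - D))"
        using tD tC finC by (simp add: insert_Diff_if)
      ultimately have "strip (delta (t - j)) (insert t C) D = 2 * 2 ^ card (C - D)"
        by (simp add: strip_delta weight_def del: sum.insert)
      then have "comb (dual D) (insert t C) {t - j} = 2 ^ card (C - D)" using g by simp
      moreover have "strip (delta j) D C = 2 ^ card (D - C)" using il szD by (simp add: strip_delta weight_def)
      \<comment> \<open>This is where the normalisation of the P-functions enters: it turns the
        weight of the strip from \<open>insert t C\<close> to \<open>D\<close> into that of the
        strip from \<open>D\<close> to \<open>C\<close>.\<close>
      moreover have "card (C - D) + card D = card (D - C) + card C"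
      proof -
        have "(C - D) \<inter> D = {}" "(D - C) \<inter> C = {}" by auto
        then show ?thesis
          using card_Un_disjoint[of "C - D" D] card_Un_disjoint[of "D - C" C] finC pD
          by (simp add: Un_commute)
      qed
      then have "(2::real) ^ card (C - D) * 2 ^ card D = 2 ^ card (D - C) * 2 ^ card C"
        by (simp flip: power_add)
      ultimately show ?thesis by (simp add: field_simps)
    next
      case False
      have "strip (delta j) D C = 0"
      proof (cases "interlaced D C")
        case True
        then have "\<Sum>C \<le> \<Sum>D" "\<Sum>D \<noteq> \<Sum>C + j" using False inside_sum[OF pD(1) C] interlaced_inside by auto
        then have "\<Sum>D - \<Sum>C \<noteq> j" by linarith
        then show ?thesis by (simp add: strip_delta)
      qed (simp add: strip_def weight_def)
      moreover have "strip (delta (t - j)) (insert t C) D = 0"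
      proof (rule ccontr)
        assume "\<not> ?thesis"
        then have il: "interlaced (insert t C) D" and sz: "\<Sum>(insert t C) - \<Sum>D = t - j"
          by (auto simp: strip_delta weight_def split: if_splits)
        then have szD: "\<Sum>D = \<Sum>C + j" using finC tC tN by simp
        have "interlaced D C"
          unfolding interlaced_def
        proof (intro allI impI)
          fix e :: nat assume e: "1 \<le> e"
          have Ds: "D \<subseteq> {1..N}" using parts_sum_subset[OF pD(1)] N szD by auto
          have CN: "C \<subseteq> {1..N}" using Cs N by auto
          show "cnt C e \<le> cnt D e \<and> cnt D e \<le> Suc (cnt C e)"
            using il e cnt_high[OF Ds, of e] cnt_high[OF CN, of e] cnt_insert[OF finC tC, of e]
            by (cases "e \<le> N") (auto simp: interlaced_def t_def)
        qed
        then show False using False szD by simp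
      qed
      ultimately show ?thesis using g by simp
    qed
  qed
  have "qv j xs * Pv C xs = Qv xs (insert t C) {t - j} / 2 ^ card C"
    using Qv_far[OF Cs tN, of xs] by (simp add: Pv_def)
  also have "\<dots> = (\<Sum>D\<in>Pow {1..t}. comb (dual D) (insert t C) {t - j} / 2 ^ card C * Qv xs D {})"
    unfolding Q_expansion[OF sub, of "map geom xs"] by (simp add: sum_divide_distrib)
  also have "\<dots> = (\<Sum>D\<in>Pow {1..t}. strip (delta j) D C * Pv D xs)"
    using coeff by (intro sum.cong) (auto simp: Pv_def)
  also have "\<dots> = (\<Sum>D\<in>Pow {1..N}. strip (delta j) D C * Pv D xs)"
  proof (rule sum.mono_neutral_right)
    show "\<forall>D\<in>Pow {1..t} - Pow {1..N}. strip (delta j) D C * Pv D xs = 0"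
    proof
      fix D assume D: "D \<in> Pow {1..t} - Pow {1..N}"
      then have pD: "parts D" using parts_subset by blast
      have "\<not> (interlaced D C \<and> \<Sum>D - \<Sum>C = j)"
      proof
        assume *: "interlaced D C \<and> \<Sum>D - \<Sum>C = j"
        then have "\<Sum>D \<le> N" using inside_sum[OF pD C] interlaced_inside N by fastforce
        then show False using D parts_sum_subset[OF pD] by auto
      qed
      then show "strip (delta j) D C * Pv D xs = 0" by (auto simp: strip_delta weight_def)
    qed
  qed (auto simp: t_def)
  finally show ?thesis .
qed

definition q_prod :: "nat list \<Rightarrow> real list \<Rightarrow> real" where
  "q_prod v xs = (\<Prod>j\<leftarrow>v. qv j xs)"

lemma q_prod_Pv:
  assumes "parts C" "\<Sum>C + sum_list v \<le> N"
  shows "q_prod v xs * Pv C xs = (\<Sum>D\<in>Pow {1..N}. Qc v D C * Pv D xs)"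
  using assms(2)
proof (induction v)
  case Nil
  have "C \<in> Pow {1..N}" using parts_sum_subset[OF assms(1)] Nil by auto
  moreover have "(\<Sum>D\<in>Pow {1..N}. Qc [] D C * Pv D xs) = (\<Sum>D\<in>Pow {1..N}. if D = C then Pv C xs else 0)"
    by (intro sum.cong) auto
  ultimately show ?case by (simp add: q_prod_def)
next
  case (Cons j v)
  have "q_prod (j # v) xs * Pv C xs = (\<Sum>S\<in>Pow {1..N}. Qc v S C * (qv j xs * Pv S xs))"
    using Cons by (simp add: q_prod_def mult.assoc mult.left_commute sum_distrib_left)
  also have "\<dots> = (\<Sum>S\<in>Pow {1..N}. Qc v S C * (\<Sum>D\<in>Pow {1..N}. strip (delta j) D S * Pv D xs))"
  proof (rule sum.cong[OF refl])
    fix S assume "S \<in> Pow {1..N}"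
    then have pS: "parts S" using parts_subset by blast
    show "Qc v S C * (qv j xs * Pv S xs) = Qc v S C * (\<Sum>D\<in>Pow {1..N}. strip (delta j) D S * Pv D xs)"
    proof (cases "Qc v S C = 0")
      case False
      then have "\<Sum>S + j \<le> N" using Qc_sum[OF pS] Cons.prems by simp
      then show ?thesis using pieri[OF pS] by simp
    qed simp
  qed
  also have "\<dots> = (\<Sum>S\<in>Pow {1..N}. \<Sum>D\<in>Pow {1..N}. strip (delta j) D S * Qc v S C * Pv D xs)"
    by (simp add: sum_distrib_left mult_ac)
  also have "\<dots> = (\<Sum>D\<in>Pow {1..N}. \<Sum>S\<in>Pow {1..N}. strip (delta j) D S * Qc v S C * Pv D xs)"
    by (rule sum.swap)
  also have "\<dots> = (\<Sum>D\<in>Pow {1..N}. Qc (j # v) D C * Pv D xs)"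
    by (simp add: strips_Cons sum_distrib_right)
  finally show ?case .
qed

lemma Pv_empty: "Pv {} xs = 1"
proof -
  have "Qv xs {} {} = 1"
  proof (induction xs)
    case (Cons x xs)
    have "Qv (x # xs) {} {} = (\<Sum>S\<in>Pow {1..0}. strip (geom x) {} S * Qv xs S {})"
      unfolding list.map by (rule strips_Cons) simp
    then show ?case using Cons by (simp add: strip_def weight_def interlaced_def)
  qed simp
  then show ?thesis by (simp add: Pv_def)
qed

text \<open>Bounds the number of boxes that the words can add, so that one window
  \<open>{1..N}\<close> catches every term.\<close>

definition word_bound :: "(real \<times> nat list) list \<Rightarrow> nat" where
  "word_bound P = (\<Sum>(c, v)\<leftarrow>P. sum_list v)"

lemma comb_Pv:
  assumes "parts C" "\<Sum>C + word_bound P \<le> N"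
  shows "(\<Sum>(c, v)\<leftarrow>P. c * q_prod v xs) * Pv C xs = (\<Sum>D\<in>Pow {1..N}. comb P D C * Pv D xs)"
  using assms(2)
proof (induction P)
  case (Cons p P)
  obtain c v where p: "p = (c, v)" by (cases p)
  have "\<Sum>C + sum_list v \<le> N" "\<Sum>C + word_bound P \<le> N" using Cons.prems by (auto simp: p word_bound_def)
  then have "c * (q_prod v xs * Pv C xs) = c * (\<Sum>D\<in>Pow {1..N}. Qc v D C * Pv D xs)"
    "(\<Sum>(c, v)\<leftarrow>P. c * q_prod v xs) * Pv C xs = (\<Sum>D\<in>Pow {1..N}. comb P D C * Pv D xs)"
    using q_prod_Pv[OF assms(1)] Cons.IH by simp_all
  then show ?case by (simp add: p algebra_simps sum.distrib sum_distrib_left)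
qed simp

text \<open>The coefficients of skew Q-functions are the structure constants of the P-functions.\<close>

lemma Pv_product:
  assumes B: "parts B" and C: "parts C" and N: "\<Sum>B \<le> N" "\<Sum>C + word_bound (dual B) \<le> N"
  shows "Pv B xs * Pv C xs = (\<Sum>D\<in>Pow {1..N}. comb (dual B) D C * Pv D xs)"
proof -
  \<comment> \<open>Applied to the P-function 1 of the empty set, the dual of \<open>B\<close> shows
    that its polynomial in the \<open>qv j\<close> is the P-function of \<open>B\<close>.\<close>
  have "(\<Sum>(c, v)\<leftarrow>dual B. c * q_prod v xs) * Pv {} xs = (\<Sum>D\<in>Pow {1..N}. comb (dual B) D {} * Pv D xs)"
    using N by (intro comb_Pv) (auto simp: parts_def)
  also have "\<dots> = (\<Sum>D\<in>Pow {1..N}. if D = B then Pv B xs else 0)"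
    using parts_subset B by (intro sum.cong) (auto simp: comb_dual)
  also have "\<dots> = Pv B xs" using parts_sum_subset[OF B] N by auto
  finally show ?thesis using comb_Pv[OF C N(2), of xs] by (simp add: Pv_empty)
qed

lemma degree_Q_poly:
  assumes "C \<subseteq> {1..a}"
  shows "degree (Q_poly C ys) \<le> a"
proof (rule degree_le, intro allI impI)
  fix k assume k: "a < k"
  show "coeff (Q_poly C ys) k = 0"
  proof (cases "C = {}")
    case True
    have "strips (delta k # map geom ys) {} {} = (\<Sum>S\<in>Pow {1..0}. strip (delta k) {} S * Qv ys S {})"
      by (rule strips_Cons) simp
    then show ?thesis using True k by (simp add: coeff_Q_poly strip_delta)
  next
    case False
    then obtain n C' where C: "C = insert (Suc n) C'" "C' \<subseteq> {1..n}"
      using parts_cases parts_subset assms by blast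
    then have "Suc n \<le> a" using assms by auto
    then show ?thesis
      using strips_insert_top(1)[OF C(2), of "{}" k "map geom ys"] C(1) k by (fastforce simp: coeff_Q_poly)
  qed
qed

text \<open>The product of the P-functions of \<open>B\<close> and \<open>C\<close> has degree at
  most \<open>a + b\<close> in the first variable. Descending from a trivial bound, the coefficient
  of degree \<open>Suc n\<close> in the expansion is a combination of Q-functions of the sets
  without their part \<open>Suc n\<close>; it vanishes, and these functions are linearly
  independent.\<close>

lemma product_top_part:
  assumes B: "B \<subseteq> {1..a}" and C: "C \<subseteq> {1..b}" and D: "parts D" and nz: "comb (dual B) D C \<noteq> 0"
  shows "D \<subseteq> {1..a + b}"
proof -
  have p: "parts B" "parts C" using B C parts_subset by auto
  define N where "N = \<Sum>B + (\<Sum>C + word_bound (dual B)) + \<Sum>D + a + b"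
  define g where "g D = comb (dual B) D C" for D
  have gN: "Pv B xs * Pv C xs = (\<Sum>D\<in>Pow {1..N}. g D * Pv D xs)" for xs
    unfolding g_def using p by (intro Pv_product) (auto simp: N_def)
  have down: "\<forall>D\<in>Pow {1..N}. g D \<noteq> 0 \<longrightarrow> D \<subseteq> {1..n}"
    if n: "a + b \<le> n" "Suc n \<le> N" and IH: "\<forall>D\<in>Pow {1..N}. g D \<noteq> 0 \<longrightarrow> D \<subseteq> {1..Suc n}" for n
  proof -
    \<comment> \<open>The factor 2 is the top coefficient of the Q-function of
      \<open>insert (Suc n) D\<close>, the denominator its normalisation.\<close>
    define c where "c D = g (insert (Suc n) D) * 2 / 2 ^ card (insert (Suc n) D)" for D
    have "(\<Sum>S\<in>Pow {1..n}. c S * Qv ys S {}) = 0" for ys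
    proof -
      define pol where "pol D = smult (1 / 2 ^ card D) (Q_poly D ys)" for D
      have pe: "poly (pol D) x = Pv D (x # ys)" for D x
        by (simp add: pol_def poly_Q_poly Pv_def)
      have "pol B * pol C = (\<Sum>D\<in>Pow {1..N}. smult (g D) (pol D))"
        by (rule poly_eq_on_pos) (simp only: poly_mult poly_sum poly_smult pe gN)
      moreover have "coeff (pol B * pol C) (Suc n) = 0"
      proof (rule coeff_eq_0)
        have "degree (pol B) \<le> a" "degree (pol C) \<le> b"
          using degree_Q_poly B C degree_smult_le le_trans unfolding pol_def by metis+
        then have "degree (pol B * pol C) \<le> a + b" using degree_mult_le[of "pol B" "pol C"] by linarith
        then show "degree (pol B * pol C) < Suc n" using n by simp
      qed
      ultimately have "(\<Sum>D\<in>Pow {1..N}. g D * coeff (pol D) (Suc n)) = 0"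
        by (simp only: coeff_sum coeff_smult)
      moreover have "(\<Sum>D\<in>Pow {1..N}. g D * coeff (pol D) (Suc n))
          = (\<Sum>D\<in>Pow {1..Suc n}. g D * coeff (pol D) (Suc n))"
        using IH n by (intro sum.mono_neutral_right) auto
      moreover have "coeff (pol D) (Suc n) = 0" if "D \<in> Pow {1..n}" for D
        using degree_Q_poly[of D n ys] that by (simp add: pol_def coeff_eq_0)
      moreover have "g (insert (Suc n) D) * coeff (pol (insert (Suc n) D)) (Suc n) = c D * Qv ys D {}"
        if "D \<in> Pow {1..n}" for D
        using strips_insert_top(2)[of D n "{}" "map geom ys"] that
        by (simp add: pol_def coeff_Q_poly c_def)
      ultimately show ?thesis by (simp only: sum_Pow_Suc) simp
    qed
    then have K0: "(\<Sum>S\<in>Pow {1..n}. c S * Qc w S {}) = 0" for w by (rule Qv_extract)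
    have c0: "c E = 0" if E: "E \<in> Pow {1..n}" for E
    proof -
      have pE: "parts E" using E parts_subset by blast
      have "(\<Sum>S\<in>Pow {1..n}. c S * comb P S {}) = 0" for P
      proof (induction P)
        case (Cons p P)
        obtain d w where p: "p = (d, w)" by (cases p)
        have "(\<Sum>S\<in>Pow {1..n}. c S * comb (p # P) S {})
            = d * (\<Sum>S\<in>Pow {1..n}. c S * Qc w S {}) + (\<Sum>S\<in>Pow {1..n}. c S * comb P S {})"
          by (simp add: p distrib_left sum.distrib sum_distrib_left mult_ac)
        then show ?case using K0 Cons.IH by simp
      qed simp
      then have "(\<Sum>S\<in>Pow {1..n}. c S * comb (dual E) S {}) = 0" .
      then show ?thesis using sum_comb_dual[of E n c] E by auto
    qed
    show ?thesis
    proof (intro ballI impI)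
      fix D assume D: "D \<in> Pow {1..N}" "g D \<noteq> 0"
      then have "D \<subseteq> {1..Suc n}" using IH by blast
      show "D \<subseteq> {1..n}"
      proof (rule ccontr)
        assume "\<not> D \<subseteq> {1..n}"
        then have "Suc n \<in> D" using \<open>D \<subseteq> {1..Suc n}\<close> by (auto simp: le_Suc_eq)
        then have "D = insert (Suc n) (D - {Suc n})" "D - {Suc n} \<in> Pow {1..n}"
          using \<open>D \<subseteq> {1..Suc n}\<close> by (auto simp: le_Suc_eq)
        then show False using c0[of "D - {Suc n}"] D by (simp add: c_def)
      qed
    qed
  qed
  have "a + b \<le> N" by (simp add: N_def)
  then have "\<forall>D\<in>Pow {1..N}. g D \<noteq> 0 \<longrightarrow> D \<subseteq> {1..a + b}"
  proof (induction rule: inc_induct)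
    case base
    then show ?case by auto
  next
    case (step n)
    then show ?case using down[of n] by auto
  qed
  moreover have "D \<in> Pow {1..N}" using parts_sum_subset[OF D] by (auto simp: N_def)
  ultimately show ?thesis using nz by (auto simp: g_def)
qed

lemma cnt_interval: "cnt {a..b} e = Suc b - max a e"
proof -
  have "{x \<in> {a..b}. e \<le> x} = {max a e..b}" by auto
  then show ?thesis by (simp add: cnt_def)
qed

section \<open>The classification\<close>

lemma Q_trapezoid_step:
  assumes pq: "1 \<le> p" "p + q \<le> Suc m" "p \<le> m"
    and C: "C \<subseteq> {1..m}" and eq: "\<And>w. Qc w {p..m} {1..q} = Qc w C {}"
  shows "Qc w {p..Suc m} {1..q} = Qc w (insert (Suc m) C) {}"
proof -
  let ?A = "{p..Suc m}" and ?B = "{1..q}"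
  have A: "?A = insert (Suc m) {p..m}" using pq by auto
  have sub: "{p..m} \<subseteq> {1..m}" "?B \<subseteq> {1..m}" "?A \<subseteq> {1..Suc m}" "?B \<subseteq> {1..Suc m}" using pq by auto
  have BA: "inside ?B {p..m}" unfolding inside_def cnt_interval using pq by auto
  define g where "g D = comb (dual D) ?A ?B" for D
  have expand: "Qc w ?A ?B = (\<Sum>D\<in>Pow {1..Suc m}. g D * Qc w D {})" for w
    unfolding g_def by (rule Q_expansion[OF sub(3,4)])
  \<comment> \<open>Symmetry makes \<open>D\<close> the inner set and complementation makes it the
    outer one. The coefficient becomes a structure constant, and the complement of \<open>D\<close>
    contains \<open>Suc m\<close>, too large for \<open>product_top_part\<close>.\<close>
  have g0: "g D = 0" if D: "D \<in> Pow {1..m}" for D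
  proof (rule ccontr)
    assume nz: "g D \<noteq> 0"
    have DD: "D \<subseteq> {1..Suc m}" using D by auto
    have "g D = comb (dual ?B) ?A D"
      unfolding g_def using sub DD parts_subset by (intro coeff_symmetric) blast+
    also have "\<dots> = comb (dual ?B) ({1..Suc m} - D) ({1..Suc m} - ?A)"
      unfolding comb_def using strips_compl[OF sub(3) DD] by simp
    also have "{1..Suc m} - ?A = {1..p - 1}" using pq by auto
    finally have "{1..Suc m} - D \<subseteq> {1..q + (p - 1)}"
      using nz parts_subset[of "{1..Suc m} - D" "Suc m"]
      by (intro product_top_part[of ?B q "{1..p - 1}" "p - 1"]) auto
    moreover have "Suc m \<in> {1..Suc m} - D" using D by auto
    ultimately have "Suc m \<in> {1..q + (p - 1)}" by blast
    then show False using pq by auto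
  qed
  have sum: "Qc w ?A ?B = (\<Sum>D\<in>Pow {1..m}. g (insert (Suc m) D) * Qc w (insert (Suc m) D) {})" for w
    unfolding expand sum_Pow_Suc using g0 by (intro sum.cong) auto
  \<comment> \<open>All remaining terms share the part \<open>Suc m\<close>, so the top coefficient
    removes it from all of them at once and leaves an expansion of the known Q-function of
    \<open>C\<close>.\<close>
  have "Qc w C {} = (\<Sum>D\<in>Pow {1..m}. g (insert (Suc m) D) * Qc w D {})" for w
  proof -
    have "2 * Qc w C {} = Qc (Suc m # w) ?A ?B"
      unfolding A using Qc_insert_top(2)[OF sub(1,2) BA] eq by simp
    also have "\<dots> = (\<Sum>D\<in>Pow {1..m}. g (insert (Suc m) D) * (2 * Qc w D {}))"
      unfolding sum using Qc_insert_top(2)[of _ m "{}" w] by (intro sum.cong) auto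
    also have "\<dots> = 2 * (\<Sum>D\<in>Pow {1..m}. g (insert (Suc m) D) * Qc w D {})"
      by (simp add: sum_distrib_left mult.left_commute)
    finally show ?thesis by simp
  qed
  then have evC: "comb P C {} = (\<Sum>D\<in>Pow {1..m}. g (insert (Suc m) D) * comb P D {})" for P
    by (rule comb_linear)
  have "g (insert (Suc m) D) = of_bool (D = C)" if D: "D \<in> Pow {1..m}" for D
  proof -
    have "D \<subseteq> {1..m}" using D by simp
    then have "g (insert (Suc m) D) = comb (dual D) C {}"
      unfolding evC by (rule sum_comb_dual[symmetric])
    then show ?thesis using comb_dual[of D C] D C parts_subset by auto
  qed
  then have "Qc w ?A ?B = (\<Sum>D\<in>Pow {1..m}. if D = C then Qc w (insert (Suc m) C) {} else 0)"
    unfolding sum by (intro sum.cong) auto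
  then show ?thesis using C by simp
qed

text \<open>Without the part \<open>n\<close> there remains a smaller trapezoid or, if
  \<open>p + q = n\<close>, a parallelogram. The latter is empty for \<open>p = 1\<close>; otherwise
  its lowest diagonal is empty, and it is a translate of the parallelogram with \<open>p\<close> and
  \<open>q\<close> lowered by one.\<close>

lemma Q_trapezoid:
  assumes "1 \<le> p" "p + q \<le> n"
  shows "\<exists>C\<subseteq>{1..n}. \<forall>w. Qc w {p..n} {1..q} = Qc w C {}"
  using assms
proof (induction n arbitrary: p q rule: less_induct)
  case (less n)
  note pq = less.prems
  show ?case
  proof (cases "q = 0")
    case True
    then show ?thesis using pq by (intro exI[of _ "{p..n}"]) auto
  next
    case False
    obtain m where nm: "n = Suc m" using pq by (cases n) auto
    have pm: "p \<le> m" using pq False nm by simp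
    have "\<exists>C\<subseteq>{1..m}. \<forall>w. Qc w {p..m} {1..q} = Qc w C {}"
    proof (cases "p + q \<le> m")
      case True
      then show ?thesis using less.IH[of m p q] nm pq by simp
    next
      case F: False
      then have m: "Suc m = p + q" using pq nm by simp
      show ?thesis
      proof (cases "p = 1")
        case True
        then have pm1: "{p..m} = {1..q}" using m by simp
        have "\<forall>w. Qc w {1..q} {1..q} = Qc w {} {}"
          using Q_diagram_eq_iff[of "{1..q}" "{1..q}" "{}" "{}"] by (simp add: skew_def parts_def)
        then show ?thesis unfolding pm1 by blast
      next
        case p: False
        define n' where "n' = m - 2"
        have m2: "Suc n' = m - 1" "1 < m" using p pq False m by (auto simp: n'_def)
        have sub: "parts {p..m}" "parts {1..q}" using pq by (auto simp: parts_def)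
        have BA: "inside {1..q} {p..m}" unfolding inside_def cnt_interval using pq m by auto
        have d: "diags {p..m} {1..q} = {1<..m}"
          unfolding diags_def cnt_interval using pq m pm False p by (auto simp: max_def)
        have "Qc w {p..m} {1..q} = Qc w {p - 1..m - 1} {1..q - 1}" for w
        proof -
          have "insert (Suc n') {x \<in> {1..n'}. x + 1 \<in> {p..m}} = {p - 1..m - 1}"
            using m2 p pq pm m False by auto
          moreover have "{x \<in> {1..n'}. x + 1 \<in> {1..q}} = {1..q - 1}" using m2 p pq m by auto
          ultimately show ?thesis using slice_Qc[OF sub BA d m2(2,1) refl refl] by simp
        qed
        moreover have "\<exists>C\<subseteq>{1..m - 1}. \<forall>w. Qc w {p - 1..m - 1} {1..q - 1} = Qc w C {}"
          using nm p pq m False by (intro less.IH) auto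
        moreover have "{1..m - 1} \<subseteq> {1..m}" by auto
        ultimately show ?thesis by (metis subset_trans)
      qed
    qed
    then obtain C where C: "C \<subseteq> {1..m}" "\<And>w. Qc w {p..m} {1..q} = Qc w C {}" by blast
    have "Qc w {p..n} {1..q} = Qc w (insert (Suc m) C) {}" for w
      unfolding nm using pq nm pm C by (intro Q_trapezoid_step) auto
    moreover have "insert (Suc m) C \<subseteq> {1..n}" using C nm by auto
    ultimately show ?thesis by blast
  qed
qed


section \<open>Partitions as lists and as sets\<close>

lemma part_Cons: "part (x # xs) i = (if i = 1 then x else part xs (i - 1))"
  by (cases i; cases "i - 1") (auto simp: part_def)

text \<open>Both conditions say that the diagram has a box in row \<open>i\<close> on diagonal
  \<open>e\<close>.\<close>

lemma le_part_iff:
  assumes "sorted_wrt (>) lam" "1 \<le> i" "1 \<le> e"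
  shows "e \<le> part lam i \<longleftrightarrow> i \<le> cnt (set lam) e"
  using assms
proof (induction lam arbitrary: i)
  case Nil
  then show ?case by (simp add: part_def)
next
  case (Cons x xs)
  have c: "cnt (set (x # xs)) e = cnt (set xs) e + of_bool (e \<le> x)"
    using cnt_insert[of "set xs" x e] Cons.prems by auto
  show ?case
  proof (cases "e \<le> x")
    case True
    then show ?thesis using Cons.IH[of "i - 1"] Cons.prems c by (cases "i = 1") (auto simp: part_Cons)
  next
    case False
    then have z: "cnt (set xs) e = 0" using Cons.prems by (subst cnt_eq_0_iff) auto
    then show ?thesis using Cons.IH[of "i - 1"] Cons.prems c False by (cases "i = 1") (auto simp: part_Cons)
  qed
qed

lemma distinct_partition_parts: "distinct_partition lam \<Longrightarrow> parts (set lam)"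
  by (auto simp: distinct_partition_def parts_def)

lemma shifted_diagram_boxes:
  assumes "distinct_partition lam"
  shows "shifted_diagram lam = boxes (set lam)"
proof -
  have s: "sorted_wrt (>) lam" using assms by (simp add: distinct_partition_def)
  have "(x, y) \<in> shifted_diagram lam \<longleftrightarrow> (x, y) \<in> boxes (set lam)" for x y
  proof (cases "1 \<le> x \<and> x \<le> y")
    case True
    then obtain e i where ei: "(x, y) = box_at e i" "1 \<le> e" "1 \<le> i" using box_at_cases by blast
    have "box_at e i \<in> shifted_diagram lam \<longleftrightarrow> e \<le> part lam i"
    proof
      assume "box_at e i \<in> shifted_diagram lam"
      then show "e \<le> part lam i" by (auto simp: shifted_diagram_def box_at_def)
    next
      assume "e \<le> part lam i"
      then show "box_at e i \<in> shifted_diagram lam"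
        unfolding shifted_diagram_def box_at_def using ei
        by (intro CollectI exI[of _ i] exI[of _ "i + e - 1"]) auto
    qed
    then show ?thesis using le_part_iff[OF s ei(3,2)] ei by (simp add: box_at_mem)
  qed (auto simp: shifted_diagram_def boxes_mem)
  then show ?thesis by auto
qed

lemma skew_diagram_skew:
  "distinct_partition lam \<Longrightarrow> distinct_partition mu \<Longrightarrow> skew_diagram lam mu = skew (set lam) (set mu)"
  by (simp add: skew_diagram_def skew_def shifted_diagram_boxes)

lemma part_le_inside:
  assumes "distinct_partition lam" "distinct_partition mu" "part_le mu lam"
  shows "inside (set mu) (set lam)"
  unfolding inside_def
proof (intro allI impI)
  fix e :: nat assume e: "1 \<le> e"
  have s: "sorted_wrt (>) lam" "sorted_wrt (>) mu" using assms by (auto simp: distinct_partition_def)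
  show "cnt (set mu) e \<le> cnt (set lam) e"
  proof (cases "cnt (set mu) e = 0")
    case False
    define i where "i = cnt (set mu) e"
    have i: "1 \<le> i" using False by (simp add: i_def)
    have "e \<le> part mu i" using le_part_iff[OF s(2) i e] by (simp add: i_def)
    also have "\<dots> \<le> part lam i" using assms by (simp add: part_le_def)
    finally show ?thesis using le_part_iff[OF s(1) i e] by (simp add: i_def)
  qed simp
qed

definition parts_of :: "nat set \<Rightarrow> nat list" where
  "parts_of A = rev (sorted_list_of_set A)"

lemma parts_of:
  assumes "parts A"
  shows "distinct_partition (parts_of A)" "set (parts_of A) = A" "length (parts_of A) = card A"
  using assms by (auto simp: parts_of_def distinct_partition_def parts_def sorted_wrt_rev intro: gr0I)

lemma consecutive_partition:
  assumes "1 \<le> b"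
  shows "distinct_partition (consecutive a b)" "set (consecutive a b) = {b..a}"
  using assms by (auto simp: consecutive_def distinct_partition_def sorted_wrt_rev simp del: upt_Suc)

lemma schur_Q_skew: "distinct_partition nu \<Longrightarrow> schur_Q nu = Q_diagram (skew (set nu) {})"
  using skew_diagram_skew[of nu "[]"] by (simp add: schur_Q_def skew_Q_def distinct_partition_def)

lemma strange_iff_strange_pair:
  assumes lam: "distinct_partition lam" and mu: "distinct_partition mu" and le: "inside (set mu) (set lam)"
  shows "strange lam mu \<longleftrightarrow> strange_pair (set lam) (set mu)"
proof -
  note p = distinct_partition_parts[OF lam] distinct_partition_parts[OF mu]
  have Q: "skew_Q lam mu = Q_diagram (skew (set lam) (set mu))"
    by (simp add: skew_Q_def skew_diagram_skew[OF lam mu])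
  have iff: "skew_Q lam mu = schur_Q nu \<longleftrightarrow> (\<forall>w. Qc w (set lam) (set mu) = Qc w (set nu) {})"
    if nu: "distinct_partition nu" for nu
    unfolding Q schur_Q_skew[OF nu]
    using p distinct_partition_parts[OF nu] le by (intro Q_diagram_eq_iff) (auto simp: parts_def)
  show ?thesis
  proof
    assume "strange lam mu"
    then show "strange_pair (set lam) (set mu)"
      using iff distinct_partition_parts unfolding strange_def strange_pair_def by blast
  next
    assume "strange_pair (set lam) (set mu)"
    then obtain C where C: "parts C" "\<forall>w. Qc w (set lam) (set mu) = Qc w C {}" by (auto simp: strange_pair_def)
    then show "strange lam mu"
      unfolding strange_def using iff[of "parts_of C"] parts_of[OF C(1)] by auto
  qed
qed

theorem theorem6:
  fixes lam mu :: "nat list"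
  assumes "distinct_partition lam" and "distinct_partition mu" and "part_le mu lam"
  shows "strange lam mu \<longleftrightarrow>
    (\<exists>lam' mu' :: nat list. \<exists>a b :: int.
       distinct_partition lam' \<and> distinct_partition mu' \<and>
       skew_diagram lam mu = translate a b (skew_diagram lam' mu') \<and>
       (mu' = []
        \<or> (\<exists>m :: nat. lam' = consecutive m 1 \<and>
              shifted_diagram mu' \<subseteq> shifted_diagram lam' \<and>
              0 < length mu' \<and> length mu' < m - 1)
        \<or> (\<exists>p q r :: nat. 1 \<le> p \<and> 1 \<le> q \<and>
              lam' = consecutive (p + q + r) p \<and> mu' = consecutive q 1)
        \<or> (\<exists>p q r :: nat. 0 < p \<and> r < q \<and>
              lam' = consecutive (p + q) (p + q - r) \<and> mu' = consecutive q (q - r))))"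
    (is "_ \<longleftrightarrow> ?R")
proof
  define A B where "A = set lam" and "B = set mu"
  have p: "parts A" "parts B" and BA: "inside B A"
    using assms distinct_partition_parts part_le_inside by (auto simp: A_def B_def)
  have sk: "skew_diagram lam mu = skew A B" using assms skew_diagram_skew by (simp add: A_def B_def)
  assume "strange lam mu"
  then have s: "strange_pair A B" using assms BA strange_iff_strange_pair by (simp add: A_def B_def)
  show ?R
  proof (cases "A = B")
    case True
    then have "skew_diagram lam mu = translate 0 0 (skew_diagram [] [])"
      unfolding sk by (simp add: skew_def skew_diagram_def)
    then show ?thesis
      by (intro exI[of _ "[]"] exI[of _ 0]) (simp add: distinct_partition_def)
  next
    case False
    obtain U where U: "layer A B U" using layer_exists[OF p] by blast
    obtain f g where fg: "f < g" "diags A B = {f<..g}" by (rule strange_pair_interval[OF p BA s False U])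
    define n where "n = g - f - 1"
    have n: "Suc n = g - f" using fg by (simp add: n_def)
    define A1 where "A1 = {x \<in> {1..n}. x + f \<in> A}"
    define B1 where "B1 = {x \<in> {1..n}. x + f \<in> B}"
    note sl = slice[OF p BA fg(2,1) n A1_def B1_def]
    have "strange_pair (insert (Suc n) A1) B1"
      using s slice_Qc[OF p BA fg(2,1) n A1_def B1_def] by (simp add: strange_pair_def)
    then have cl: "B1 = {} \<or> insert (Suc n) A1 = {1..Suc n} \<or>
      (\<exists>p q. 1 \<le> p \<and> 1 \<le> q \<and> p + q \<le> Suc n \<and> insert (Suc n) A1 = {p..Suc n} \<and> B1 = {1..q})"
      by (rule strange_classification[OF sl(3-5)])
    obtain a b where ab: "skew_diagram lam mu = translate a b (skew (insert (Suc n) A1) B1)"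
      using sl(6) sk by auto
    have pA1: "parts (insert (Suc n) A1)" and pB1: "parts B1"
      using sl parts_insert_Suc parts_subset by blast+
    have le1: "inside B1 (insert (Suc n) A1)" by (rule inside_insert_Suc(1)[OF sl(3-5)])
    have T: "skew_diagram lam mu = translate a b (skew_diagram lam' mu')"
      if "distinct_partition lam'" "distinct_partition mu'" "set lam' = insert (Suc n) A1" "set mu' = B1" for lam' mu'
      using ab that by (simp add: skew_diagram_skew)
    note pp = parts_of[OF pA1] parts_of[OF pB1]
    from cl consider "B1 = {}" | "B1 \<noteq> {}" "insert (Suc n) A1 = {1..Suc n}" "card B1 < n"
      | p q where "1 \<le> p" "1 \<le> q" "p + q \<le> Suc n" "insert (Suc n) A1 = {p..Suc n}" "B1 = {1..q}"
    proof (elim disjE exE conjE)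
      assume *: "insert (Suc n) A1 = {1..Suc n}"
      have c: "card B1 \<le> n" using card_mono[of "{1..n}" B1] sl(4) by simp
      show thesis
      proof (cases "B1 = {} \<or> card B1 < n")
        case True
        then show ?thesis using that * by blast
      next
        case F: False
        \<comment> \<open>With \<open>n\<close> parts the length condition of the triangle family
          fails, but the pair is then a trapezoid with \<open>p = 1\<close> and
          \<open>q = n\<close>.\<close>
        then have "B1 = {1..n}" using c sl(4) card_subset_eq[of "{1..n}" B1] by simp
        moreover from this have "1 \<le> n" using F by (cases n) auto
        ultimately show ?thesis using that(3)[of 1 n] * by simp
      qed
    qed (use that in blast)+
    then show ?thesis
    proof cases
      case 1
      then have "parts_of B1 = []" using pp(6) by simp
      then show ?thesis using T[OF pp(1,4,2,5)] pp by metis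
    next
      case 2
      have c: "distinct_partition (consecutive (Suc n) 1)" "set (consecutive (Suc n) 1) = insert (Suc n) A1"
        using consecutive_partition[of 1 "Suc n"] 2 by auto
      have "shifted_diagram (parts_of B1) \<subseteq> shifted_diagram (consecutive (Suc n) 1)"
        using le1 pp c by (simp add: shifted_diagram_boxes boxes_subset_iff)
      moreover have "0 < length (parts_of B1)" "length (parts_of B1) < Suc n - 1"
        using 2 pp pB1 by (auto simp: card_gt_0_iff)
      ultimately show ?thesis
        using T[OF c(1) pp(4) c(2) pp(5)] c(1) pp(4) by blast
    next
      case 3
      define r where "r = Suc n - (p + q)"
      have r: "p + q + r = Suc n" using 3 by (simp add: r_def)
      have c: "distinct_partition (consecutive (p + q + r) p)" "set (consecutive (p + q + r) p) = insert (Suc n) A1"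
        "distinct_partition (consecutive q 1)" "set (consecutive q 1) = B1"
        using consecutive_partition[of p "p + q + r"] consecutive_partition[of 1 q] 3 r by auto
      show ?thesis using T[OF c(1,3,2,4)] c(1,3) 3(1,2) by blast
    qed
  qed
next
  assume ?R
  then obtain lam' mu' a b where d: "distinct_partition lam'" "distinct_partition mu'"
    and t: "skew_diagram lam mu = translate a b (skew_diagram lam' mu')"
    and cs: "mu' = []
        \<or> (\<exists>m :: nat. lam' = consecutive m 1 \<and>
              shifted_diagram mu' \<subseteq> shifted_diagram lam' \<and>
              0 < length mu' \<and> length mu' < m - 1)
        \<or> (\<exists>p q r :: nat. 1 \<le> p \<and> 1 \<le> q \<and>
              lam' = consecutive (p + q + r) p \<and> mu' = consecutive q 1)
        \<or> (\<exists>p q r :: nat. 0 < p \<and> r < q \<and>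
              lam' = consecutive (p + q) (p + q - r) \<and> mu' = consecutive q (q - r))"
    by blast
  have Q: "skew_Q lam mu = skew_Q lam' mu'" unfolding skew_Q_def t by (rule Q_diagram_translate)
  have "inside (set mu') (set lam') \<and> strange_pair (set lam') (set mu')"
    using cs
  proof (elim disjE exE conjE)
    assume "mu' = []"
    then show ?thesis using distinct_partition_parts[OF d(1)] by (auto simp: strange_pair_def)
  next
    fix m assume m: "lam' = consecutive m 1" "shifted_diagram mu' \<subseteq> shifted_diagram lam'"
    have A: "set lam' = {1..m}" using m consecutive_partition[of 1 m] by simp
    have le: "inside (set mu') {1..m}" using m(2) d A by (simp add: shifted_diagram_boxes boxes_subset_iff)
    then have B: "set mu' \<subseteq> {1..m}"
      using cnt_le_subset[of "{1..m}" m] distinct_partition_parts[OF d(2)] by (auto simp: inside_def)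
    \<comment> \<open>The complement of the outer set is empty, so reflection gives a straight
      diagram.\<close>
    have "Qc w {1..m} (set mu') = Qc w ({1..m} - set mu') {}" for w
      using strips_compl[OF subset_refl B, of "map delta w"] by simp
    moreover have "parts ({1..m} - set mu')" by (rule parts_subset[of _ m]) auto
    ultimately show ?thesis using le A by (auto simp: strange_pair_def)
  next
    fix p q r :: nat assume h: "1 \<le> p" "1 \<le> q" "lam' = consecutive (p + q + r) p" "mu' = consecutive q 1"
    have AB: "set lam' = {p..p + q + r}" "set mu' = {1..q}"
      using h consecutive_partition[of p] consecutive_partition[of 1] by auto
    have "inside {1..q} {p..p + q + r}" unfolding inside_def cnt_interval using h by auto
    moreover have "strange_pair {p..p + q + r} {1..q}"
      unfolding strange_pair_def using Q_trapezoid[of p q "p + q + r"] h parts_subset by auto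
    ultimately show ?thesis using AB by simp
  next
    fix p q r :: nat
    assume h: "0 < p" "r < q" "lam' = consecutive (p + q) (p + q - r)" "mu' = consecutive q (q - r)"
    let ?A = "{p + q - r..p + q}" and ?B = "{q - r..q}"
    have AB: "set lam' = ?A" "set mu' = ?B"
      using h consecutive_partition[of "p + q - r"] consecutive_partition[of "q - r"] by auto
    have ps: "parts ?A" "parts ?B" using h by (auto simp: parts_def)
    have le: "inside ?B ?A" unfolding inside_def cnt_interval using h by auto
    \<comment> \<open>Shifting by \<open>q - r\<close> diagonals turns the parallelogram into
      \<open>{p..p + r}\<close> over \<open>{1..r}\<close>; the smallest inner part becomes 0 and
      disappears.\<close>
    have dg: "diags ?A ?B = {q - r<..p + q}"
      unfolding diags_def cnt_interval using h by (auto simp: max_def)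
    define n where "n = p + r - 1"
    have n: "q - r < p + q" "Suc n = p + q - (q - r)" using h by (auto simp: n_def)
    have "insert (Suc n) {x \<in> {1..n}. x + (q - r) \<in> ?A} = {p..p + r}" using h n by auto
    moreover have "{x \<in> {1..n}. x + (q - r) \<in> ?B} = {1..r}" using h n by auto
    ultimately have "Qc w ?A ?B = Qc w {p..p + r} {1..r}" for w
      using slice_Qc[OF ps le dg n refl refl] by simp
    then have "strange_pair ?A ?B"
      unfolding strange_pair_def using Q_trapezoid[of p r "p + r"] h parts_subset by auto
    then show ?thesis using le AB by simp
  qed
  then have "strange lam' mu'" using strange_iff_strange_pair[OF d] by blast
  then show "strange lam mu" using Q by (simp add: strange_def)
qed

end
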